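(* Let $p \in \mathbb{R}[x_1,x_2]$ be an irreducible $RZ_{x^0}$ polynomial of degree $m$ with $p(x^0)=1$, where $x^0=(x^0_1,x^0_2) \in \mathbb{R}^2$. Let $P \in \mathbb{R}[X_0,X_1,X_2]$ be the homogenization of $p$, let $\nu \colon \widetilde{\mathcal V}_P \to \mathcal V_P$ be the desingularization of the corresponding complex projective curve $\mathcal V_P=\{[X]\in\mathbb{P}^2(\mathbb{C}) : P(X)=0\}$, and let $\Delta$ be the adjoint divisor on $\widetilde{\mathcal V}_P$. Let $Q \in \mathbb{R}[X_0,X_1,X_2]$ be a homogeneous polynomial of degree $m-1$ that interlaces $P$ and that vanishes on the adjoint divisor: $(\nu^* Q) \geq \Delta$. Then there exist complex hermitian $m \times m$ matrices $A_0,A_1,A_2$ with $A_0+x^0_1A_1+x^0_2A_2=I$ such that $$\det(A_0+x_1A_1+x_2A_2)=p(x_1,x_2)$$ and such that the first principal minor of $A_0+x_1A_1+x_2A_2$ (the determinant of the matrix obtained by removing the first row and the first column) equals $Q(1,x_1,x_2)$.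
   Context: A polynomial $p \in \mathbb{R}[x_1,\ldots,x_d]$ is a $RZ_{x^0}$ (real zero) polynomial, where $x^0 \in \mathbb{R}^d$, if for every $x \in \mathbb{R}^d$ the univariate polynomial $t \mapsto p(x^0+tx)$ has only real zeroes. If $p$ has degree $m$, its homogenization is $P(X_0,\ldots,X_d)=X_0^m\, p(X_1/X_0,\ldots,X_d/X_0)$. Interlacing: let $p \in \mathbb{R}[x_1,\ldots,x_d]$ be a reduced (no multiple irreducible factors) $RZ_{x^0}$ polynomial of degree $m$ with $p(x^0)\neq 0$ and homogenization $P$, let $X^0=(1,x^0)$, and let $Q \in \mathbb{R}[X_0,\ldots,X_d]$ be homogeneous of degree $m-1$ and relatively prime to $P$. Then $Q$ interlaces $P$ if for a general $X \in \mathbb{R}^{d+1}$ there is a zero of the univariate polynomial $s\mapsto Q(X+sX^0)$ in the open interval between any two zeroes of $s \mapsto P(X+sX^0)$. Alternatively, for any $X \in \mathbb{R}^{d+1}$, $s_1 \le s_1' \le s_2 \le \cdots \le s_{m-1} \le s_{m-1}' \le s_m$, where $s_1,\ldots,s_m$ are the zeroes of $P(X+sX^0)$ and $s'_1,\ldots,s'_{m-1}$ are the zeroes of $Q(X+sX^0)$, counting multiplicities. Adjoint divisor: $\nu\colon \widetilde{\mathcal V}_P\to\mathcal V_P$ is the normalization (desingularization), so $\widetilde{\mathcal V}_P$ is a compact Riemann surface. For a singular point $\lambda$ of $\mathcal V_P$ lying in the affine plane $\mathbb{C}^2\subset\mathbb{P}^2(\mathbb{C})$ (otherwise use different affine coordinates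 near $\lambda$) and for $\mu \in \nu^{-1}(\lambda)$, let $m_\mu$ be the order of the pole at $\mu$ of the differential $\nu^*\left(\frac{dx_1}{\partial p/\partial x_2}\right) = -\nu^*\left(\frac{dx_2}{\partial p/\partial x_1}\right)$. The adjoint divisor is $\Delta=\sum_{\lambda}\sum_{\mu\in\nu^{-1}(\lambda)} m_\mu\,\mu$, the outer sum being over all singular points $\lambda$ of $\mathcal V_P$. For a homogeneous polynomial $Q$ not vanishing identically on $\mathcal V_P$, $(\nu^*Q)$ denotes the effective divisor on $\widetilde{\mathcal V}_P$ of zeroes (with orders) of the pullback of $Q$ under $\nu$.
   Formalization: The normalization Q(1,x^0_1,x^0_2)=1 is added as a hypothesis: the conclusion forces it, since the matrix at x^0 is I, and without it the claim fails (e.g. m=1, p=1+x_1, x^0=0, Q=2). *)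

theory Defs
  imports
    "HOL-Complex_Analysis.Complex_Analysis"
    "Jordan_Normal_Form.Schur_Decomposition"
begin

section \<open>Polynomials in two and three variables\<close>

text \<open>
  R[x1,x2] is \<open>real poly poly\<close> and R[X0,X1,X2] is \<open>real poly poly poly\<close>; the outermost
  polynomial variable is the first one, so \<open>coeff (coeff p i) j\<close> is the coefficient of
  x1^i x2^j and \<open>coeff (coeff (coeff P i) j) k\<close> that of X0^i X1^j X2^k.  Evaluation is
  polymorphic, to serve for both real and complex arguments.
\<close>

definition eval2 :: "real poly poly \<Rightarrow> 'b::real_field \<Rightarrow> 'b \<Rightarrow> 'b" where
  "eval2 p x1 x2 = poly (poly (map_poly (map_poly of_real) p) [:x1:]) x2"

definition eval3 :: "real poly poly poly \<Rightarrow> 'b::real_field \<Rightarrow> 'b \<Rightarrow> 'b \<Rightarrow> 'b" where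
  "eval3 P x0 x1 x2 =
     poly (poly (poly (map_poly (map_poly (map_poly of_real)) P) [:[:x0:]:]) [:x1:]) x2"

text \<open>Meaningful for nonzero \<open>p\<close> only.\<close>

definition total_degree :: "real poly poly \<Rightarrow> nat" where
  "total_degree p = Max {i + j | i j. coeff (coeff p i) j \<noteq> 0}"

definition homogeneous :: "nat \<Rightarrow> real poly poly poly \<Rightarrow> bool" where
  "homogeneous d P \<longleftrightarrow> (\<forall>i j k. coeff (coeff (coeff P i) j) k \<noteq> 0 \<longrightarrow> i + j + k = d)"

text \<open>A term c x1^i x2^j of \<open>p\<close> becomes c X0^(m-i-j) X1^i X2^j, with m the total degree.\<close>

definition homogenization :: "real poly poly \<Rightarrow> real poly poly poly" where
  "homogenization p =
     (\<Sum>i\<le>degree p. \<Sum>j\<le>degree (coeff p i).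
        monom (monom (monom (coeff (coeff p i) j) j) i) (total_degree p - i - j))"

text \<open>\<open>partial3 i P\<close>, for i < 3, is the partial derivative of \<open>P\<close> with respect to Xi.\<close>

definition partial3 :: "nat \<Rightarrow> real poly poly poly \<Rightarrow> real poly poly poly" where
  "partial3 i P =
     (if i = 0 then pderiv P
      else if i = 1 then map_poly pderiv P
      else map_poly (map_poly pderiv) P)"


section \<open>Real zero polynomials and interlacing\<close>

definition real_zero_poly :: "real \<Rightarrow> real \<Rightarrow> real poly poly \<Rightarrow> bool" where
  "real_zero_poly a1 a2 p \<longleftrightarrow>
     (\<forall>x1 x2 :: real. \<forall>t :: complex.
        eval2 p (of_real a1 + t * of_real x1) (of_real a2 + t * of_real x2) = 0 \<longrightarrow> t \<in> \<real>)"

text \<open>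
  Interlacing with respect to X^0 = (1,a1,a2).  ``For a general X'' means: for all X outside the
  zero set of some nonzero polynomial \<open>G\<close>.
\<close>

definition interlaces ::
    "real \<Rightarrow> real \<Rightarrow> real poly poly poly \<Rightarrow> real poly poly poly \<Rightarrow> bool" where
  "interlaces a1 a2 Q P \<longleftrightarrow>
     coprime Q P \<and>
     (\<exists>G. G \<noteq> 0 \<and>
       (\<forall>X0 X1 X2 :: real. eval3 G X0 X1 X2 \<noteq> 0 \<longrightarrow>
          (\<forall>s1 s2 :: real. s1 < s2 \<and>
             eval3 P (X0 + s1) (X1 + s1 * a1) (X2 + s1 * a2) = 0 \<and>
             eval3 P (X0 + s2) (X1 + s2 * a1) (X2 + s2 * a2) = 0 \<longrightarrow>
             (\<exists>s. s1 < s \<and> s < s2 \<and>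
               eval3 Q (X0 + s) (X1 + s * a1) (X2 + s * a2) = 0))))"


section \<open>Plane projective curves\<close>

text \<open>A point of the complex projective plane is the set of all its homogeneous coordinates.\<close>

type_synonym ppoint = "(complex \<times> complex \<times> complex) set"

definition proj_point :: "complex \<Rightarrow> complex \<Rightarrow> complex \<Rightarrow> ppoint" where
  "proj_point a b c = {(l * a, l * b, l * c) | l. l \<noteq> 0}"

definition proj_curve :: "real poly poly poly \<Rightarrow> ppoint set" where
  "proj_curve P = {proj_point a b c | a b c. (a, b, c) \<noteq> 0 \<and> eval3 P a b c = 0}"

definition singular_points :: "real poly poly poly \<Rightarrow> ppoint set" where
  "singular_points P =
     {proj_point a b c | a b c. (a, b, c) \<noteq> 0 \<and> eval3 P a b c = 0 \<and>
        (\<forall>i<3. eval3 (partial3 i P) a b c = 0)}"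


section \<open>Riemann surfaces and desingularization\<close>

text \<open>
  A chart is a pair of its domain and the coordinate function, whose values outside
  the domain are irrelevant.
\<close>

type_synonym 'a chart = "'a set \<times> ('a \<Rightarrow> complex)"

definition riemann_surface :: "'a topology \<Rightarrow> 'a chart set \<Rightarrow> bool" where
  "riemann_surface S \<A> \<longleftrightarrow>
     connected_space S \<and> Hausdorff_space S \<and> second_countable S \<and>
     \<Union> (fst ` \<A>) = topspace S \<and>
     (\<forall>(U, \<phi>) \<in> \<A>. openin S U \<and> open (\<phi> ` U) \<and>
        homeomorphic_map (subtopology S U) (top_of_set (\<phi> ` U)) \<phi>) \<and>
     (\<forall>(U, \<phi>) \<in> \<A>. \<forall>(V, \<psi>) \<in> \<A>. (\<psi> \<circ> inv_into U \<phi>) holomorphic_on (\<phi> ` (U \<inter> V)))"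

text \<open>
  \<open>local_lift U \<phi> \<nu> \<mu> F\<close>: in the coordinate of the chart \<open>(U, \<phi>)\<close>, the map \<open>\<nu>\<close> into the projective
  plane is [F 0 : F 1 : F 2] near \<open>\<mu>\<close>, with holomorphic F i having no common zero.
\<close>

definition local_lift ::
    "'a set \<Rightarrow> ('a \<Rightarrow> complex) \<Rightarrow> ('a \<Rightarrow> ppoint) \<Rightarrow> 'a \<Rightarrow> (nat \<Rightarrow> complex \<Rightarrow> complex) \<Rightarrow> bool" where
  "local_lift U \<phi> \<nu> \<mu> F \<longleftrightarrow>
     \<mu> \<in> U \<and>
     (\<exists>W. open W \<and> \<phi> \<mu> \<in> W \<and> W \<subseteq> \<phi> ` U \<and> (\<forall>i<3. F i holomorphic_on W) \<and>
        (\<forall>z\<in>W. (F 0 z, F 1 z, F 2 z) \<noteq> 0 \<and>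
           \<nu> (inv_into U \<phi> z) = proj_point (F 0 z) (F 1 z) (F 2 z)))"

definition holomorphic_to_CP2 :: "'a chart set \<Rightarrow> ('a \<Rightarrow> ppoint) \<Rightarrow> bool" where
  "holomorphic_to_CP2 \<A> \<nu> \<longleftrightarrow> (\<forall>(U, \<phi>) \<in> \<A>. \<forall>\<mu>\<in>U. \<exists>F. local_lift U \<phi> \<nu> \<mu> F)"

text \<open>
  The normalization (desingularization) of the plane curve of \<open>P\<close> as in Griffiths, Introduction to
  Algebraic Curves: a compact Riemann surface with a holomorphic map onto the curve that has
  finitely many points over the singular points and is one-to-one over the others.
  It is unique up to isomorphism over the curve.
\<close>

definition desingularization ::
    "real poly poly poly \<Rightarrow> 'a topology \<Rightarrow> 'a chart set \<Rightarrow> ('a \<Rightarrow> ppoint) \<Rightarrow> bool" where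
  "desingularization P S \<A> \<nu> \<longleftrightarrow>
     riemann_surface S \<A> \<and> compact_space S \<and>
     holomorphic_to_CP2 \<A> \<nu> \<and>
     \<nu> ` topspace S = proj_curve P \<and>
     finite {\<mu> \<in> topspace S. \<nu> \<mu> \<in> singular_points P} \<and>
     inj_on \<nu> {\<mu> \<in> topspace S. \<nu> \<mu> \<notin> singular_points P}"


section \<open>Divisors\<close>

text \<open>
  Divisors are integer-valued functions on the points of the Riemann surface (0 off the carrier),
  compared pointwise.  The orders below depend neither on the chart nor on the
  lift (nor on the affine coordinates), which the description by \<open>THE\<close> relies on.
\<close>

definition pullback_order ::
    "'a chart set \<Rightarrow> ('a \<Rightarrow> ppoint) \<Rightarrow> real poly poly poly \<Rightarrow> 'a \<Rightarrow> int" where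
  "pullback_order \<A> \<nu> Q \<mu> =
     (THE n. \<exists>U \<phi> F. (U, \<phi>) \<in> \<A> \<and> local_lift U \<phi> \<nu> \<mu> F \<and>
        n = zorder (\<lambda>z. eval3 Q (F 0 z) (F 1 z) (F 2 z)) (\<phi> \<mu>))"

definition pullback_divisor ::
    "'a topology \<Rightarrow> 'a chart set \<Rightarrow> ('a \<Rightarrow> ppoint) \<Rightarrow> real poly poly poly \<Rightarrow> 'a \<Rightarrow> int" where
  "pullback_divisor S \<A> \<nu> Q \<mu> = (if \<mu> \<in> topspace S then pullback_order \<A> \<nu> Q \<mu> else 0)"

text \<open>
  The order of the pole at \<open>\<mu>\<close> of the pullback of dx / (\<partial>f/\<partial>y), where x = Xi/Xk and y = Xj/Xk are
  affine coordinates near the point \<open>\<nu> \<mu>\<close> and f is \<open>P\<close> with Xk = 1; thus \<partial>f/\<partial>y is the partial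
  derivative of \<open>P\<close> with respect to Xj, evaluated at Xk = 1.  For k = 0, i = 1, j = 2 and P the
  homogenization of p, this is dx1 / (\<partial>p/\<partial>x2).
\<close>

definition adjoint_order ::
    "'a chart set \<Rightarrow> ('a \<Rightarrow> ppoint) \<Rightarrow> real poly poly poly \<Rightarrow> 'a \<Rightarrow> int" where
  "adjoint_order \<A> \<nu> P \<mu> =
     (THE n. \<exists>U \<phi> F i j k. (U, \<phi>) \<in> \<A> \<and> local_lift U \<phi> \<nu> \<mu> F \<and>
        {i, j, k} = {0, 1, 2} \<and> F k (\<phi> \<mu>) \<noteq> 0 \<and>
        n = - zorder (\<lambda>z. deriv (\<lambda>w. F i w / F k w) z /
                 eval3 (partial3 j P) (F 0 z / F k z) (F 1 z / F k z) (F 2 z / F k z)) (\<phi> \<mu>))"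

definition adjoint_divisor ::
    "'a topology \<Rightarrow> 'a chart set \<Rightarrow> ('a \<Rightarrow> ppoint) \<Rightarrow> real poly poly poly \<Rightarrow> 'a \<Rightarrow> int" where
  "adjoint_divisor S \<A> \<nu> P \<mu> =
     (if \<mu> \<in> topspace S \<and> \<nu> \<mu> \<in> singular_points P then adjoint_order \<A> \<nu> P \<mu> else 0)"


section \<open>Hermitian matrices\<close>

definition hermitian_mat :: "nat \<Rightarrow> complex mat \<Rightarrow> bool" where
  "hermitian_mat n A \<longleftrightarrow> A \<in> carrier_mat n n \<and> mat_adjoint A = A"

end

theory Submission
  imports Defs "HOL-Computational_Algebra.Field_as_Ring"
begin

unbundle no vec_syntax
unbundle no fps_syntax
hide_const (open) Determinants.det Module.module.smult

text \<open>
  Restrict \<open>P\<close> and \<open>Q\<close> to the lines \<open>s \<mapsto> Y + s (1, a1, a2)\<close>, where \<open>Y = (0, u, 1 + u \<beta>)\<close> with a generic slope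
  \<open>\<beta>\<close>; this gives \<open>f\<close> and \<open>q\<close>, monic in \<open>s\<close> with coefficients polynomial in \<open>u\<close>.  For almost all real
  \<open>u\<close> the zeros of \<open>f\<close> are real and simple, and interlacing says that \<open>q / f\<close> is a sum of fractions
  \<open>\<omega>\<^sub>i / (s - s\<^sub>i)\<close> with \<open>\<omega>\<^sub>i > 0\<close>.  Hence the Hankel matrix \<open>H\<close> of the coefficients of \<open>q / f\<close> at infinity is
  positive definite, and the companion matrix \<open>B\<close> of \<open>f\<close> is self-adjoint for \<open>H\<close>: \<open>H B = B\<^sup>* H\<close>.

  Over the polynomials in \<open>u\<close> the form \<open>H\<close> need not be unimodular.  If \<open>det H\<close> vanishes at \<open>c\<close>, then the
  kernel of \<open>H c\<close> is invariant under \<open>B c\<close> and so contains an eigenvector \<open>v\<close>.  Adjoining \<open>v / (u - c)\<close> to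
  the lattice keeps \<open>H\<close> and \<open>B\<close> polynomial (for real \<open>c\<close> by positivity) and lowers the degree of \<open>det H\<close>
  by two.  Degrees are measured against weights of the basis vectors, initially \<open>0, \<dots>, m - 1\<close>, and
  each step lowers one weight.  At the end all weights are zero: \<open>H\<close> is constant, \<open>B\<close> is linear in \<open>u\<close>, and
  an orthonormal basis makes \<open>B\<close> a hermitian pencil.  The first basis vector \<open>1\<close> has weight 0 and norm 1
  throughout, so \<open>q / f\<close> remains the upper left entry of the resolvent of \<open>B\<close>, and \<open>q\<close> is the first
  principal minor.
\<close>

section \<open>Congruence of matrices\<close>

text \<open>What the overview leaves open is why the descent cannot stop early. A step needs a zero
  of \<open>det H\<close>, so as long as a weight is positive, \<open>det H\<close> must not be
  constant; the invariant is that its degree is at least twice the sum of the weights. Entry (a, b)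
  of the initial \<open>H\<close> has degree at most a + b, hence \<open>det H\<close> has degree at
  most m (m - 1), which is exactly twice 0 + ... + (m - 1), and its coefficient there is the
  determinant of the top coefficients. These form a Hankel matrix again, that of the limiting line u
  = \<infinity> through (0, 1, \<beta>). So interlacing is also required in the direction \<beta>
  itself, and \<beta> is chosen outside a finite set of bad directions.

  That \<open>f\<close> and \<open>q\<close> are monic comes from the normalizations p(a1, a2) = 1
  and Q(1, a1, a2) = 1, the values at the direction of the lines. The zeros of \<open>det H\<close>
  and the eigenvectors over them are complex in general; this is why real data lead to hermitian and
  not to real symmetric matrices.\<close>

definition ctr :: "complex mat \<Rightarrow> complex mat" where
  "ctr A = mat (dim_col A) (dim_row A) (\<lambda>(i, j). cnj (A $$ (j, i)))"

lemma ctr_carrier [simp, intro]: "A \<in> carrier_mat n k \<Longrightarrow> ctr A \<in> carrier_mat k n"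
  by (auto simp: ctr_def)

lemma ctr_index [simp]: "i < dim_col A \<Longrightarrow> j < dim_row A \<Longrightarrow> ctr A $$ (i, j) = cnj (A $$ (j, i))"
  by (simp add: ctr_def)

lemma ctr_dim [simp]: "dim_row (ctr A) = dim_col A" "dim_col (ctr A) = dim_row A"
  by (simp_all add: ctr_def)

lemma ctr_ctr [simp]: "ctr (ctr A) = A"
  by (rule eq_matI) auto

lemma mult_mat_index_sum:
  assumes "A \<in> carrier_mat n k" "B \<in> carrier_mat k l" "i < n" "j < l"
  shows "(A * B) $$ (i, j) = (\<Sum>c<k. A $$ (i, c) * B $$ (c, j))"
  using assms by (auto simp: scalar_prod_def atLeast0LessThan intro!: sum.cong)

lemma ctr_mult:
  assumes "A \<in> carrier_mat n k" "B \<in> carrier_mat k l"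
  shows "ctr (A * B) = ctr B * ctr A"
proof (rule eq_matI)
  fix i j assume "i < dim_row (ctr B * ctr A)" "j < dim_col (ctr B * ctr A)"
  then have ij: "i < l" "j < n" using assms by auto
  have "ctr (A * B) $$ (i, j) = cnj ((A * B) $$ (j, i))" using assms ij by auto
  also have "\<dots> = (\<Sum>c<k. cnj (A $$ (j, c)) * cnj (B $$ (c, i)))"
    using assms ij by (simp add: mult_mat_index_sum del: index_mult_mat)
  also have "\<dots> = (\<Sum>c<k. ctr B $$ (i, c) * ctr A $$ (c, j))"
    using assms ij by (intro sum.cong) (auto simp: mult.commute)
  also have "\<dots> = (ctr B * ctr A) $$ (i, j)"
    using assms ij by (subst mult_mat_index_sum[of _ l k _ n]) auto
  finally show "ctr (A * B) $$ (i, j) = (ctr B * ctr A) $$ (i, j)" .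
qed (use assms in auto)

lemma ctr_one [simp]: "ctr (1\<^sub>m n) = 1\<^sub>m n"
  by (rule eq_matI) auto

lemma ctr_add:
  "A \<in> carrier_mat n k \<Longrightarrow> B \<in> carrier_mat n k \<Longrightarrow> ctr (A + B) = ctr A + ctr B"
  by (rule eq_matI) auto

lemma ctr_smult: "ctr (c \<cdot>\<^sub>m A) = cnj c \<cdot>\<^sub>m ctr A"
  by (rule eq_matI) auto

lemma det_ctr:
  assumes "A \<in> carrier_mat n n"
  shows "det (ctr A) = cnj (det A)"
proof -
  interpret cnj_hom: comm_ring_hom cnj by standard auto
  have "ctr A = map_mat cnj (transpose_mat A)" by (rule eq_matI) auto
  then show ?thesis using assms by (simp add: det_transpose cnj_hom.hom_det)
qed

lemma hermitian_mat_ctr: "hermitian_mat n A \<longleftrightarrow> A \<in> carrier_mat n n \<and> ctr A = A"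
proof -
  have "mat_adjoint A = ctr A" if "A \<in> carrier_mat n n"
    using that by (intro eq_matI) (auto simp: mat_adjoint_def mat_of_rows_def)
  then show ?thesis by (auto simp: hermitian_mat_def)
qed

text \<open>Test vectors are functions on indices, so that the form is a plain double sum.
  Positivity is asked of the real part; that the form is hermitian is a separate clause of
  \<open>positive_pair\<close>.\<close>

definition posdef :: "nat \<Rightarrow> complex mat \<Rightarrow> bool" where
  "posdef n A \<longleftrightarrow> (\<forall>v :: nat \<Rightarrow> complex. (\<exists>a<n. v a \<noteq> 0) \<longrightarrow>
     0 < Re (\<Sum>a<n. \<Sum>b<n. cnj (v a) * A $$ (a, b) * v b))"

lemma ctr_mult_mult_index:
  assumes "A \<in> carrier_mat n n" "W \<in> carrier_mat n k" "V \<in> carrier_mat n l" "i < k" "j < l"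
  shows "(ctr W * A * V) $$ (i, j) = (\<Sum>a<n. \<Sum>b<n. cnj (W $$ (a, i)) * A $$ (a, b) * V $$ (b, j))"
proof -
  have "(ctr W * A * V) $$ (i, j) = (\<Sum>b<n. (\<Sum>a<n. cnj (W $$ (a, i)) * A $$ (a, b)) * V $$ (b, j))"
    using assms by (subst mult_mat_index_sum[of _ k n _ l])
      (auto simp: mult_mat_index_sum[of _ k n _ n] simp del: index_mult_mat(1) intro!: sum.cong)
  also have "\<dots> = (\<Sum>a<n. \<Sum>b<n. cnj (W $$ (a, i)) * A $$ (a, b) * V $$ (b, j))"
    by (subst sum.swap) (simp add: sum_distrib_right)
  finally show ?thesis .
qed

text \<open>The form of \<open>ctr T * H * T\<close> at \<open>v\<close> is the form of
  \<open>H\<close> at T v, which is nonzero because \<open>T\<close> is invertible. Writing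
  \<open>v\<close> as a one-column matrix reduces this to associativity.\<close>

lemma posdef_congruence:
  assumes "posdef n H" "H \<in> carrier_mat n n" "T \<in> carrier_mat n n" "det T \<noteq> 0"
  shows "posdef n (ctr T * H * T)"
  unfolding posdef_def
proof (intro allI impI)
  fix v :: "nat \<Rightarrow> complex" assume v: "\<exists>a<n. v a \<noteq> 0"
  define V where "V = mat n 1 (\<lambda>(i, j). v i)"
  have V: "V \<in> carrier_mat n 1" by (simp add: V_def)
  define x where "x = (\<lambda>a. (T * V) $$ (a, 0))"
  have TV: "T * V \<in> carrier_mat n 1" using assms V by auto
  have "\<exists>a<n. x a \<noteq> 0"
  proof (rule ccontr)
    assume "\<not> ?thesis"
    then have x0: "x a = 0" if "a < n" for a using that by auto
    have "T *\<^sub>v vec n v = 0\<^sub>v n"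
    proof (rule eq_vecI)
      fix a assume "a < dim_vec (0\<^sub>v n :: complex vec)"
      then have a: "a < n" by simp
      have "(T *\<^sub>v vec n v) $ a = x a"
        using a assms(3) by (simp add: x_def V_def scalar_prod_def)
      then show "(T *\<^sub>v vec n v) $ a = 0\<^sub>v n $ a" using x0[OF a] a by simp
    qed (use assms in auto)
    moreover have "vec n v \<noteq> 0\<^sub>v n" using v by (metis index_vec index_zero_vec(1))
    ultimately show False
      using assms(4) det_0_iff_vec_prod_zero_field[OF assms(3)] vec_carrier[of n v] by blast
  qed
  then have "0 < Re (\<Sum>a<n. \<Sum>b<n. cnj (x a) * H $$ (a, b) * x b)"
    using assms(1) by (auto simp: posdef_def)
  also have "(\<Sum>a<n. \<Sum>b<n. cnj (x a) * H $$ (a, b) * x b) = (ctr (T * V) * H * (T * V)) $$ (0, 0)"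
    using TV assms by (subst ctr_mult_mult_index[of _ n _ 1 _ 1]) (auto simp: x_def)
  also have "ctr (T * V) * H * (T * V) = ctr V * (ctr T * H * T) * V"
  proof -
    have "ctr (T * V) = ctr V * ctr T" using ctr_mult[OF assms(3) V] .
    moreover have "ctr V * ctr T * H * (T * V) = ctr V * ctr T * H * T * V"
      using assms V by (subst assoc_mult_mat[of _ 1 n T n V 1, symmetric]) (auto intro!: mult_carrier_mat)
    moreover have "ctr V * ctr T * H = ctr V * (ctr T * H)"
      using assms V by (subst assoc_mult_mat[of _ 1 n _ n _ n]) (auto intro!: mult_carrier_mat)
    moreover have "ctr V * (ctr T * H) * T = ctr V * (ctr T * H * T)"
      using assms V by (subst assoc_mult_mat[of _ 1 n _ n _ n]) (auto intro!: mult_carrier_mat)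
    ultimately show ?thesis by simp
  qed
  also have "(ctr V * (ctr T * H * T) * V) $$ (0, 0) =
      (\<Sum>a<n. \<Sum>b<n. cnj (v a) * (ctr T * H * T) $$ (a, b) * v b)"
  proof -
    have "ctr T * H * T \<in> carrier_mat n n" using assms by (auto intro!: mult_carrier_mat)
    then show ?thesis using V
      by (subst ctr_mult_mult_index[of _ n _ 1 _ 1]) (auto simp: V_def intro!: sum.cong)
  qed
  finally show "0 < Re (\<Sum>a<n. \<Sum>b<n. cnj (v a) * (ctr T * H * T) $$ (a, b) * v b)" .
qed

text \<open>The columns of \<open>T\<close> are the new basis in old coordinates;
  \<open>T * B' = B * T\<close> says without an inverse that \<open>B'\<close> is the operator in
  that basis. The condition on the first column keeps the marked vector, whose resolvent entry
  yields the first principal minor.\<close>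

definition base_change ::
    "nat \<Rightarrow> complex mat \<Rightarrow> complex mat \<Rightarrow> complex mat \<Rightarrow> complex mat \<Rightarrow> bool" where
  "base_change n H B H' B' \<longleftrightarrow> (\<exists>T \<in> carrier_mat n n. det T \<noteq> 0 \<and>
     (\<forall>a<n. T $$ (a, 0) = (if a = 0 then 1 else 0)) \<and>
     B' \<in> carrier_mat n n \<and> H' = ctr T * H * T \<and> T * B' = B * T)"

lemma base_change_refl:
  "H \<in> carrier_mat n n \<Longrightarrow> B \<in> carrier_mat n n \<Longrightarrow> 0 < n \<Longrightarrow> base_change n H B H B"
  unfolding base_change_def by (rule bexI[of _ "1\<^sub>m n"]) auto

lemma base_change_trans:
  assumes "base_change n H B H' B'" "base_change n H' B' H'' B''" "0 < n"
    "H \<in> carrier_mat n n" "B \<in> carrier_mat n n"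
  shows "base_change n H B H'' B''"
proof -
  obtain T where T: "T \<in> carrier_mat n n" "det T \<noteq> 0"
     "\<forall>a<n. T $$ (a, 0) = (if a = 0 then 1 else 0)" 
     "B' \<in> carrier_mat n n" "H' = ctr T * H * T" "T * B' = B * T"
    using assms by (auto simp: base_change_def)
  obtain T' where T': "T' \<in> carrier_mat n n" "det T' \<noteq> 0"
     "\<forall>a<n. T' $$ (a, 0) = (if a = 0 then 1 else 0)" 
     "B'' \<in> carrier_mat n n" "H'' = ctr T' * H' * T'" "T' * B'' = B' * T'"
    using assms by (auto simp: base_change_def)
  note c = T(1,4) T'(1,4) assms(4,5)
  have TT: "T * T' \<in> carrier_mat n n" using c by auto
  show ?thesis unfolding base_change_def
  proof (rule bexI[OF _ TT], intro conjI allI impI)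
    show "det (T * T') \<noteq> 0" using T T' by (simp add: det_mult)
    show "B'' \<in> carrier_mat n n" by fact
    have cT: "ctr T \<in> carrier_mat n n" "ctr T' \<in> carrier_mat n n" using c by auto
    note as = assoc_mult_mat[of _ n n _ n _ n] mult_carrier_mat[of _ n n _ n]
    show "H'' = ctr (T * T') * H * (T * T')"
      using c cT by (simp add: T'(5) T(5) ctr_mult[of _ n n _ n] as)
    have "T * T' * B'' = T * (T' * B'')" using c as by simp
    also have "\<dots> = (T * B') * T'" using c as by (simp add: T'(6))
    also have "\<dots> = B * (T * T')" using c as by (simp add: T(6))
    finally show "T * T' * B'' = B * (T * T')" .
    fix a assume a: "a < n"
    have "(T * T') $$ (a, 0) = (\<Sum>c<n. T $$ (a, c) * T' $$ (c, 0))"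
      using c a assms(3) by (simp add: mult_mat_index_sum del: index_mult_mat)
    also have "\<dots> = (\<Sum>c<n. if c = 0 then T $$ (a, 0) else 0)"
      using T' by (intro sum.cong) auto
    also have "\<dots> = T $$ (a, 0)" using assms(3) by simp
    finally show "(T * T') $$ (a, 0) = (if a = 0 then 1 else 0)" using T a by auto
  qed
qed

lemma base_change_posdef:
  "base_change n H B H' B' \<Longrightarrow> H \<in> carrier_mat n n \<Longrightarrow> posdef n H \<Longrightarrow> posdef n H'"
  by (auto simp: base_change_def posdef_congruence)

lemma base_change_hermitian:
  assumes "base_change n H B H' B'" "H \<in> carrier_mat n n" "ctr H = H"
  shows "H' \<in> carrier_mat n n" "ctr H' = H'"
proof -
  obtain T where T: "T \<in> carrier_mat n n" "H' = ctr T * H * T"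
    using assms by (auto simp: base_change_def)
  have cT: "ctr T \<in> carrier_mat n n" using T by auto
  note as = assoc_mult_mat[of _ n n _ n _ n] mult_carrier_mat[of _ n n _ n]
  show "H' \<in> carrier_mat n n" using T cT assms(2) by (auto intro!: mult_carrier_mat)
  show "ctr H' = H'" using T cT assms by (simp add: T(2) ctr_mult[of _ n n _ n] as)
qed

lemma base_change_selfadjoint:
  assumes "base_change n H B H' B'" "H \<in> carrier_mat n n" "B \<in> carrier_mat n n" "H * B = ctr B * H"
  shows "H' * B' = ctr B' * H'"
proof -
  obtain T where T: "T \<in> carrier_mat n n" "H' = ctr T * H * T" "T * B' = B * T" "B' \<in> carrier_mat n n"
    using assms by (auto simp: base_change_def)
  have cT: "ctr T \<in> carrier_mat n n" "ctr B \<in> carrier_mat n n" "ctr B' \<in> carrier_mat n n"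
    using T assms by auto
  have 1: "ctr B' * ctr T = ctr T * ctr B"
    using T assms by (metis ctr_mult)
  note as = assoc_mult_mat[of _ n n _ n _ n] mult_carrier_mat[of _ n n _ n]
  have "H' * B' = ctr T * H * (T * B')" using T cT assms(2,3) by (simp add: as)
  also have "\<dots> = ctr T * (H * B) * T" using T cT assms(2,3) by (simp add: as)
  also have "ctr T * (H * B) * T = ctr T * (ctr B * H) * T" by (simp only: assms(4))
  also have "\<dots> = (ctr T * ctr B) * H * T"
    using T(1) cT assms(2,3) by (simp add: as del: assms(4))
  also have "\<dots> = ctr B' * H'" using T cT assms by (simp add: 1[symmetric] as)
  finally show ?thesis .
qed

definition positive_pair :: "nat \<Rightarrow> complex mat \<Rightarrow> complex mat \<Rightarrow> bool" where
  "positive_pair n H B \<longleftrightarrow> H \<in> carrier_mat n n \<and> B \<in> carrier_mat n n \<and>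
     ctr H = H \<and> posdef n H \<and> H * B = ctr B * H"

lemma base_change_positive_pair:
  assumes "base_change n H B H' B'" "positive_pair n H B"
  shows "positive_pair n H' B'"
proof -
  have "B' \<in> carrier_mat n n" using assms(1) by (auto simp: base_change_def)
  then show ?thesis
    using assms base_change_hermitian[OF assms(1)] base_change_posdef[OF assms(1)]
      base_change_selfadjoint[OF assms(1)]
    unfolding positive_pair_def by blast
qed

section \<open>Matrices with polynomial entries\<close>

text \<open>The bound is an integer, since differences of weights occur; a negative one forces \<open>p = 0\<close>.\<close>

definition deg_le :: "complex poly \<Rightarrow> int \<Rightarrow> bool" where
  "deg_le p d \<longleftrightarrow> (\<forall>j. coeff p j \<noteq> 0 \<longrightarrow> int j \<le> d)"

lemma deg_le_0 [simp]: "deg_le 0 d" by (simp add: deg_le_def)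

lemma deg_le_mono: "deg_le p d \<Longrightarrow> d \<le> e \<Longrightarrow> deg_le p e" by (force simp: deg_le_def)

lemma deg_le_add: "deg_le p d \<Longrightarrow> deg_le q d \<Longrightarrow> deg_le (p + q) d"
  unfolding deg_le_def by (metis add_0 coeff_add)

lemma deg_le_diff: "deg_le p d \<Longrightarrow> deg_le q d \<Longrightarrow> deg_le (p - q) d"
  unfolding deg_le_def by (metis diff_self coeff_diff)

lemma deg_le_minus: "deg_le p d \<Longrightarrow> deg_le (- p) d"
  by (simp add: deg_le_def)

lemma deg_le_smult: "(c \<noteq> 0 \<Longrightarrow> deg_le p d) \<Longrightarrow> deg_le (smult c p) d"
  by (cases "c = 0") (auto simp: deg_le_def)

lemma deg_le_sum: "(\<And>i. i \<in> I \<Longrightarrow> deg_le (f i) d) \<Longrightarrow> deg_le (sum f I) d"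
  by (induction I rule: infinite_finite_induct) (auto intro: deg_le_add)

lemma deg_le_mult: "deg_le p d \<Longrightarrow> deg_le q e \<Longrightarrow> deg_le (p * q) (d + e)"
  unfolding deg_le_def coeff_mult
proof (intro allI impI)
  fix j assume p: "\<forall>j. coeff p j \<noteq> 0 \<longrightarrow> int j \<le> d" and q: "\<forall>j. coeff q j \<noteq> 0 \<longrightarrow> int j \<le> e"
    and "(\<Sum>i\<le>j. coeff p i * coeff q (j - i)) \<noteq> 0"
  then obtain i where "i \<le> j" "coeff p i * coeff q (j - i) \<noteq> 0"
    by (meson atMost_iff sum.not_neutral_contains_not_neutral)
  then show "int j \<le> d + e" using p[rule_format, of i] q[rule_format, of "j - i"] by auto
qed

lemma deg_le_degree: "deg_le p d \<longleftrightarrow> p = 0 \<or> int (degree p) \<le> d"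
proof
  assume "deg_le p d"
  then show "p = 0 \<or> int (degree p) \<le> d"
    using leading_coeff_neq_0 unfolding deg_le_def by blast
next
  assume "p = 0 \<or> int (degree p) \<le> d"
  then show "deg_le p d" using le_degree[of p] by (force simp: deg_le_def)
qed

lemma deg_le_linear_factor: "deg_le ([:c, 1:] * p) d \<Longrightarrow> deg_le p (d - 1)"
proof (cases "p = 0")
  case False
  then have "degree ([:c, 1:] * p) = Suc (degree p)" by (subst degree_mult_eq) auto
  moreover assume "deg_le ([:c, 1:] * p) d"
  moreover have "[:c, 1:] * p \<noteq> 0" using False by (metis mult_eq_0_iff one_neq_zero pCons_eq_0_iff)
  ultimately show ?thesis by (auto simp: deg_le_degree)
qed simp

lemma deg_le_linear_mult: "deg_le p d \<Longrightarrow> deg_le ([:c, 1:] * p) (d + 1)"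
  using deg_le_mult[of "[:c, 1:]" 1 p d] by (auto simp: deg_le_degree add.commute)

lemma deg_le_map_cnj: "deg_le p d \<Longrightarrow> deg_le (map_poly cnj p) d"
  by (auto simp: deg_le_def coeff_map_poly)

text \<open>Matrix identities are available only for almost all real \<open>u\<close>; this turns
  them into identities of polynomials, which may then be used at complex points.\<close>

lemma poly_eqI_cofinite:
  fixes p q :: "complex poly"
  assumes "\<forall>\<^sub>\<infinity>u :: real. poly p (of_real u) = poly q (of_real u)"
  shows "p = q"
proof (rule ccontr)
  assume "p \<noteq> q"
  then have fin: "finite {z. poly (p - q) z = 0}" by (intro poly_roots_finite) auto
  have "finite {u :: real. poly p (of_real u) \<noteq> poly q (of_real u)}"
    using assms by (simp add: eventually_cofinite)
  moreover have "finite {u :: real. poly p (of_real u) = poly q (of_real u)}"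
    using finite_vimageI[OF fin, of "of_real :: real \<Rightarrow> complex"]
    by (simp add: vimage_def inj_def)
  ultimately have "finite ({u :: real. poly p (of_real u) \<noteq> poly q (of_real u)} \<union>
      {u :: real. poly p (of_real u) = poly q (of_real u)})" by blast
  moreover have "\<dots> = UNIV" by auto
  ultimately show False using infinite_UNIV_char_0 by metis
qed

lemma linear_factorE:
  fixes p :: "complex poly"
  assumes "poly p c = 0"
  obtains q where "p = [:-c, 1:] * q"
  using assms by (auto simp: poly_eq_0_iff_dvd)

definition poly_mat :: "nat \<Rightarrow> (nat \<Rightarrow> nat \<Rightarrow> complex poly) \<Rightarrow> complex poly mat" where
  "poly_mat n M = mat n n (\<lambda>(a, b). M a b)"

definition eval_mat :: "nat \<Rightarrow> (nat \<Rightarrow> nat \<Rightarrow> complex poly) \<Rightarrow> complex \<Rightarrow> complex mat" where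
  "eval_mat n M z = mat n n (\<lambda>(a, b). poly (M a b) z)"

lemma eval_mat_carrier [simp, intro]: "eval_mat n M z \<in> carrier_mat n n"
  by (simp add: eval_mat_def)

lemma eval_mat_dim [simp]: "dim_row (eval_mat n M z) = n" "dim_col (eval_mat n M z) = n"
  by (simp_all add: eval_mat_def)

lemma eval_mat_index [simp]: "a < n \<Longrightarrow> b < n \<Longrightarrow> eval_mat n M z $$ (a, b) = poly (M a b) z"
  by (simp add: eval_mat_def)

lemma det_eval_mat: "det (eval_mat n M z) = poly (det (poly_mat n M)) z"
proof -
  have ev: "comm_ring_hom (\<lambda>p. poly p z)" by standard auto
  have "eval_mat n M z = map_mat (\<lambda>p. poly p z) (poly_mat n M)"
    by (rule eq_matI) (auto simp: eval_mat_def poly_mat_def)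
  then show ?thesis by (simp only: comm_ring_hom.hom_det[OF ev])
qed

section \<open>Eigenvectors inside a kernel\<close>

lemma singular_matrix_kernel:
  fixes A :: "complex mat"
  assumes "A \<in> carrier_mat n n" "det A = 0"
  obtains v :: "nat \<Rightarrow> complex" where "\<exists>a<n. v a \<noteq> 0" "\<And>a. a < n \<Longrightarrow> (\<Sum>b<n. A $$ (a, b) * v b) = 0"
proof -
  obtain v where v: "v \<in> carrier_vec n" "v \<noteq> 0\<^sub>v n" "A *\<^sub>v v = 0\<^sub>v n"
    using assms det_0_iff_vec_prod_zero_field[OF assms(1)] by blast
  have "\<exists>a<n. v $ a \<noteq> 0"
  proof (rule ccontr)
    assume "\<not> ?thesis"
    then have "v = 0\<^sub>v n" using v(1) by (intro eq_vecI) auto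
    then show False using v by simp
  qed
  moreover have "(\<Sum>b<n. A $$ (a, b) * v $ b) = 0" if "a < n" for a
  proof -
    have "(A *\<^sub>v v) $ a = 0" using v that by simp
    then show ?thesis using that assms(1) v(1) by (simp add: scalar_prod_def atLeast0LessThan)
  qed
  ultimately show ?thesis using that[of "($) v"] by blast
qed

text \<open>\<open>w k\<close> is the k-th iterate of \<open>M\<close> on \<open>w 0\<close>, and
  \<open>f\<close> annihilates \<open>w 0\<close>. Split off a linear factor, f = (x - l) g: either
  g(M) applied to \<open>w 0\<close> is nonzero and an eigenvector for l, or \<open>g\<close> is an
  annihilator of smaller degree. A nonzero constant cannot annihilate \<open>w 0\<close>.\<close>

lemma cyclic_eigenvector:
  fixes M :: "nat \<Rightarrow> nat \<Rightarrow> complex" and w :: "nat \<Rightarrow> nat \<Rightarrow> complex"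
  assumes w: "\<And>k a. a < n \<Longrightarrow> w (Suc k) a = (\<Sum>b<n. M a b * w k b)"
    and "f \<noteq> 0" "\<And>a. a < n \<Longrightarrow> (\<Sum>k\<le>degree f. coeff f k * w k a) = 0" "\<exists>a<n. w 0 a \<noteq> 0"
  shows "\<exists>(g :: complex poly) l. (\<exists>a<n. (\<Sum>k\<le>degree g. coeff g k * w k a) \<noteq> 0) \<and>
     (\<forall>a<n. (\<Sum>b<n. M a b * (\<Sum>k\<le>degree g. coeff g k * w k b)) =
        l * (\<Sum>k\<le>degree g. coeff g k * w k a))"
  using assms(2,3)
proof (induction "degree f" arbitrary: f)
  case 0
  then have "coeff f 0 * w 0 a = 0" if "a < n" for a using that by force
  moreover have "coeff f 0 \<noteq> 0" using 0 by (metis leading_coeff_neq_0)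
  ultimately show ?case using assms(4) by auto
next
  case (Suc d)
  then obtain l where "poly f l = 0"
    by (metis constant_degree fundamental_theorem_of_algebra nat.distinct(1))
  then obtain g where g: "f = [:-l, 1:] * g" by (rule linear_factorE)
  have "g \<noteq> 0" using g Suc by auto
  then have "degree f = Suc (degree g)" unfolding g by (subst degree_mult_eq) auto
  then have dg: "degree g = d" using Suc by simp
  let ?act = "\<lambda>a. \<Sum>k\<le>degree g. coeff g k * w k a"
  have act: "(\<Sum>b<n. M a b * ?act b) = l * ?act a" if a: "a < n" for a
  proof -
    have "0 = (\<Sum>k\<le>Suc d. coeff f k * w k a)" using Suc a by simp
    \<comment> \<open>The coefficients of f = x g - l g; shifting the index in the first part
      produces \<open>w (Suc k)\<close>, which is \<open>M\<close> applied to
      \<open>w k\<close>.\<close>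
    also have "\<dots> = (\<Sum>k\<le>Suc d. (case k of 0 \<Rightarrow> 0 | Suc j \<Rightarrow> coeff g j) * w k a) -
        (\<Sum>k\<le>Suc d. l * (coeff g k * w k a))"
      unfolding sum_subtractf[symmetric]
      by (intro sum.cong) (auto simp: g coeff_pCons algebra_simps split: nat.splits)
    also have "(\<Sum>k\<le>Suc d. (case k of 0 \<Rightarrow> 0 | Suc j \<Rightarrow> coeff g j) * w k a) =
        (\<Sum>k\<le>d. coeff g k * w (Suc k) a)"
      by (subst sum.atMost_Suc_shift) simp
    also have "(\<Sum>k\<le>Suc d. l * (coeff g k * w k a)) = l * ?act a"
      using dg by (simp add: sum_distrib_left coeff_eq_0)
    also have "(\<Sum>k\<le>d. coeff g k * w (Suc k) a) = (\<Sum>k\<le>d. \<Sum>b<n. coeff g k * (M a b * w k b))"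
      using a by (simp add: w sum_distrib_left)
    also have "\<dots> = (\<Sum>b<n. M a b * ?act b)"
      by (subst sum.swap) (simp add: dg sum_distrib_left mult_ac)
    finally show ?thesis by simp
  qed
  show ?case
  proof (cases "\<exists>a<n. ?act a \<noteq> 0")
    case True
    then show ?thesis using act by blast
  next
    case False
    then show ?thesis using Suc(1)[of g] dg \<open>g \<noteq> 0\<close> by blast
  qed
qed

text \<open>\<open>X\<close> witnesses that the kernel of \<open>H\<close> is invariant under \<open>B\<close>.\<close>

lemma eigenvector_in_kernel:
  fixes H B X :: "nat \<Rightarrow> nat \<Rightarrow> complex"
  assumes HB: "\<And>a b. a < n \<Longrightarrow> b < n \<Longrightarrow> (\<Sum>c<n. H a c * B c b) = (\<Sum>c<n. X a c * H c b)"
    and det: "det (mat n n (\<lambda>(a, b). H a b)) = 0"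
  obtains v l where "\<exists>a<n. v a \<noteq> 0" "\<And>a. a < n \<Longrightarrow> (\<Sum>b<n. H a b * v b) = 0"
    "\<And>a. a < n \<Longrightarrow> (\<Sum>b<n. B a b * v b) = l * v a"
proof -
  have "mat n n (\<lambda>(a, b). H a b) \<in> carrier_mat n n" by simp
  from singular_matrix_kernel[OF this det] obtain v0 where v0': "\<exists>a<n. v0 a \<noteq> 0"
    "\<And>a. a < n \<Longrightarrow> (\<Sum>b<n. mat n n (\<lambda>(a, b). H a b) $$ (a, b) * v0 b) = 0" by blast
  have v0: "\<exists>a<n. v0 a \<noteq> 0" "\<And>a. a < n \<Longrightarrow> (\<Sum>b<n. H a b * v0 b) = 0"
    using v0' by auto
  define w where "w = (\<lambda>k. ((\<lambda>x a. \<Sum>b<n. B a b * x b) ^^ k) v0)"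
  have w0: "w 0 = v0" by (simp add: w_def)
  have wSuc: "w (Suc k) a = (\<Sum>b<n. B a b * w k b)" for k a by (simp add: w_def)
  have Hw: "(\<Sum>b<n. H a b * w k b) = 0" if "a < n" for a k
    using that
  proof (induction k arbitrary: a)
    case 0 then show ?case using v0 w0 by simp
  next
    case (Suc k)
    have "(\<Sum>b<n. H a b * w (Suc k) b) = (\<Sum>c<n. \<Sum>b<n. H a b * B b c * w k c)"
      by (subst sum.swap) (simp add: wSuc sum_distrib_left mult_ac)
    also have "\<dots> = (\<Sum>c<n. \<Sum>b<n. X a b * H b c * w k c)"
      using HB Suc by (simp add: sum_distrib_right[symmetric])
    also have "\<dots> = (\<Sum>b<n. X a b * (\<Sum>c<n. H b c * w k c))"
      by (subst sum.swap) (simp add: sum_distrib_left mult_ac)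
    also have "\<dots> = 0" using Suc by simp
    finally show ?case .
  qed
  \<comment> \<open>The n + 1 iterates are dependent in dimension n. A zero last row makes their
    matrix square and singular, and a kernel vector supplies the coefficients of an annihilating
    polynomial.\<close>
  define M where "M = mat (Suc n) (Suc n) (\<lambda>(a, k). if a = n then 0 else w k a)"
  have M: "M \<in> carrier_mat (Suc n) (Suc n)" by (simp add: M_def)
  have "det M = (\<Sum>j<Suc n. M $$ (n, j) * cofactor M n j)"
    by (rule laplace_expansion_row[OF M]) simp
  also have "\<dots> = 0" by (rule sum.neutral) (auto simp: M_def)
  finally have "det M = 0" .
  from singular_matrix_kernel[OF M this] obtain c where c: "\<exists>k<Suc n. c k \<noteq> 0"
    "\<And>a. a < Suc n \<Longrightarrow> (\<Sum>k<Suc n. M $$ (a, k) * c k) = 0" by metis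
  define f where "f = (\<Sum>k\<le>n. monom (c k) k)"
  have cf: "coeff f k = (if k \<le> n then c k else 0)" for k
    by (simp add: f_def coeff_sum sum.delta)
  have "f \<noteq> 0" using c(1) cf by (metis coeff_0 less_Suc_eq_le)
  have df: "degree f \<le> n" using cf by (simp add: degree_le)
  have "(\<Sum>k\<le>degree f. coeff f k * w k a) = 0" if "a < n" for a
  proof -
    have "(\<Sum>k\<le>degree f. coeff f k * w k a) = (\<Sum>k\<le>n. coeff f k * w k a)"
      using df by (intro sum.mono_neutral_left) (auto simp: coeff_eq_0)
    also have "\<dots> = (\<Sum>k<Suc n. M $$ (a, k) * c k)"
      unfolding lessThan_Suc_atMost using that by (intro sum.cong) (auto simp: M_def cf)
    also have "\<dots> = 0" using c(2) that by simp
    finally show ?thesis .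
  qed
  moreover have "\<exists>a<n. w 0 a \<noteq> 0" using v0(1) w0 by simp
  ultimately have "\<exists>(g :: complex poly) l. (\<exists>a<n. (\<Sum>k\<le>degree g. coeff g k * w k a) \<noteq> 0) \<and>
     (\<forall>a<n. (\<Sum>b<n. B a b * (\<Sum>k\<le>degree g. coeff g k * w k b)) =
        l * (\<Sum>k\<le>degree g. coeff g k * w k a))"
    using cyclic_eigenvector[of n w B f] wSuc \<open>f \<noteq> 0\<close> by blast
  then obtain g l where g: "\<exists>a<n. (\<Sum>k\<le>degree g. coeff g k * w k a) \<noteq> 0"
    "\<forall>a<n. (\<Sum>b<n. B a b * (\<Sum>k\<le>degree g. coeff g k * w k b)) =
        l * (\<Sum>k\<le>degree g. coeff g k * w k a)" by blast
  have Hg: "(\<Sum>b<n. H a b * (\<Sum>k\<le>degree g. coeff g k * w k b)) = 0" if "a < n" for a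
  proof -
    have "(\<Sum>b<n. H a b * (\<Sum>k\<le>degree g. coeff g k * w k b)) =
       (\<Sum>k\<le>degree g. coeff g k * (\<Sum>b<n. H a b * w k b))"
      unfolding sum_distrib_left by (subst sum.swap) (simp add: mult_ac)
    then show ?thesis using Hw that by simp
  qed
  show thesis by (rule that[OF g(1) Hg g(2)[rule_format]])
qed

section \<open>Lowering the degrees of a positive pencil\<close>

lemma cofinite_real_ex:
  assumes "\<forall>\<^sub>\<infinity>u :: real. P u"
  obtains u where "P u"
proof -
  have "\<not> trivial_limit (cofinite :: real filter)"
    by (simp add: cofinite_bot infinite_UNIV_char_0)
  then show ?thesis using assms that eventually_happens by blast
qed

lemma cofinite_neq: "\<forall>\<^sub>\<infinity>u :: real. complex_of_real u \<noteq> c"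
proof -
  have "{u :: real. complex_of_real u = c} \<subseteq> {Re c}" by auto
  then have "finite {u :: real. complex_of_real u = c}" using finite_subset by blast
  then show ?thesis by (simp add: eventually_cofinite)
qed

lemma cofinite_imp_eventually_at:
  assumes "\<forall>\<^sub>\<infinity>u :: real. P u"
  shows "\<forall>\<^sub>F u in at (x :: real). P u"
proof -
  have "finite {u. \<not> P u}" using assms by (simp add: eventually_cofinite)
  then have "finite ({u. \<not> P u} - {x})" by simp
  then have "closed ({u. \<not> P u} - {x})" by (rule finite_imp_closed)
  then have "open (- ({u. \<not> P u} - {x}))" by (rule open_Compl)
  moreover have "x \<in> - ({u. \<not> P u} - {x})" by simp
  ultimately show ?thesis unfolding eventually_at_topological by blast
qed

text \<open>For real \<open>c\<close> this holds because a simple real zero would be a change of sign.\<close>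

lemma positive_poly_conj_root:
  fixes g g1 :: "complex poly"
  assumes g: "g = [:-c, 1:] * g1" and pos: "\<forall>\<^sub>\<infinity>u :: real. 0 < Re (poly g (of_real u))"
    and real: "\<forall>\<^sub>\<infinity>u :: real. cnj (poly g (of_real u)) = poly g (of_real u)"
  shows "poly g1 (cnj c) = 0"
proof (cases "Im c = 0")
  case False
  \<comment> \<open>Real values on the real line make the coefficients real, so \<open>cnj c\<close>
    is a second zero of \<open>g\<close>, distinct from \<open>c\<close>, and must come from
    \<open>g1\<close>.\<close>
  have "map_poly cnj g = g"
    by (rule poly_eqI_cofinite) (use real in \<open>simp add: poly_map_poly_cnj\<close>)
  then have "poly g (cnj c) = cnj (poly g c)"
    by (metis poly_cnj)
  moreover have "poly g c = 0" using g by simp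
  ultimately have "(cnj c - c) * poly g1 (cnj c) = 0" using g by auto
  moreover have "cnj c \<noteq> c" using False by (metis Reals_cnj_iff complex_is_Real_iff)
  ultimately show ?thesis by auto
next
  case True
  define x where "x = Re c"
  have c: "c = of_real x" using True by (simp add: x_def complex_eq_iff)
  have cont: "((\<lambda>u. poly g1 (complex_of_real u)) \<longlongrightarrow> poly g1 (of_real x)) (at x)"
    by (intro tendsto_intros)
  have gu: "poly g (complex_of_real u) = of_real (u - x) * poly g1 (of_real u)" for u
    unfolding g c by (simp add: algebra_simps)
  have ev: "\<forall>\<^sub>F u in at x. 0 < Re (poly g (of_real u)) \<and> cnj (poly g (of_real u)) = poly g (of_real u)"
    by (rule cofinite_imp_eventually_at) (use pos real in \<open>auto intro: eventually_conj\<close>)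
  have "\<forall>\<^sub>F u in at x. Im (poly g1 (complex_of_real u)) = 0"
    using ev eventually_neq_at_within[of x x UNIV]
  proof eventually_elim
    case (elim u)
    then have "Im (of_real (u - x) * poly g1 (of_real u)) = 0"
      by (metis Reals_cnj_iff complex_is_Real_iff gu)
    then show ?case using elim by simp
  qed
  then have "((\<lambda>u. Im (poly g1 (complex_of_real u))) \<longlongrightarrow> 0) (at x)"
    by (rule tendsto_eventually)
  then have "Im (poly g1 (of_real x)) = 0"
    using tendsto_Im[OF cont] tendsto_unique trivial_limit_at by blast
  moreover have "0 \<le> Re (poly g1 (of_real x))"
  proof (rule tendsto_lowerbound)
    show "((\<lambda>u. Re (poly g1 (complex_of_real u))) \<longlongrightarrow> Re (poly g1 (of_real x))) (at_right x)"
      by (rule tendsto_Re) (intro tendsto_intros)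
    have "\<forall>\<^sub>F u in at_right x. 0 < Re (poly g (of_real u))"
      using ev unfolding eventually_at_split by (auto elim: eventually_mono)
    then show "\<forall>\<^sub>F u in at_right x. 0 \<le> Re (poly g1 (complex_of_real u))"
      using eventually_at_right_less[of x]
      by eventually_elim (auto simp: gu zero_less_mult_iff)
  qed simp
  moreover have "0 \<ge> Re (poly g1 (of_real x))"
  proof (rule tendsto_upperbound)
    show "((\<lambda>u. Re (poly g1 (complex_of_real u))) \<longlongrightarrow> Re (poly g1 (of_real x))) (at_left x)"
      by (rule tendsto_Re) (intro tendsto_intros)
    have "\<forall>\<^sub>F u in at_left x. 0 < Re (poly g (of_real u))"
      using ev unfolding eventually_at_split by (auto elim: eventually_mono)
    moreover have "\<forall>\<^sub>F u in at_left x. u < x" by (auto simp: eventually_at_filter)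
    ultimately show "\<forall>\<^sub>F u in at_left x. Re (poly g1 (complex_of_real u)) \<le> 0"
      by eventually_elim (auto simp: gu zero_less_mult_iff)
  qed simp
  ultimately have "poly g1 (of_real x) = 0" by (simp add: complex_eq_iff)
  then show ?thesis by (simp add: c)
qed

lemma sum_two_terms:
  fixes f :: "nat \<Rightarrow> 'a::comm_monoid_add"
  assumes "i < n" "j < n" "i \<noteq> j" "\<And>c. c < n \<Longrightarrow> c \<noteq> i \<Longrightarrow> c \<noteq> j \<Longrightarrow> f c = 0"
  shows "(\<Sum>c<n. f c) = f i + f j"
proof -
  have "(\<Sum>c<n. f c) = (\<Sum>c\<in>{i, j}. f c)"
    using assms by (intro sum.mono_neutral_right) auto
  then show ?thesis using assms(3) by simp
qed

lemma sum_one_term: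
  fixes f :: "nat \<Rightarrow> 'a::comm_monoid_add"
  assumes "i < n" "\<And>c. c < n \<Longrightarrow> c \<noteq> i \<Longrightarrow> f c = 0"
  shows "(\<Sum>c<n. f c) = f i"
proof -
  have "(\<Sum>c<n. f c) = (\<Sum>c\<in>{i}. f c)"
    using assms by (intro sum.mono_neutral_right) auto
  then show ?thesis by simp
qed

lemma det_replace_column:
  fixes c :: "nat \<Rightarrow> complex"
  assumes "i < n"
  shows "det (mat n n (\<lambda>(a, b). if b = i then c a else if a = b then 1 else 0)) = c i"
    (is "det ?T = _")
proof -
  have T: "?T \<in> carrier_mat n n" by simp
  have "det ?T = (\<Sum>j<n. ?T $$ (i, j) * cofactor ?T i j)"
    by (rule laplace_expansion_row[OF T assms])
  also have "\<dots> = ?T $$ (i, i) * cofactor ?T i i"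
    by (rule sum_one_term) (use assms in auto)
  also have "mat_delete ?T i i = 1\<^sub>m (n - 1)"
    by (rule eq_matI) (use assms in \<open>auto simp: mat_delete_def\<close>)
  then have "cofactor ?T i i = 1" by (simp add: cofactor_def)
  finally show ?thesis using assms by simp
qed

abbreviation "poly_base_change n H B H' B' u \<equiv>
  base_change n (eval_mat n H (of_real u)) (eval_mat n B (of_real u))
    (eval_mat n H' (of_real u)) (eval_mat n B' (of_real u))"

text \<open>
  \<open>k\<close> are the weights.  The vector \<open>v\<close> replaces the basis vector of maximal weight \<open>k i\<close> in its support, so
  that no entry violates its degree bound; \<open>k i > 0\<close>, because otherwise the value of \<open>H\<close> at \<open>v\<close> would be
  constant in \<open>u\<close>, hence zero, against definiteness.
\<close>

lemma reduction_step:
  fixes H B :: "nat \<Rightarrow> nat \<Rightarrow> complex poly" and k :: "nat \<Rightarrow> nat"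
  assumes dH: "\<And>a b. a < n \<Longrightarrow> b < n \<Longrightarrow> deg_le (H a b) (int (k a) + int (k b))"
    and dB: "\<And>a b. a < n \<Longrightarrow> b < n \<Longrightarrow> deg_le (B a b) (1 + int (k b) - int (k a))"
    and k0: "k 0 = 0"
    and pos: "\<forall>\<^sub>\<infinity>u :: real. positive_pair n (eval_mat n H (of_real u)) (eval_mat n B (of_real u))"
    and deg: "0 < degree (det (poly_mat n H))"
  obtains i H' B' where "i < n" "0 < k i"
    "\<And>a b. a < n \<Longrightarrow> b < n \<Longrightarrow> deg_le (H' a b) (int ((k(i := k i - 1)) a) + int ((k(i := k i - 1)) b))"
    "\<And>a b. a < n \<Longrightarrow> b < n \<Longrightarrow> deg_le (B' a b) (1 + int ((k(i := k i - 1)) b) - int ((k(i := k i - 1)) a))"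
    "\<forall>\<^sub>\<infinity>u :: real. poly_base_change n H B H' B' u"
    "degree (det (poly_mat n H)) = degree (det (poly_mat n H')) + 2"
proof -
  have herm: "\<forall>\<^sub>\<infinity>u :: real. ctr (eval_mat n H (of_real u)) = eval_mat n H (of_real u)"
    using pos by (rule eventually_mono) (simp add: positive_pair_def)
  have pd: "\<forall>\<^sub>\<infinity>u :: real. posdef n (eval_mat n H (of_real u))"
    using pos by (rule eventually_mono) (simp add: positive_pair_def)
  have sa: "\<forall>\<^sub>\<infinity>u :: real. eval_mat n H (of_real u) * eval_mat n B (of_real u) =
      ctr (eval_mat n B (of_real u)) * eval_mat n H (of_real u)"
    using pos by (rule eventually_mono) (simp add: positive_pair_def)
  obtain y where y: "poly (det (poly_mat n H)) y = 0"
    using deg by (metis constant_degree fundamental_theorem_of_algebra not_gr_zero)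
  \<comment> \<open>At real u, conjugating a value is conjugating the coefficients; in this form
    hermitian symmetry survives at nonreal points.\<close>
  have symH: "map_poly cnj (H b a) = H a b" if "a < n" "b < n" for a b
  proof (rule poly_eqI_cofinite, rule eventually_mono[OF herm])
    fix u :: real assume "ctr (eval_mat n H (of_real u)) = eval_mat n H (of_real u)"
    then have "ctr (eval_mat n H (of_real u)) $$ (a, b) = eval_mat n H (of_real u) $$ (a, b)" by simp
    then show "poly (map_poly cnj (H b a)) (of_real u) = poly (H a b) (of_real u)"
      using that by (simp add: poly_map_poly_cnj)
  qed
  have HB: "(\<Sum>c<n. H a c * B c b) = (\<Sum>c<n. map_poly cnj (B c a) * H c b)"
    if ab: "a < n" "b < n" for a b
  proof (rule poly_eqI_cofinite, rule eventually_mono[OF sa])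
    fix u :: real assume "eval_mat n H (of_real u) * eval_mat n B (of_real u) =
        ctr (eval_mat n B (of_real u)) * eval_mat n H (of_real u)"
    then have "(eval_mat n H (of_real u) * eval_mat n B (of_real u)) $$ (a, b) =
      (ctr (eval_mat n B (of_real u)) * eval_mat n H (of_real u)) $$ (a, b)" by simp
    then show "poly (\<Sum>c<n. H a c * B c b) (of_real u) =
        poly (\<Sum>c<n. map_poly cnj (B c a) * H c b) (of_real u)"
      using ab by (simp add: mult_mat_index_sum[of _ n n _ n] poly_sum poly_map_poly_cnj
        del: index_mult_mat(1))
  qed
  \<comment> \<open>At a nonreal \<open>y\<close> the left factor is not the adjoint of
    \<open>B\<close> at \<open>y\<close>; the kernel argument only needs that some left factor
    exists.\<close>
  have "(\<Sum>c<n. poly (H a c) y * poly (B c b) y) =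
      (\<Sum>c<n. poly (map_poly cnj (B c a)) y * poly (H c b) y)" if "a < n" "b < n" for a b
    using arg_cong[OF HB[OF that], of "\<lambda>p. poly p y"] by (simp add: poly_sum)
  moreover have "det (mat n n (\<lambda>(a, b). poly (H a b) y)) = 0"
    using y det_eval_mat[of n H y] by (simp add: eval_mat_def)
  ultimately obtain v0 l where v0: "\<exists>a<n. v0 a \<noteq> 0"
     "\<And>a. a < n \<Longrightarrow> (\<Sum>b<n. poly (H a b) y * v0 b) = 0"
     "\<And>a. a < n \<Longrightarrow> (\<Sum>b<n. poly (B a b) y * v0 b) = l * v0 a"
    by (rule eigenvector_in_kernel[of n "\<lambda>a b. poly (H a b) y" "\<lambda>a b. poly (B a b) y"
          "\<lambda>a c. poly (map_poly cnj (B c a)) y"]) blast+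
  have ne: "k ` {a. a < n \<and> v0 a \<noteq> 0} \<noteq> {}" "finite (k ` {a. a < n \<and> v0 a \<noteq> 0})"
    using v0(1) by auto
  obtain i where i: "i < n" "v0 i \<noteq> 0" "k i = Max (k ` {a. a < n \<and> v0 a \<noteq> 0})"
    using Max_in[OF ne(2,1)] by auto
  have i: "i < n" "v0 i \<noteq> 0" "\<And>a. a < n \<Longrightarrow> v0 a \<noteq> 0 \<Longrightarrow> k a \<le> k i"
    using i Max_ge[OF ne(2)] by auto
  define v where "v = (\<lambda>a. v0 a / v0 i)"
  have vi: "v i = 1" using i by (simp add: v_def)
  have vk: "k a \<le> k i" if "a < n" "v a \<noteq> 0" for a using that i by (simp add: v_def)
  have vH: "(\<Sum>b<n. poly (H a b) y * v b) = 0" if "a < n" for a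
    using v0(2)[OF that] by (simp add: v_def sum_divide_distrib[symmetric])
  have vB: "(\<Sum>b<n. poly (B a b) y * v b) = l * v a" if "a < n" for a
    using v0(3)[OF that] by (simp add: v_def sum_divide_distrib[symmetric])
  \<comment> \<open>\<open>Hv\<close> is H v, divisible by u - y since \<open>v\<close> lies in the
    kernel of \<open>H\<close> at \<open>y\<close>. The quotient \<open>r\<close> gives the
    off-diagonal entries of column \<open>i\<close> of the new form.\<close>
  define Hv where "Hv = (\<lambda>a. \<Sum>b<n. smult (v b) (H a b))"
  define r where "r = (\<lambda>a. Hv a div [:-y, 1:])"
  have Hv: "Hv a = [:-y, 1:] * r a" if "a < n" for a
  proof -
    have "poly (Hv a) y = 0" using vH[OF that] by (simp add: Hv_def poly_sum mult.commute)
    then have "[:-y, 1:] dvd Hv a" by (simp add: poly_eq_0_iff_dvd)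
    then show ?thesis by (simp only: r_def dvd_mult_div_cancel)
  qed
  have dHv: "deg_le (Hv a) (int (k a) + int (k i))" if "a < n" for a
    unfolding Hv_def using that vk by (intro deg_le_sum deg_le_smult) (force intro: deg_le_mono[OF dH])
  have dr: "deg_le (r a) (int (k a) + int (k i) - 1)" if "a < n" for a
    using dHv[OF that] Hv[OF that] by (metis deg_le_linear_factor)
  \<comment> \<open>The value of the form at \<open>v\<close>. Divided by both u - y and u - cnj y
    it is the value at v / (u - y), the new diagonal entry \<open>g2\<close>; that the second
    division is exact is where positivity enters.\<close>
  define g where "g = (\<Sum>a<n. smult (cnj (v a)) (Hv a))"
  define g1 where "g1 = (\<Sum>a<n. smult (cnj (v a)) (r a))"
  have g: "g = [:-y, 1:] * g1"
    unfolding g_def g1_def sum_distrib_left by (intro sum.cong) (auto simp: Hv)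
  have dg: "deg_le g (int (k i) + int (k i))"
    unfolding g_def using vk by (intro deg_le_sum deg_le_smult) (force intro: deg_le_mono[OF dHv])
  have gu: "poly g z = (\<Sum>a<n. \<Sum>b<n. cnj (v a) * eval_mat n H z $$ (a, b) * v b)" for z
    unfolding g_def Hv_def by (simp add: poly_sum sum_distrib_left mult_ac)
  have gpos: "\<forall>\<^sub>\<infinity>u :: real. 0 < Re (poly g (of_real u))"
    using pd
  proof (rule eventually_mono)
    fix u :: real assume "posdef n (eval_mat n H (of_real u))"
    moreover have "\<exists>a<n. v a \<noteq> 0" using i vi by force
    ultimately show "0 < Re (poly g (of_real u))" unfolding posdef_def gu by blast
  qed
  have greal: "\<forall>\<^sub>\<infinity>u :: real. cnj (poly g (of_real u)) = poly g (of_real u)"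
    using herm
  proof (rule eventually_mono)
    fix u :: real assume h: "ctr (eval_mat n H (of_real u)) = eval_mat n H (of_real u)"
    have "cnj (eval_mat n H (of_real u) $$ (a, b)) = eval_mat n H (of_real u) $$ (b, a)" if "a < n" "b < n" for a b
      using arg_cong[OF h, of "\<lambda>M. M $$ (b, a)"] that by simp
    then have "cnj (poly g (of_real u)) = (\<Sum>a<n. \<Sum>b<n. v a * eval_mat n H (of_real u) $$ (b, a) * cnj (v b))"
      unfolding gu by simp
    also have "\<dots> = poly g (of_real u)"
      unfolding gu by (subst sum.swap) (simp add: mult_ac)
    finally show "cnj (poly g (of_real u)) = poly g (of_real u)" .
  qed
  have ki: "0 < k i"
  proof (rule ccontr)
    assume "\<not> 0 < k i"
    then have "degree g = 0" using dg by (auto simp: deg_le_degree)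
    then obtain c where c: "g = [:c:]" by (rule degree_eq_zeroE)
    have "poly g y = 0" unfolding g by simp
    then have "poly g z = 0" for z using c by simp
    moreover obtain u :: real where "0 < Re (poly g (of_real u))" using gpos by (rule cofinite_real_ex)
    ultimately show False by simp
  qed
  have i0: "i \<noteq> 0" using ki k0 by (metis less_irrefl)
  define g2 where "g2 = g1 div [:-cnj y, 1:]"
  have g2: "g1 = [:-cnj y, 1:] * g2"
  proof -
    have "[:-cnj y, 1:] dvd g1"
      using positive_poly_conj_root[OF g gpos greal] by (simp only: poly_eq_0_iff_dvd)
    then show ?thesis by (simp only: g2_def dvd_mult_div_cancel)
  qed
  define Bv where "Bv = (\<lambda>a. \<Sum>b<n. smult (v b) (B a b))"
  have dBv: "deg_le (Bv a) (1 + int (k i) - int (k a))" if "a < n" for a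
    unfolding Bv_def using that vk by (intro deg_le_sum deg_le_smult) (force intro: deg_le_mono[OF dB])
  \<comment> \<open>With w = v / (u - y), B w equals \<open>Bv i\<close> times w plus
    \<open>q a\<close> times the basis vectors e_a with a \<noteq> i. Divisibility holds because
    \<open>v\<close> is an eigenvector of \<open>B\<close> at \<open>y\<close> and
    \<open>v i = 1\<close>.\<close>
  define q where "q = (\<lambda>a. (Bv a - smult (v a) (Bv i)) div [:-y, 1:])"
  have q: "Bv a - smult (v a) (Bv i) = [:-y, 1:] * q a" if "a < n" for a
  proof -
    have "poly (Bv b) y = l * v b" if "b < n" for b
      using vB[OF that] by (simp add: Bv_def poly_sum mult.commute)
    then have "poly (Bv a - smult (v a) (Bv i)) y = 0" using that i vi by simp
    then have "[:-y, 1:] dvd Bv a - smult (v a) (Bv i)" by (simp only: poly_eq_0_iff_dvd)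
    then show ?thesis by (simp only: q_def dvd_mult_div_cancel)
  qed
  have dq: "deg_le (q a) (int (k i) - int (k a))" if "a < n" for a
  proof -
    have "deg_le (Bv a - smult (v a) (Bv i)) (1 + int (k i) - int (k a))"
      using that vk by (intro deg_le_diff dBv deg_le_smult) (force intro: deg_le_mono[OF dBv[OF i(1)]])+
    then have "deg_le (q a) (1 + int (k i) - int (k a) - 1)" unfolding q[OF that] by (rule deg_le_linear_factor)
    then show ?thesis by simp
  qed
  define H' where "H' = (\<lambda>a b. if a = i then (if b = i then g2 else map_poly cnj (r b))
     else if b = i then r a else H a b)"
  \<comment> \<open>The columns b \<noteq> i arise by substituting e_i = (u - y) w - (sum of
    \<open>v a\<close> e_a over a \<noteq> i) into B e_b.\<close>
  define B' where "B' = (\<lambda>a b. if a = i then (if b = i then Bv i else [:-y, 1:] * B i b)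
     else if b = i then q a else B a b - smult (v a) (B i b))"
  define k' where "k' = k(i := k i - 1)"
  have k': "int (k' i) = int (k i) - 1" "\<And>a. a \<noteq> i \<Longrightarrow> k' a = k a"
    using ki by (auto simp: k'_def)
  have dH': "deg_le (H' a b) (int (k' a) + int (k' b))" if ab: "a < n" "b < n" for a b
  proof -
    have "deg_le g2 (int (k i) + int (k i) - 1 - 1)"
      using dg unfolding g g2 by (intro deg_le_linear_factor)
    then show ?thesis
      using dr deg_le_map_cnj[OF dr] dH ab i by (auto simp: H'_def k' algebra_simps)
  qed
  have dB': "deg_le (B' a b) (1 + int (k' b) - int (k' a))" if ab: "a < n" "b < n" for a b
  proof -
    have "deg_le (smult (v a) (B i b)) (1 + int (k b) - int (k a))"
      using vk[OF ab(1)] by (intro deg_le_smult) (force intro: deg_le_mono[OF dB[OF i(1) ab(2)]])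
    moreover have "deg_le ([:-y, 1:] * B i b) (1 + int (k b) - int (k i) + 1)"
      by (intro deg_le_linear_mult dB i ab)
    ultimately show ?thesis
      using dBv[OF i(1)] dq[OF ab(1)] deg_le_diff[OF dB[OF ab]]
      by (cases "a = i"; cases "b = i") (auto simp: B'_def k' algebra_simps)
  qed
  define T where "T = (\<lambda>u. mat n n (\<lambda>(a, b). if b = i then v a / (u - y) else if a = b then 1 else 0))"
  have Tc: "T u \<in> carrier_mat n n" for u by (simp add: T_def)
  have T: "T u $$ (a, b) = (if b = i then v a / (u - y) else if a = b then 1 else 0)"
    if "a < n" "b < n" for a b u using that by (simp add: T_def)
  have detT: "det (T u) = 1 / (u - y)" for u
    unfolding T_def using det_replace_column[OF i(1), of "\<lambda>a. v a / (u - y)"] vi by simp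
  have ev: "\<forall>\<^sub>\<infinity>u :: real. complex_of_real u \<noteq> y"
    by (rule cofinite_neq)
  have H'T: "eval_mat n H' (of_real u) = ctr (T (of_real u)) * eval_mat n H (of_real u) * T (of_real u)"
    if "complex_of_real u \<noteq> y" for u
  proof (rule eq_matI)
    fix a b assume "a < dim_row (ctr (T (complex_of_real u)) * eval_mat n H (of_real u) * T (of_real u))"
      "b < dim_col (ctr (T (complex_of_real u)) * eval_mat n H (of_real u) * T (of_real u))"
    then have ab: "a < n" "b < n" using Tc[of "of_real u"] by auto
    let ?u = "complex_of_real u"
    have uy: "?u - y \<noteq> 0" "?u - cnj y \<noteq> 0" using that by (auto simp: complex_eq_iff)
    have ru: "poly (Hv c) ?u / (?u - y) = poly (r c) ?u" if "c < n" for c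
      using uy by (simp add: Hv[OF that] del: mult_pCons_left)
    have col: "(\<Sum>d<n. poly (H c d) ?u * T ?u $$ (d, b)) = (if b = i then poly (r c) ?u else poly (H c b) ?u)"
      if "c < n" for c
    proof (cases "b = i")
      case True
      then have "(\<Sum>d<n. poly (H c d) ?u * T ?u $$ (d, b)) = poly (Hv c) ?u / (?u - y)"
        using ab by (simp add: T Hv_def poly_sum sum_divide_distrib mult_ac)
      then show ?thesis using ru that True by simp
    next
      case False
      then show ?thesis
        using ab by (subst sum_one_term[of b]) (auto simp: T)
    qed
    have "(ctr (T ?u) * eval_mat n H ?u * T ?u) $$ (a, b) =
      (\<Sum>c<n. cnj (T ?u $$ (c, a)) * (if b = i then poly (r c) ?u else poly (H c b) ?u))"
      using ab Tc by (subst ctr_mult_mult_index[of _ n _ n _ n])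
        (auto simp: sum_distrib_left[symmetric] mult.assoc col intro!: sum.cong)
    also have "\<dots> = poly (H' a b) ?u"
    proof (cases "a = i")
      case False
      then show ?thesis using ab by (subst sum_one_term[of a]) (auto simp: T H'_def)
    next
      case a: True
      show ?thesis
      proof (cases "b = i")
        case True
        have "(\<Sum>c<n. cnj (T ?u $$ (c, a)) * (if b = i then poly (r c) ?u else poly (H c b) ?u)) =
          poly g1 ?u / (?u - cnj y)"
          using a True ab by (simp add: T g1_def poly_sum sum_divide_distrib)
        also have "\<dots> = poly g2 ?u" using uy by (simp add: g2 del: mult_pCons_left)
        finally show ?thesis using a True by (simp add: H'_def)
      next
        case False
        have "cnj (poly (H b c) ?u) = poly (H c b) ?u" if "c < n" for c
          using symH[OF that ab(2)] by (metis poly_cnj complex_cnj_complex_of_real)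
        then have "(\<Sum>c<n. cnj (T ?u $$ (c, a)) * (if b = i then poly (r c) ?u else poly (H c b) ?u)) =
          cnj (\<Sum>c<n. v c * poly (H b c) ?u / (?u - y))"
          using a False ab by (simp add: T)
        also have "\<dots> = cnj (poly (r b) ?u)"
          using ru[OF ab(2)] by (simp add: Hv_def poly_sum sum_divide_distrib)
        finally show ?thesis using a False by (simp add: H'_def poly_map_poly_cnj)
      qed
    qed
    finally show "eval_mat n H' ?u $$ (a, b) = (ctr (T ?u) * eval_mat n H ?u * T ?u) $$ (a, b)"
      using ab by simp
  qed (use carrier_matD[OF Tc[of "of_real u"]] in auto)
  have B'T: "T (of_real u) * eval_mat n B' (of_real u) = eval_mat n B (of_real u) * T (of_real u)"
    if "complex_of_real u \<noteq> y" for u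
  proof (rule eq_matI)
    fix a b assume "a < dim_row (eval_mat n B (complex_of_real u) * T (of_real u))"
      "b < dim_col (eval_mat n B (complex_of_real u) * T (of_real u))"
    then have ab: "a < n" "b < n" using Tc[of "of_real u"] by auto
    let ?u = "complex_of_real u"
    have uy: "?u - y \<noteq> 0" using that by auto
    have "(eval_mat n B ?u * T ?u) $$ (a, b) = (\<Sum>c<n. poly (B a c) ?u * T ?u $$ (c, b))"
      using ab Tc by (subst mult_mat_index_sum[of _ n n _ n]) auto
    also have "\<dots> = (if b = i then poly (Bv a) ?u / (?u - y) else poly (B a b) ?u)"
    proof (cases "b = i")
      case True
      then show ?thesis
        using ab by (simp add: T Bv_def poly_sum sum_divide_distrib mult_ac)
    next
      case False
      then show ?thesis
        using ab by (subst sum_one_term[of b]) (auto simp: T)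
    qed
    finally have R: "(eval_mat n B ?u * T ?u) $$ (a, b) =
      (if b = i then poly (Bv a) ?u / (?u - y) else poly (B a b) ?u)" .
    have "(T ?u * eval_mat n B' ?u) $$ (a, b) = (\<Sum>c<n. T ?u $$ (a, c) * poly (B' c b) ?u)"
      using ab Tc by (subst mult_mat_index_sum[of _ n n _ n]) auto
    also have "\<dots> = (if b = i then poly (Bv a) ?u / (?u - y) else poly (B a b) ?u)"
    proof (cases "a = i")
      case True
      then have "(\<Sum>c<n. T ?u $$ (a, c) * poly (B' c b) ?u) = T ?u $$ (i, i) * poly (B' i b) ?u"
        using ab by (subst sum_one_term[of i]) (auto simp: T)
      also have "\<dots> = (if b = i then poly (Bv a) ?u / (?u - y) else poly (B a b) ?u)"
        using True uy i vi by (simp add: T B'_def del: mult_pCons_left)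
      finally show ?thesis .
    next
      case False
      then have "(\<Sum>c<n. T ?u $$ (a, c) * poly (B' c b) ?u) =
          T ?u $$ (a, a) * poly (B' a b) ?u + T ?u $$ (a, i) * poly (B' i b) ?u"
        using ab i by (subst sum_two_terms[of a _ i]) (auto simp: T)
      also have "\<dots> = poly (B' a b) ?u + v a * (poly (B' i b) ?u / (?u - y))"
        using False ab i by (simp add: T)
      also have "\<dots> = (if b = i then poly (Bv a) ?u / (?u - y) else poly (B a b) ?u)"
      proof (cases "b = i")
        case True
        have "poly (Bv a) ?u - v a * poly (Bv i) ?u = (?u - y) * poly (q a) ?u"
          using arg_cong[OF q[OF ab(1)], of "\<lambda>p. poly p ?u"] by (simp del: mult_pCons_left)
        then show ?thesis using True False uy by (simp add: B'_def field_simps del: mult_pCons_left)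
      next
        case b: False
        then show ?thesis using False uy by (simp add: B'_def del: mult_pCons_left)
      qed
      finally show ?thesis .
    qed
    finally show "(T ?u * eval_mat n B' ?u) $$ (a, b) = (eval_mat n B ?u * T ?u) $$ (a, b)"
      using R by simp
  qed (use carrier_matD[OF Tc[of "of_real u"]] in auto)
  have bc: "\<forall>\<^sub>\<infinity>u :: real. poly_base_change n H B H' B' u"
    using ev
  proof (rule eventually_mono)
    fix u assume u: "complex_of_real u \<noteq> y"
    show "poly_base_change n H B H' B' u"
      unfolding base_change_def
      by (rule bexI[OF _ Tc[of "of_real u"]])
        (use u i i0 in \<open>auto simp: detT H'T B'T T\<close>)
  qed
  \<comment> \<open>The determinant of \<open>T\<close> is 1 / (u - y), and at real u that of its
    adjoint is 1 / (u - cnj y); hence the loss of two in the degree.\<close>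
  have "det (poly_mat n H) = [:-y, 1:] * [:-cnj y, 1:] * det (poly_mat n H')"
    (is "_ = ?R")
  proof (rule poly_eqI_cofinite, rule eventually_mono[OF ev])
    fix u assume u: "complex_of_real u \<noteq> y"
    let ?u = "complex_of_real u"
    have uy: "?u - y \<noteq> 0" "?u - cnj y \<noteq> 0" using u by (auto simp: complex_eq_iff)
    have c1: "ctr (T ?u) \<in> carrier_mat n n" using Tc by (rule ctr_carrier)
    note c = c1 mult_carrier_mat[OF c1 eval_mat_carrier[of n H ?u]]
    have "det (eval_mat n H' ?u) = cnj (1 / (?u - y)) * det (eval_mat n H ?u) * (1 / (?u - y))"
      unfolding H'T[OF u] using c Tc[of ?u] by (simp add: det_mult[of _ n] det_ctr[of _ n] detT)
    also have "cnj (1 / (?u - y)) = 1 / (?u - cnj y)" by simp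
    finally have "det (eval_mat n H ?u) = (?u - y) * (?u - cnj y) * det (eval_mat n H' ?u)"
      using uy by simp
    also have "\<dots> = poly ?R ?u" by (simp only: det_eval_mat poly_mult) simp
    finally show "poly (det (poly_mat n H)) ?u = poly ?R ?u" by (simp only: det_eval_mat)
  qed
  moreover have "det (poly_mat n H) \<noteq> 0" using deg by auto
  ultimately have "degree (det (poly_mat n H)) = degree (det (poly_mat n H')) + 2"
    by (simp add: degree_mult_eq del: mult_pCons_left)
  then show thesis
    using that[of i H' B'] i ki dH' dB' bc unfolding k'_def by blast
qed

section \<open>Orthonormalization and companion matrices\<close>

lemma poly_degree_le_0: "deg_le p 0 \<Longrightarrow> poly p z = coeff p 0"
proof -
  assume "deg_le p 0"
  then have "degree p = 0" by (auto simp: deg_le_degree)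
  then obtain c where "p = [:c:]" by (rule degree_eq_zeroE)
  then show ?thesis by simp
qed

lemma poly_degree_le_1: "deg_le p 1 \<Longrightarrow> poly p z = coeff p 0 + z * coeff p 1"
proof -
  assume "deg_le p 1"
  then have "degree p \<le> 1" by (auto simp: deg_le_degree)
  then have "poly p z = (\<Sum>i\<le>1. coeff p i * z ^ i)"
    unfolding poly_altdef by (intro sum.mono_neutral_left) (auto simp: coeff_eq_0)
  then show ?thesis by simp
qed

text \<open>An orthonormal system is extended one vector at a time, starting from the first basis
  vector; this is why its norm has to be 1. A vector orthogonal to the earlier ones is found as a
  solution of fewer than n linear equations rather than by projection.\<close>

lemma orthonormal_basis:
  assumes H: "H \<in> carrier_mat n n" "ctr H = H" "posdef n H" "H $$ (0, 0) = 1" and n: "0 < n"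
  obtains W where "W \<in> carrier_mat n n" "ctr W * H * W = 1\<^sub>m n"
    "\<And>a. a < n \<Longrightarrow> W $$ (a, 0) = (if a = 0 then 1 else 0)"
proof -
  define ip where "ip = (\<lambda>(x :: nat \<Rightarrow> complex) y. \<Sum>a<n. \<Sum>b<n. cnj (x a) * H $$ (a, b) * y b)"
  have Hsym: "cnj (H $$ (a, b)) = H $$ (b, a)" if "a < n" "b < n" for a b
    using arg_cong[OF H(2), of "\<lambda>M. M $$ (b, a)"] H(1) that by simp
  have ip_cnj: "cnj (ip x y) = ip y x" for x y
  proof -
    have "cnj (ip x y) = (\<Sum>a<n. \<Sum>b<n. x a * H $$ (b, a) * cnj (y b))"
      unfolding ip_def using Hsym by simp
    also have "\<dots> = ip y x" unfolding ip_def by (subst sum.swap) (simp add: mult_ac)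
    finally show ?thesis .
  qed
  have ip_pos: "ip x x \<noteq> 0 \<and> ip x x = of_real (Re (ip x x)) \<and> 0 < Re (ip x x)" if "\<exists>a<n. x a \<noteq> 0" for x
  proof -
    have "0 < Re (ip x x)" using H(3) that unfolding posdef_def ip_def by blast
    moreover have "Im (ip x x) = 0" using ip_cnj[of x x] by (metis Reals_cnj_iff complex_is_Real_iff)
    ultimately show ?thesis by (auto simp: complex_eq_iff)
  qed
  have ip_smult: "ip x (\<lambda>a. c * y a) = c * ip x y" "ip (\<lambda>a. c * y a) x = cnj c * ip y x" for c x y
    unfolding ip_def by (simp_all add: sum_distrib_left mult_ac)
  have "\<exists>w. (\<forall>a. w 0 a = (if a = 0 then 1 else 0)) \<and>
    (\<forall>i<k. \<forall>j<k. ip (w i) (w j) = (if i = j then 1 else 0))" if "0 < k" "k \<le> n" for k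
    using that
  proof (induction k)
    case (Suc k)
    show ?case
    proof (cases "k = 0")
      case True
      define w where "w = (\<lambda>(i :: nat) (a :: nat). if a = 0 then 1 else 0 :: complex)"
      have "(\<Sum>b<n. cnj (w 0 a) * H $$ (a, b) * w 0 b) = (if a = 0 then 1 else 0)" if "a < n" for a
        using n H(4) by (subst sum.mono_neutral_right[of _ "{0}"]) (auto simp: w_def)
      then have "ip (w 0) (w 0) = 1"
        unfolding ip_def using n by simp
      then show ?thesis using True by (intro exI[of _ w]) (auto simp: w_def)
    next
      case False
      then obtain w where w: "\<forall>a. w 0 a = (if a = 0 then 1 else 0)"
        "\<forall>i<k. \<forall>j<k. ip (w i) (w j) = (if i = j then 1 else 0)" using Suc by auto
      \<comment> \<open>The rows below \<open>k\<close> are the functionals \<open>ip (w i)\<close>;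
        row \<open>k\<close> is zero, so the determinant vanishes and a common kernel vector
        exists.\<close>
      define M where "M = mat n n (\<lambda>(i, b). if i < k then (\<Sum>a<n. cnj (w i a) * H $$ (a, b)) else 0)"
      have M: "M \<in> carrier_mat n n" by (simp add: M_def)
      have kn: "k < n" using Suc by simp
      have "det M = (\<Sum>j<n. M $$ (k, j) * cofactor M k j)"
        by (rule laplace_expansion_row[OF M kn])
      also have "\<dots> = 0" by (rule sum.neutral) (use kn in \<open>auto simp: M_def\<close>)
      finally have "det M = 0" .
      from singular_matrix_kernel[OF M this] obtain x where x: "\<exists>a<n. x a \<noteq> 0"
        "\<And>a. a < n \<Longrightarrow> (\<Sum>b<n. M $$ (a, b) * x b) = 0" by blast
      have wx: "ip (w i) x = 0" if "i < k" for i
      proof -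
        have "ip (w i) x = (\<Sum>b<n. M $$ (i, b) * x b)"
          unfolding ip_def using that kn by (subst sum.swap) (simp add: M_def sum_distrib_right)
        then show ?thesis using x(2)[of i] that kn by simp
      qed
      then have xw: "ip x (w i) = 0" if "i < k" for i
        using that ip_cnj[of "w i" x] by simp
      define c where "c = complex_of_real (1 / sqrt (Re (ip x x)))"
      have cc: "cnj c * (c * ip x x) = 1"
      proof -
        define \<rho> where "\<rho> = Re (ip x x)"
        have "ip x x = of_real \<rho>" "0 < \<rho>" using ip_pos[OF x(1)] by (auto simp: \<rho>_def)
        then have "cnj c * (c * ip x x) = of_real (1 / sqrt \<rho> * (1 / sqrt \<rho> * \<rho>))"
          by (simp only: c_def \<rho>_def[symmetric] Re_complex_of_real complex_cnj_complex_of_real of_real_mult)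
        also have "1 / sqrt \<rho> * (1 / sqrt \<rho> * \<rho>) = 1"
          using \<open>0 < \<rho>\<close> real_sqrt_mult_self[of \<rho>] by (simp add: field_simps del: real_sqrt_mult_self)
        finally show ?thesis by simp
      qed
      define w' where "w' = w(k := \<lambda>a. c * x a)"
      have "w' 0 a = (if a = 0 then 1 else 0)" for a using False w by (simp add: w'_def)
      moreover have "ip (w' i) (w' j) = (if i = j then 1 else 0)" if "i < Suc k" "j < Suc k" for i j
        using that w wx xw cc cc[unfolded mult.left_commute[of "cnj c" c]]
        by (cases "i = k"; cases "j = k") (auto simp: w'_def ip_smult)
      ultimately show ?thesis by (intro exI[of _ w']) auto
    qed
  qed simp
  from this[of n] n obtain w where w: "\<forall>a. w 0 a = (if a = 0 then 1 else 0)"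
    "\<forall>i<n. \<forall>j<n. ip (w i) (w j) = (if i = j then 1 else 0)" by blast
  define W where "W = mat n n (\<lambda>(a, i). w i a)"
  have W: "W \<in> carrier_mat n n" by (simp add: W_def)
  have "ctr W * H * W = 1\<^sub>m n"
  proof (rule eq_matI)
    fix i j assume "i < dim_row (1\<^sub>m n :: complex mat)" "j < dim_col (1\<^sub>m n :: complex mat)"
    then have ij: "i < n" "j < n" by auto
    have "(ctr W * H * W) $$ (i, j) = ip (w i) (w j)"
      using ij W H(1) by (subst ctr_mult_mult_index[of _ n _ n _ n]) (auto simp: W_def ip_def)
    then show "(ctr W * H * W) $$ (i, j) = 1\<^sub>m n $$ (i, j)" using w ij by simp
  qed (use W in \<open>auto simp: W_def\<close>)
  then show thesis using that[OF W] w n by (auto simp: W_def)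
qed


section \<open>Companion matrices\<close>

text \<open>Multiplication by x modulo a monic polynomial of degree n, in the basis 1, x, ..., x^(n
  - 1); \<open>f a\<close> is the coefficient of x^a below the top, and the last column reduces
  x^n.\<close>

definition companion :: "nat \<Rightarrow> (nat \<Rightarrow> 'a::comm_ring_1) \<Rightarrow> 'a mat" where
  "companion n f = mat n n (\<lambda>(a, b). if Suc b = n then - f a else if a = Suc b then 1 else 0)"

text \<open>The row (1, x, ..., x^(n - 1)) times the characteristic matrix is zero except for its
  last entry, the value of the polynomial. Putting this row on top by the unimodular
  \<open>E\<close> and expanding along it leaves a triangular minor with diagonal -1, whose sign
  cancels that of the cofactor.\<close>

lemma det_companion:
  assumes n: "0 < n"
  shows "det (x \<cdot>\<^sub>m 1\<^sub>m n - companion n f) = x ^ n + (\<Sum>a<n. f a * x ^ a)"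
proof -
  let ?M = "x \<cdot>\<^sub>m 1\<^sub>m n - companion n f"
  have M: "?M \<in> carrier_mat n n" by (intro minus_carrier_mat) (simp add: companion_def)
  define E where "E = mat n n (\<lambda>(a, b). if a = 0 then x ^ b else if a = b then 1 else 0)"
  have E: "E \<in> carrier_mat n n" by (simp add: E_def)
  have "upper_triangular E" by (auto simp: upper_triangular_def E_def)
  then have detE: "det E = 1"
    using det_upper_triangular[OF _ E] E
    by (auto simp: diag_mat_def E_def intro!: prod_list_neutral)
  have EM: "E * ?M \<in> carrier_mat n n" using E M by auto
  define c where "c = x ^ n + (\<Sum>a<n. f a * x ^ a)"
  have row: "(E * ?M) $$ (0, b) = (if Suc b = n then c else 0)" if b: "b < n" for b
  proof -
    have Mab: "?M $$ (a, b) = (if a = b then x else 0) + (if Suc b = n then f a else 0)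
        - (if a = Suc b then 1 else 0)" if "a < n" for a
      using that b by (auto simp: companion_def)
    have "(E * ?M) $$ (0, b) = (\<Sum>a<n. E $$ (0, a) * ?M $$ (a, b))"
      using E M n b by (simp add: mult_mat_index_sum[of _ n n _ n] del: index_mult_mat(1))
    also have "\<dots> = (\<Sum>a<n. (if a = b then x ^ Suc a else 0) + (if Suc b = n then f a * x ^ a else 0)
        - (if a = Suc b then x ^ a else 0))"
    proof (intro sum.cong refl)
      fix a assume "a \<in> {..<n}"
      then have a: "a < n" by simp
      show "E $$ (0, a) * ?M $$ (a, b) = (if a = b then x ^ Suc a else 0) +
          (if Suc b = n then f a * x ^ a else 0) - (if a = Suc b then x ^ a else 0)"
        unfolding Mab[OF a] using a n by (simp add: E_def algebra_simps)
    qed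
    also have "\<dots> = (if Suc b = n then c else 0)"
      using b by (cases "Suc b = n") (auto simp: sum.distrib sum_subtractf c_def)
    finally show ?thesis .
  qed
  have other: "(E * ?M) $$ (a, b) = ?M $$ (a, b)" if "0 < a" "a < n" "b < n" for a b
  proof -
    have "(E * ?M) $$ (a, b) = (\<Sum>d<n. E $$ (a, d) * ?M $$ (d, b))"
      using E M that by (simp add: mult_mat_index_sum[of _ n n _ n] del: index_mult_mat(1))
    also have "\<dots> = (\<Sum>d<n. if d = a then ?M $$ (a, b) else 0)"
      using that by (intro sum.cong) (auto simp: E_def)
    finally show ?thesis using that by simp
  qed
  define N where "N = mat_delete (E * ?M) 0 (n - 1)"
  have N: "N \<in> carrier_mat (n - 1) (n - 1)" unfolding N_def by (rule mat_delete_carrier[OF EM])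
  have Nab: "N $$ (a, b) = (if Suc a = b then x else if a = b then - 1 else 0)"
    if "a < n - 1" "b < n - 1" for a b
    using that EM other[of "Suc a" b] by (auto simp: N_def mat_delete_def companion_def)
  have "det ?M = det (E * ?M)"
    using det_mult[OF E M] detE by simp
  also have "\<dots> = (\<Sum>b<n. (E * ?M) $$ (0, b) * cofactor (E * ?M) 0 b)"
    by (rule laplace_expansion_row[OF EM n])
  also have "\<dots> = (\<Sum>b<n. if b = n - 1 then c * cofactor (E * ?M) 0 b else 0)"
    using row by (intro sum.cong) auto
  also have "\<dots> = c * cofactor (E * ?M) 0 (n - 1)" using n by simp
  also have "cofactor (E * ?M) 0 (n - 1) = (- 1) ^ (n - 1) * det N"
    by (simp add: cofactor_def N_def)
  also have "det N = (- 1) ^ (n - 1)"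
  proof -
    have "upper_triangular N" using N Nab by (auto simp: upper_triangular_def)
    then have "det N = prod_list (diag_mat N)" using det_upper_triangular N by blast
    also have "diag_mat N = map (\<lambda>_. - 1) [0..<n - 1]" using N Nab by (simp add: diag_mat_def)
    also have "prod_list \<dots> = (- 1) ^ (n - 1)" by (simp add: map_replicate_const)
    finally show ?thesis .
  qed
  also have "c * ((- 1) ^ (n - 1) * (- 1) ^ (n - 1)) = c" by (simp flip: power_add mult_2)
  finally show ?thesis by (simp add: c_def)
qed

section \<open>Hankel matrices of interlacing pairs\<close>

text \<open>The coefficients \<open>h\<^sub>k\<close> in \<open>q / f = (\<Sum>k. h\<^sub>k / s ^ (k + 1))\<close>, for monic \<open>f\<close> of degree \<open>m\<close>.\<close>

fun markov_seq :: "nat \<Rightarrow> (nat \<Rightarrow> 'a::comm_ring_1) \<Rightarrow> (nat \<Rightarrow> 'a) \<Rightarrow> nat \<Rightarrow> 'a" where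
  "markov_seq m f q k = (if k < m then q (m - 1 - k) else 0) -
     (\<Sum>j\<in>{..<k}. if k - j \<le> m then f (m - (k - j)) * markov_seq m f q j else 0)"

declare markov_seq.simps [simp del]

lemma markov_seq_poly:
  "poly (markov_seq m f q k) u = markov_seq m (\<lambda>j. poly (f j) u) (\<lambda>j. poly (q j) u) k"
proof (induction k rule: less_induct)
  case (less k)
  then show ?case
    by (subst (1 2) markov_seq.simps) (auto simp: poly_sum intro!: sum.cong)
qed

lemma coeff_mult_top:
  assumes "deg_le p (int a)" "deg_le q (int b)"
  shows "coeff (p * q) (a + b) = coeff p a * coeff q b"
proof -
  have "coeff (p * q) (a + b) = (\<Sum>i\<le>a + b. coeff p i * coeff q (a + b - i))" by (rule coeff_mult)
  also have "\<dots> = (\<Sum>i\<in>{a}. coeff p i * coeff q (a + b - i))"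
  proof (rule sum.mono_neutral_right)
    show "\<forall>i\<in>{..a + b} - {a}. coeff p i * coeff q (a + b - i) = 0"
    proof
      fix i assume "i \<in> {..a + b} - {a}"
      then consider "i > a" | "a + b - i > b" by force
      then show "coeff p i * coeff q (a + b - i) = 0"
        using assms unfolding deg_le_def by cases force+
    qed
  qed auto
  finally show ?thesis by simp
qed

text \<open>Give s and u weight one each: \<open>f\<close> and \<open>q\<close> have weights at most
  m and m - 1, so the coefficient of 1 / s^(k + 1) in q / f has degree at most k in u.\<close>

lemma markov_seq_deg_le:
  assumes "\<And>j. j < m \<Longrightarrow> deg_le (f j) (int m - int j)" "\<And>j. j < m \<Longrightarrow> deg_le (q j) (int m - 1 - int j)"
  shows "deg_le (markov_seq m f q k) (int k)"
proof (induction k rule: less_induct)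
  case (less k)
  have "deg_le (f (m - (k - j)) * markov_seq m f q j) (int k)" if "j < k" "k - j \<le> m" for j
  proof -
    have "deg_le (f (m - (k - j))) (int (k - j))" using assms(1)[of "m - (k - j)"] that by (simp add: of_nat_diff)
    from deg_le_mult[OF this less[OF that(1)]] show ?thesis using that by (simp add: of_nat_diff)
  qed
  moreover have "k < m \<Longrightarrow> deg_le (q (m - 1 - k)) (int k)"
    using assms(2)[of "m - 1 - k"] by (simp add: of_nat_diff)
  ultimately show ?case by (subst markov_seq.simps, intro deg_le_diff deg_le_sum) auto
qed

text \<open>The recursion is compatible with passing to parts of top weight. The result is the
  sequence of the pair of leading forms, which geometrically is the restriction to the line at u =
  \<infinity>.\<close>

lemma markov_seq_top:
  assumes "\<And>j. j < m \<Longrightarrow> deg_le (f j) (int m - int j)" "\<And>j. j < m \<Longrightarrow> deg_le (q j) (int m - 1 - int j)"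
  shows "coeff (markov_seq m f q k) k = markov_seq m (\<lambda>j. coeff (f j) (m - j)) (\<lambda>j. coeff (q j) (m - 1 - j)) k"
proof (induction k rule: less_induct)
  case (less k)
  have "coeff (f (m - (k - j)) * markov_seq m f q j) k =
      coeff (f (m - (k - j))) (m - (m - (k - j))) * coeff (markov_seq m f q j) j" if "j < k" "k - j \<le> m" for j
  proof -
    have "deg_le (f (m - (k - j))) (int (k - j))" using assms(1)[of "m - (k - j)"] that by (simp add: of_nat_diff)
    from coeff_mult_top[OF this markov_seq_deg_le[of m f q j]] assms that show ?thesis by simp
  qed
  then show ?case using less
    by (subst (1 2) markov_seq.simps) (auto simp: coeff_sum if_distrib[of "\<lambda>p. coeff p k"] intro!: sum.cong)
qed

text \<open>\<open>f\<close> vanishes at the \<open>s i\<close>, and \<open>q = (\<Sum>i. \<omega> i * f / (x - s i))\<close>, written out in coefficients.\<close>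

definition interlaced :: "nat \<Rightarrow> (nat \<Rightarrow> complex) \<Rightarrow> (nat \<Rightarrow> complex) \<Rightarrow> bool" where
  "interlaced m f q \<longleftrightarrow> (\<exists>s \<omega> :: nat \<Rightarrow> real. inj_on s {..<m} \<and> (\<forall>i<m. 0 < \<omega> i) \<and>
     (\<forall>i<m. (\<Sum>l\<le>m. f l * of_real (s i) ^ l) = 0) \<and>
     (\<forall>b<m. q b = (\<Sum>i<m. of_real (\<omega> i) * (\<Sum>l\<in>{b<..m}. f l * of_real (s i) ^ (l - 1 - b)))))"

text \<open>Each fraction \<omega> / (x - s) expands as the sum of \<omega> s^k / x^(k + 1), so the
  coefficients are moments. The proof checks that the moments obey the recursion: for k < m this is
  the given formula for \<open>q\<close>, and for k \<ge> m the sum contains the factor f(s i) =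
  0.\<close>

lemma markov_seq_interlaced:
  assumes f: "f m = 1"
    and root: "\<And>i. i < m \<Longrightarrow> (\<Sum>l\<le>m. f l * s i ^ l) = 0"
    and q: "\<And>b. b < m \<Longrightarrow> q b = (\<Sum>i<m. \<omega> i * (\<Sum>l\<in>{b<..m}. f l * s i ^ (l - 1 - b)))"
  shows "markov_seq m f q k = (\<Sum>i<m. \<omega> i * s i ^ k)"
proof (induction k rule: less_induct)
  case (less k)
  let ?c = "\<lambda>j. if k - j \<le> m then f (m - (k - j)) else 0"
  have key: "(\<Sum>j\<le>k. ?c j * (\<Sum>i<m. \<omega> i * s i ^ j)) = (if k < m then q (m - 1 - k) else 0)"
  proof -
    have "(\<Sum>j\<le>k. ?c j * (\<Sum>i<m. \<omega> i * s i ^ j)) = (\<Sum>i<m. \<omega> i * (\<Sum>j\<le>k. ?c j * s i ^ j))"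
      unfolding sum_distrib_left by (subst sum.swap) (simp add: mult_ac)
    also have "\<dots> = (if k < m then q (m - 1 - k) else 0)"
    proof (cases "k < m")
      case True
      have "(\<Sum>l\<in>{m - 1 - k<..m}. f l * x ^ (l - 1 - (m - 1 - k))) = (\<Sum>j\<le>k. ?c j * x ^ j)" for x
        using True by (intro sum.reindex_bij_witness[of _ "\<lambda>j. m - (k - j)" "\<lambda>l. l - (m - k)"]) auto
      then show ?thesis using True q[of "m - 1 - k"] by simp
    next
      case False
      have "(\<Sum>j\<le>k. ?c j * x ^ j) = (\<Sum>j\<in>{k - m..k}. f (m - (k - j)) * x ^ j)" for x
        by (intro sum.mono_neutral_cong_right) auto
      also have "\<dots> x = (\<Sum>l\<le>m. f l * x ^ (k - m + l))" for x
        using False by (intro sum.reindex_bij_witness[of _ "\<lambda>l. k - m + l" "\<lambda>j. j - (k - m)"])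
            (auto simp: add.commute)
      also have "\<dots> x = x ^ (k - m) * (\<Sum>l\<le>m. f l * x ^ l)" for x
        by (simp add: power_add sum_distrib_left mult_ac)
      finally have "(\<Sum>j\<le>k. ?c j * s i ^ j) = 0" if "i < m" for i
        using root[OF that] by simp
      then show ?thesis using False by simp
    qed
    finally show ?thesis .
  qed
  have "(\<Sum>j\<le>k. ?c j * (\<Sum>i<m. \<omega> i * s i ^ j)) =
      (\<Sum>i<m. \<omega> i * s i ^ k) + (\<Sum>j<k. ?c j * (\<Sum>i<m. \<omega> i * s i ^ j))"
    using f by (simp add: lessThan_Suc_atMost[symmetric])
  moreover have "markov_seq m f q k = (if k < m then q (m - 1 - k) else 0) - (\<Sum>j<k. ?c j * (\<Sum>i<m. \<omega> i * s i ^ j))"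
    using less by (subst markov_seq.simps) (auto intro!: sum.cong)
  ultimately show ?case using key by simp
qed

lemma polynomial_vanishing:
  fixes c :: "nat \<Rightarrow> complex"
  assumes "inj_on s {..<m}" "\<And>i. i < m \<Longrightarrow> (\<Sum>a<m. c a * s i ^ a) = 0" "a < m"
  shows "c a = 0"
proof -
  define p where "p = (\<Sum>a<m. monom (c a) a)"
  have cp: "coeff p k = (if k < m then c k else 0)" for k
    by (simp add: p_def coeff_sum sum.delta)
  have "p = 0"
  proof (rule ccontr)
    assume p: "p \<noteq> 0"
    have "degree p < m" using cp p by (metis leading_coeff_0_iff)
    have "s ` {..<m} \<subseteq> {x. poly p x = 0}"
      using assms(2) by (auto simp: p_def poly_sum poly_monom)
    then have "card (s ` {..<m}) \<le> card {x. poly p x = 0}"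
      by (intro card_mono poly_roots_finite p)
    also have "\<dots> \<le> degree p" by (rule card_poly_roots_bound[OF p])
    finally show False using \<open>degree p < m\<close> assms(1) by (simp add: card_image)
  qed
  then show ?thesis using cp[of a] assms(3) by simp
qed

definition hankel :: "nat \<Rightarrow> (nat \<Rightarrow> complex) \<Rightarrow> complex mat" where
  "hankel m h = mat m m (\<lambda>(a, b). h (a + b))"

lemma hankel_carrier [simp, intro]: "hankel m h \<in> carrier_mat m m" by (simp add: hankel_def)

lemma companion_carrier [simp, intro]: "companion m f \<in> carrier_mat m m" by (simp add: companion_def)

text \<open>By the moment formula the form at \<open>v\<close> is the sum of \<omega> i |v(s i)|^2,
  with \<open>v\<close> read as a polynomial of degree below m. Multiplication by x raises the
  index, so H times the companion matrix has entries h(a + b + 1); being real and symmetric in a and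
  b, it gives self-adjointness. The second claim evaluates the first row of \<open>H\<close> on the
  resolvent column.\<close>

lemma interlaced_hankel:
  fixes f q :: "nat \<Rightarrow> complex"
  assumes f: "f m = 1" and "interlaced m f q"
  defines "H \<equiv> hankel m (markov_seq m f q)"
  shows "positive_pair m H (companion m f)"
    "(\<Sum>b<m. markov_seq m f q b * (\<Sum>l\<in>{b<..m}. f l * z ^ (l - 1 - b))) = (\<Sum>b<m. q b * z ^ b)"
proof -
  obtain s \<omega> :: "nat \<Rightarrow> real" where s: "inj_on s {..<m}" and w: "\<And>i. i < m \<Longrightarrow> 0 < \<omega> i"
    and root: "\<And>i. i < m \<Longrightarrow> (\<Sum>l\<le>m. f l * complex_of_real (s i) ^ l) = 0"
    and q: "\<And>b. b < m \<Longrightarrow> q b = (\<Sum>i<m. of_real (\<omega> i) * (\<Sum>l\<in>{b<..m}. f l * of_real (s i) ^ (l - 1 - b)))"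
    using assms(2) unfolding interlaced_def by blast
  define h where "h = markov_seq m f q"
  have h: "h k = (\<Sum>i<m. of_real (\<omega> i) * of_real (s i) ^ k)" for k
    unfolding h_def by (rule markov_seq_interlaced[OF f root q])
  have hreal: "cnj (h k) = h k" for k unfolding h by simp
  have H: "H \<in> carrier_mat m m" by (simp add: H_def)
  have Hab: "H $$ (a, b) = h (a + b)" if "a < m" "b < m" for a b
    using that by (simp add: H_def hankel_def h_def)
  have herm: "ctr H = H" by (rule eq_matI) (use H Hab hreal in \<open>auto simp: add.commute\<close>)
  have pd: "posdef m H" unfolding posdef_def
  proof (intro allI impI)
    fix v :: "nat \<Rightarrow> complex" assume v: "\<exists>a<m. v a \<noteq> 0"
    define V where "V = (\<lambda>i. \<Sum>a<m. v a * complex_of_real (s i) ^ a)"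
    have "(\<Sum>a<m. \<Sum>b<m. cnj (v a) * H $$ (a, b) * v b) =
      (\<Sum>a<m. \<Sum>b<m. \<Sum>i<m. of_real (\<omega> i) * ((cnj (v a) * of_real (s i) ^ a) * (v b * of_real (s i) ^ b)))"
      by (simp add: Hab h power_add sum_distrib_left sum_distrib_right mult_ac)
    also have "\<dots> = (\<Sum>i<m. \<Sum>a<m. \<Sum>b<m. of_real (\<omega> i) * ((cnj (v a) * of_real (s i) ^ a) * (v b * of_real (s i) ^ b)))"
      (is "(\<Sum>a<m. \<Sum>b<m. \<Sum>i<m. ?t a b i) = _")
    proof -
      have "(\<Sum>a<m. \<Sum>b<m. \<Sum>i<m. ?t a b i) = (\<Sum>a<m. \<Sum>i<m. \<Sum>b<m. ?t a b i)"
        by (intro sum.cong refl sum.swap)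
      also have "\<dots> = (\<Sum>i<m. \<Sum>a<m. \<Sum>b<m. ?t a b i)" by (rule sum.swap)
      finally show ?thesis .
    qed
    also have "\<dots> = (\<Sum>i<m. of_real (\<omega> i) * (cnj (V i) * V i))"
    proof (intro sum.cong refl)
      fix i
      have "cnj (V i) * V i = (\<Sum>a<m. \<Sum>b<m. (cnj (v a) * of_real (s i) ^ a) * (v b * of_real (s i) ^ b))"
        by (simp add: V_def sum_product)
      then show "(\<Sum>a<m. \<Sum>b<m. of_real (\<omega> i) * ((cnj (v a) * of_real (s i) ^ a) * (v b * of_real (s i) ^ b))) =
          of_real (\<omega> i) * (cnj (V i) * V i)" by (simp only: sum_distrib_left)
    qed
    also have "\<dots> = of_real (\<Sum>i<m. \<omega> i * (cmod (V i))\<^sup>2)"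
      unfolding of_real_sum of_real_mult complex_norm_square by (simp add: mult.commute)
    finally have eq: "Re (\<Sum>a<m. \<Sum>b<m. cnj (v a) * H $$ (a, b) * v b) = (\<Sum>i<m. \<omega> i * (cmod (V i))\<^sup>2)"
      by simp
    have "\<exists>i<m. V i \<noteq> 0"
    proof (rule ccontr)
      assume "\<not> ?thesis"
      then have "v a = 0" if "a < m" for a
        using polynomial_vanishing[of "\<lambda>i. complex_of_real (s i)" m v a] s that
        by (auto simp: V_def inj_on_def)
      then show False using v by auto
    qed
    then obtain i where i: "i < m" "V i \<noteq> 0" by blast
    have "0 < \<omega> i * (cmod (V i))\<^sup>2" using i w by simp
    also have "\<dots> \<le> (\<Sum>i<m. \<omega> i * (cmod (V i))\<^sup>2)"
      using i w by (intro member_le_sum) (auto simp: less_imp_le)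
    finally show "0 < Re (\<Sum>a<m. \<Sum>b<m. cnj (v a) * H $$ (a, b) * v b)" unfolding eq .
  qed
  let ?C = "companion m f"
  have HC: "(H * ?C) $$ (a, b) = h (a + b + 1)" if ab: "a < m" "b < m" for a b
  proof -
    have "(H * ?C) $$ (a, b) = (\<Sum>c<m. H $$ (a, c) * ?C $$ (c, b))"
      using ab H by (simp add: mult_mat_index_sum[of _ m m _ m] del: index_mult_mat(1))
    also have "\<dots> = h (a + b + 1)"
    proof (cases "Suc b = m")
      case True
      \<comment> \<open>Only the last column needs an argument: there the relation f(s i) = 0,
        summed with the weights, reduces h(a + m).\<close>
      have "h (a + m) + (\<Sum>c<m. h (a + c) * f c) = (\<Sum>l\<le>m. h (a + l) * f l)"
        using f by (simp add: lessThan_Suc_atMost[symmetric])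
      also have "\<dots> = (\<Sum>i<m. of_real (\<omega> i) * of_real (s i) ^ a * (\<Sum>l\<le>m. f l * of_real (s i) ^ l))"
        unfolding h sum_distrib_left sum_distrib_right by (subst sum.swap) (simp add: power_add mult_ac)
      also have "\<dots> = 0" using root by simp
      finally have "h (a + m) = - (\<Sum>c<m. h (a + c) * f c)" by (simp add: eq_neg_iff_add_eq_0)
      then show ?thesis using True ab by (auto simp: Hab companion_def sum_negf)
    next
      case False
      then show ?thesis using ab
        by (subst sum.mono_neutral_right[of "{..<m}" "{Suc b}"]) (auto simp: Hab companion_def)
    qed
    finally show ?thesis .
  qed
  have "H * ?C = ctr ?C * H"
  proof (rule eq_matI)
    fix a b assume "a < dim_row (ctr ?C * H)" "b < dim_col (ctr ?C * H)"
    then have ab: "a < m" "b < m" using H by (auto simp: companion_def)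
    have "(ctr ?C * H) $$ (a, b) = (\<Sum>c<m. cnj (?C $$ (c, a)) * H $$ (c, b))"
      using ab H carrier_matD[OF companion_carrier[of m f]]
      by (simp add: mult_mat_index_sum[of _ m m _ m] del: index_mult_mat(1))
    also have "\<dots> = cnj (\<Sum>c<m. H $$ (b, c) * ?C $$ (c, a))"
      using ab by (simp add: Hab hreal add.commute mult.commute)
    also have "\<dots> = cnj ((H * ?C) $$ (b, a))"
      using ab H by (simp add: mult_mat_index_sum[of _ m m _ m] del: index_mult_mat(1))
    finally show "(H * ?C) $$ (a, b) = (ctr ?C * H) $$ (a, b)"
      using HC ab hreal by (simp add: add.commute del: index_mult_mat(1))
  qed (use H in \<open>auto simp: companion_def\<close>)
  then show "positive_pair m H ?C" unfolding positive_pair_def using H herm pd by auto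
  \<comment> \<open>Both sides are the divided difference (f(x) - f(y)) / (x - y); its symmetry in x
    and y lets z and the zeros \<open>s i\<close> trade places.\<close>
  have swap: "(\<Sum>b<m. x ^ b * (\<Sum>l\<in>{b<..m}. f l * y ^ (l - 1 - b))) =
      (\<Sum>l\<le>m. f l * (\<Sum>b<l. x ^ b * y ^ (l - 1 - b)))" for x y :: complex
  proof -
    have "(\<Sum>b<m. x ^ b * (\<Sum>l\<in>{b<..m}. f l * y ^ (l - 1 - b))) =
      (\<Sum>(b, l)\<in>(SIGMA b:{..<m}. {b<..m}). f l * (x ^ b * y ^ (l - 1 - b)))"
      by (simp add: sum.Sigma sum_distrib_left mult_ac)
    also have "\<dots> = (\<Sum>(l, b)\<in>(SIGMA l:{..m}. {..<l}). f l * (x ^ b * y ^ (l - 1 - b)))"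
      by (rule sum.reindex_bij_witness[of _ "\<lambda>(l, b). (b, l)" "\<lambda>(b, l). (l, b)"]) auto
    also have "\<dots> = (\<Sum>l\<le>m. f l * (\<Sum>b<l. x ^ b * y ^ (l - 1 - b)))"
      by (simp add: sum.Sigma sum_distrib_left)
    finally show ?thesis .
  qed
  have sym: "(\<Sum>b<l. x ^ b * y ^ (l - 1 - b)) = (\<Sum>b<l. y ^ b * x ^ (l - 1 - b))" for x y :: complex and l
    by (rule sum.reindex_bij_witness[of _ "\<lambda>b. l - 1 - b" "\<lambda>b. l - 1 - b"]) auto
  have "(\<Sum>b<m. h b * (\<Sum>l\<in>{b<..m}. f l * z ^ (l - 1 - b))) =
     (\<Sum>i<m. of_real (\<omega> i) * (\<Sum>b<m. of_real (s i) ^ b * (\<Sum>l\<in>{b<..m}. f l * z ^ (l - 1 - b))))"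
    unfolding h sum_distrib_right by (subst sum.swap) (simp add: sum_distrib_left mult.assoc)
  also have "\<dots> = (\<Sum>i<m. of_real (\<omega> i) * (\<Sum>b<m. z ^ b * (\<Sum>l\<in>{b<..m}. f l * of_real (s i) ^ (l - 1 - b))))"
    unfolding swap by (subst sym) simp
  also have "\<dots> = (\<Sum>b<m. q b * z ^ b)"
    unfolding sum_distrib_left[of "complex_of_real _"] by (subst sum.swap) (simp add: q sum_distrib_left mult_ac)
  finally show "(\<Sum>b<m. markov_seq m f q b * (\<Sum>l\<in>{b<..m}. f l * z ^ (l - 1 - b))) = (\<Sum>b<m. q b * z ^ b)"
    unfolding h_def .
qed

text \<open>The sums over l > b are the coefficients of the quotient of \<open>f\<close> by x - z.
  This is the recurrence between them; at b = 0 it produces the remainder f(z).\<close>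

lemma horner_step:
  fixes z :: "'a::comm_ring_1"
  assumes "b < m"
  shows "z * (\<Sum>l\<in>{b<..m}. f l * z ^ (l - 1 - b)) + f b =
    (if b = 0 then (\<Sum>l\<le>m. f l * z ^ l) else (\<Sum>l\<in>{b - 1<..m}. f l * z ^ (l - 1 - (b - 1))))"
proof -
  have "{b..m} = insert b {b<..m}" using assms by auto
  then have "(\<Sum>l\<in>{b..m}. f l * z ^ (l - b)) = f b + (\<Sum>l\<in>{b<..m}. f l * z ^ (l - b))" by simp
  also have "(\<Sum>l\<in>{b<..m}. f l * z ^ (l - b)) = (\<Sum>l\<in>{b<..m}. z * (f l * z ^ (l - 1 - b)))"
  proof (intro sum.cong refl)
    fix l assume "l \<in> {b<..m}"
    then have "l - b = Suc (l - 1 - b)" by auto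
    then show "f l * z ^ (l - b) = z * (f l * z ^ (l - 1 - b))" by (simp only: power_Suc mult_ac)
  qed
  finally have 1: "(\<Sum>l\<in>{b..m}. f l * z ^ (l - b)) = f b + z * (\<Sum>l\<in>{b<..m}. f l * z ^ (l - 1 - b))"
    by (simp add: sum_distrib_left)
  show ?thesis
  proof (cases "b = 0")
    case True
    then show ?thesis using 1 by (simp add: atLeast0AtMost)
  next
    case False
    then have "{b - 1<..m} = {b..m}" by auto
    then show ?thesis using 1 False by simp
  qed
qed

text \<open>\<open>X\<close> is the first column of the adjugate, computed by Horner's scheme.\<close>

lemma companion_resolvent:
  fixes z :: complex
  assumes m: "0 < m" and f: "f m = 1"
  defines "X \<equiv> mat m 1 (\<lambda>(b, _). \<Sum>l\<in>{b<..m}. f l * z ^ (l - 1 - b))"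
  shows "(z \<cdot>\<^sub>m 1\<^sub>m m - companion m f) * X =
     (\<Sum>l\<le>m. f l * z ^ l) \<cdot>\<^sub>m mat m 1 (\<lambda>(b, _). if b = 0 then 1 else 0)"
    (is "?M * X = ?c \<cdot>\<^sub>m ?E")
proof (rule eq_matI)
  fix a j assume "a < dim_row (?c \<cdot>\<^sub>m ?E)" "j < dim_col (?c \<cdot>\<^sub>m ?E)"
  then have a: "a < m" and j: "j = 0" by auto
  define x where "x = (\<lambda>b. \<Sum>l\<in>{b<..m}. f l * z ^ (l - 1 - b))"
  have M: "?M \<in> carrier_mat m m" by (intro minus_carrier_mat) simp
  have X: "X \<in> carrier_mat m 1" by (simp add: X_def)
  have last: "x (m - 1) = 1"
  proof -
    have "{m - 1<..m} = {m}" using m by auto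
    then show ?thesis using f by (simp add: x_def)
  qed
  have rec: "z * x b + f b = (if b = 0 then ?c else x (b - 1))" if "b < m" for b
    unfolding x_def by (rule horner_step[OF that])
  have "(?M * X) $$ (a, j) = (\<Sum>b<m. ?M $$ (a, b) * x b)"
    using M X a j by (subst mult_mat_index_sum[of _ m m _ 1]) (auto simp: X_def x_def)
  also have "\<dots> = (\<Sum>b<m. (if b = a then z * x b else 0) + (if b = m - 1 then f a * x b else 0)
      - (if a = Suc b \<and> b \<noteq> m - 1 then x b else 0))"
    using a m by (intro sum.cong) (auto simp: companion_def algebra_simps)
  also have "\<dots> = z * x a + f a * x (m - 1) - (\<Sum>b<m. if a = Suc b \<and> b \<noteq> m - 1 then x b else 0)"
    using a m by (simp add: sum.distrib sum_subtractf)
  also have "(\<Sum>b<m. if a = Suc b \<and> b \<noteq> m - 1 then x b else 0) = (if a = 0 then 0 else x (a - 1))"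
  proof (cases "a = 0")
    case False
    then have "(\<Sum>b<m. if a = Suc b \<and> b \<noteq> m - 1 then x b else 0) = (\<Sum>b<m. if b = a - 1 then x b else 0)"
      using a by (intro sum.cong) auto
    then show ?thesis using False a by auto
  qed simp
  finally show "(?M * X) $$ (a, j) = (?c \<cdot>\<^sub>m ?E) $$ (a, j)"
    using rec[OF a] a j last by auto
qed (auto simp: X_def companion_def)

lemma posdef_det_nonzero:
  assumes "A \<in> carrier_mat n n" "posdef n A"
  shows "det A \<noteq> 0"
proof
  assume "det A = 0"
  from singular_matrix_kernel[OF assms(1) this] obtain v where v: "\<exists>a<n. v a \<noteq> 0"
    "\<And>a. a < n \<Longrightarrow> (\<Sum>b<n. A $$ (a, b) * v b) = 0" by blast
  have "(\<Sum>a<n. \<Sum>b<n. cnj (v a) * A $$ (a, b) * v b) = (\<Sum>a<n. cnj (v a) * (\<Sum>b<n. A $$ (a, b) * v b))"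
    by (simp add: sum_distrib_left mult.assoc)
  also have "\<dots> = 0" using v(2) by simp
  finally have "(\<Sum>a<n. \<Sum>b<n. cnj (v a) * A $$ (a, b) * v b) = 0" .
  moreover have "0 < Re (\<Sum>a<n. \<Sum>b<n. cnj (v a) * A $$ (a, b) * v b)"
    using assms(2) v(1) unfolding posdef_def by blast
  ultimately show False by simp
qed

section \<open>Top coefficient of the Hankel determinant, and the descent\<close>

lemma coeff_prod_top:
  assumes "finite I" "\<And>i. i \<in> I \<Longrightarrow> deg_le (f i) (int (d i))"
  shows "deg_le (\<Prod>i\<in>I. f i) (int (\<Sum>i\<in>I. d i)) \<and>
    coeff (\<Prod>i\<in>I. f i) (\<Sum>i\<in>I. d i) = (\<Prod>i\<in>I. coeff (f i) (d i))"
  using assms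
proof (induction I rule: finite_induct)
  case empty
  then show ?case by (simp add: deg_le_degree)
next
  case (insert x I)
  then show ?case
    using deg_le_mult[of "f x" "int (d x)" "\<Prod>i\<in>I. f i" "int (\<Sum>i\<in>I. d i)"]
      coeff_mult_top[of "f x" "d x" "\<Prod>i\<in>I. f i" "\<Sum>i\<in>I. d i"] by simp
qed

text \<open>For every permutation p the degree bounds i + p i add up to the same number, twice the
  sum of the indices, so only top coefficients contribute to that coefficient.\<close>

lemma coeff_det_top:
  assumes "\<And>a b. a < n \<Longrightarrow> b < n \<Longrightarrow> deg_le (M a b) (int a + int b)"
  shows "coeff (det (poly_mat n M)) (2 * (\<Sum>a<n. a)) =
    det (mat n n (\<lambda>(a, b). coeff (M a b) (a + b)))"
proof -
  have P: "poly_mat n M \<in> carrier_mat n n" by (simp add: poly_mat_def)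
  have Q: "mat n n (\<lambda>(a, b). coeff (M a b) (a + b)) \<in> carrier_mat n n" by simp
  have 1: "coeff (signof p * (\<Prod>i = 0..<n. poly_mat n M $$ (i, p i))) (2 * (\<Sum>a<n. a)) =
      signof p * (\<Prod>i = 0..<n. coeff (M i (p i)) (i + p i))" if p: "p permutes {0..<n}" for p
  proof -
    have pi: "p i < n" if "i < n" for i using permutes_in_image[OF p, of i] that by simp
    have "(\<Sum>i = 0..<n. i + p i) = (\<Sum>i = 0..<n. i) + (\<Sum>i = 0..<n. p i)" by (rule sum.distrib)
    also have "(\<Sum>i = 0..<n. p i) = (\<Sum>i = 0..<n. i)" using sum.permute[OF p, of id] by simp
    finally have s: "2 * (\<Sum>a<n. a) = (\<Sum>i = 0..<n. i + p i)" by (simp add: atLeast0LessThan)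
    have "(\<Prod>i = 0..<n. poly_mat n M $$ (i, p i)) = (\<Prod>i = 0..<n. M i (p i))"
      using pi by (intro prod.cong) (auto simp: poly_mat_def)
    moreover have "coeff (\<Prod>i = 0..<n. M i (p i)) (\<Sum>i = 0..<n. i + p i) = (\<Prod>i = 0..<n. coeff (M i (p i)) (i + p i))"
      using coeff_prod_top[of "{0..<n}" "\<lambda>i. M i (p i)" "\<lambda>i. i + p i"] assms pi by simp
    ultimately show ?thesis unfolding s by (simp add: sign_def)
  qed
  have 2: "(\<Prod>i = 0..<n. coeff (M i (p i)) (i + p i)) =
     (\<Prod>i = 0..<n. mat n n (\<lambda>(a, b). coeff (M a b) (a + b)) $$ (i, p i))" if p: "p permutes {0..<n}" for p
    using permutes_in_image[OF p] by (intro prod.cong) auto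
  show ?thesis
    unfolding det_def'[OF P] det_def'[OF Q] coeff_sum
  proof (rule sum.cong[OF refl])
    fix p assume "p \<in> {p. p permutes {0..<n}}"
    then have p: "p permutes {0..<n}" by simp
    show "coeff (signof p * (\<Prod>i = 0..<n. poly_mat n M $$ (i, p i))) (2 * (\<Sum>a<n. a)) =
      signof p * (\<Prod>i = 0..<n. mat n n (\<lambda>(a, b). coeff (M a b) (a + b)) $$ (i, p i))"
      unfolding 1[OF p] 2[OF p] ..
  qed
qed

text \<open>Induction on the sum of the weights. A step lowers both sides of the last hypothesis by
  two, and a positive sum makes the determinant nonconstant, so that another step is possible. When
  all weights are zero, the bounds leave \<open>H\<close> constant and \<open>B\<close> of degree at
  most one in u.\<close>

lemma reduction_to_constant:
  fixes H B :: "nat \<Rightarrow> nat \<Rightarrow> complex poly" and k :: "nat \<Rightarrow> nat"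
  assumes n: "0 < n" and dH: "\<And>a b. a < n \<Longrightarrow> b < n \<Longrightarrow> deg_le (H a b) (int (k a) + int (k b))"
    and dB: "\<And>a b. a < n \<Longrightarrow> b < n \<Longrightarrow> deg_le (B a b) (1 + int (k b) - int (k a))"
    and k0: "k 0 = 0"
    and pos: "\<forall>\<^sub>\<infinity>u :: real. positive_pair n (eval_mat n H (of_real u)) (eval_mat n B (of_real u))"
    and deg: "2 * (\<Sum>a<n. k a) \<le> degree (det (poly_mat n H))"
  shows "\<exists>K B1 B2. K \<in> carrier_mat n n \<and> B1 \<in> carrier_mat n n \<and> B2 \<in> carrier_mat n n \<and>
    (\<forall>\<^sub>\<infinity>u :: real. base_change n (eval_mat n H (of_real u)) (eval_mat n B (of_real u))
       K (B1 + of_real u \<cdot>\<^sub>m B2))"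
  using dH dB k0 pos deg
proof (induction "\<Sum>a<n. k a" arbitrary: k H B rule: less_induct)
  case less
  show ?case
  proof (cases "(\<Sum>a<n. k a) = 0")
    case True
    then have k: "k a = 0" if "a < n" for a using that by simp
    define K where "K = mat n n (\<lambda>(a, b). coeff (H a b) 0)"
    define B1 where "B1 = mat n n (\<lambda>(a, b). coeff (B a b) 0)"
    define B2 where "B2 = mat n n (\<lambda>(a, b). coeff (B a b) 1)"
    have "eval_mat n H u = K" for u
      using poly_degree_le_0 less.prems(1) k by (intro eq_matI) (auto simp: K_def)
    moreover have "eval_mat n B u = B1 + u \<cdot>\<^sub>m B2" for u
      using poly_degree_le_1 less.prems(2) k by (intro eq_matI) (auto simp: B1_def B2_def)
    ultimately have "base_change n (eval_mat n H u) (eval_mat n B u) K (B1 + u \<cdot>\<^sub>m B2)" for u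
      using base_change_refl[OF eval_mat_carrier[of n H u] eval_mat_carrier[of n B u] n] by (simp only:)
    then show ?thesis
      by (intro exI[of _ K] exI[of _ B1] exI[of _ B2]) (auto simp: K_def B1_def B2_def)
  next
    case False
    then have pos: "0 < degree (det (poly_mat n H))" using less.prems(5) by linarith
    show ?thesis
    proof (rule reduction_step[OF less.prems(1-4) pos])
      fix i H' B' assume step: "i < n" "0 < k i"
        "\<And>a b. a < n \<Longrightarrow> b < n \<Longrightarrow> deg_le (H' a b) (int ((k(i := k i - 1)) a) + int ((k(i := k i - 1)) b))"
        "\<And>a b. a < n \<Longrightarrow> b < n \<Longrightarrow> deg_le (B' a b) (1 + int ((k(i := k i - 1)) b) - int ((k(i := k i - 1)) a))"
        "\<forall>\<^sub>\<infinity>u :: real. poly_base_change n H B H' B' u"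
        "degree (det (poly_mat n H)) = degree (det (poly_mat n H')) + 2"
      define k' where "k' = k(i := k i - 1)"
      have sk: "(\<Sum>a<n. k a) = (\<Sum>a<n. k' a) + 1"
      proof -
        have "(\<Sum>a<n. k a) = k i + (\<Sum>a\<in>{..<n} - {i}. k a)" using step(1) by (intro sum.remove) auto
        moreover have "(\<Sum>a<n. k' a) = k' i + (\<Sum>a\<in>{..<n} - {i}. k' a)" using step(1) by (intro sum.remove) auto
        moreover have "(\<Sum>a\<in>{..<n} - {i}. k' a) = (\<Sum>a\<in>{..<n} - {i}. k a)"
          by (intro sum.cong) (auto simp: k'_def)
        ultimately show ?thesis using step(2) by (simp add: k'_def)
      qed
      have "\<exists>K B1 B2. K \<in> carrier_mat n n \<and> B1 \<in> carrier_mat n n \<and> B2 \<in> carrier_mat n n \<and>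
        (\<forall>\<^sub>\<infinity>u :: real. base_change n (eval_mat n H' (of_real u)) (eval_mat n B' (of_real u))
           K (B1 + of_real u \<cdot>\<^sub>m B2))"
      proof (rule less.hyps[of k'])
        show "(\<Sum>a<n. k' a) < (\<Sum>a<n. k a)" using sk by simp
        show "deg_le (H' a b) (int (k' a) + int (k' b))" if "a < n" "b < n" for a b
          using step(3)[OF that] by (simp add: k'_def)
        show "deg_le (B' a b) (1 + int (k' b) - int (k' a))" if "a < n" "b < n" for a b
          using step(4)[OF that] by (simp add: k'_def)
        show "k' 0 = 0" using less.prems(3) by (simp add: k'_def)
        show "\<forall>\<^sub>\<infinity>u :: real. positive_pair n (eval_mat n H' (of_real u)) (eval_mat n B' (of_real u))"
          using step(5) less.prems(4) by eventually_elim (rule base_change_positive_pair)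
        show "2 * (\<Sum>a<n. k' a) \<le> degree (det (poly_mat n H'))"
          using less.prems(5) step(6) sk by simp
      qed
      then obtain K B1 B2 where K: "K \<in> carrier_mat n n" "B1 \<in> carrier_mat n n" "B2 \<in> carrier_mat n n"
        "\<forall>\<^sub>\<infinity>u :: real. base_change n (eval_mat n H' (of_real u)) (eval_mat n B' (of_real u))
           K (B1 + of_real u \<cdot>\<^sub>m B2)" by blast
      have "\<forall>\<^sub>\<infinity>u :: real. base_change n (eval_mat n H (of_real u)) (eval_mat n B (of_real u))
           K (B1 + of_real u \<cdot>\<^sub>m B2)"
        using K(4) step(5)
      proof eventually_elim
        case (elim u)
        show ?case by (rule base_change_trans[OF elim(2,1) n eval_mat_carrier eval_mat_carrier])
      qed
      then show ?thesis using K by blast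
    qed
  qed
qed

section \<open>Corner entry of the resolvent under a change of basis\<close>

lemma det_linear_poly:
  fixes M N :: "complex mat"
  assumes "M \<in> carrier_mat n n" "N \<in> carrier_mat n n"
  obtains d where "\<And>t. det (M + t \<cdot>\<^sub>m N) = poly d t"
proof -
  have "M + t \<cdot>\<^sub>m N = eval_mat n (\<lambda>a b. [:M $$ (a, b), N $$ (a, b):]) t" for t
    using assms by (intro eq_matI) auto
  then have "det (M + t \<cdot>\<^sub>m N) = poly (det (poly_mat n (\<lambda>a b. [:M $$ (a, b), N $$ (a, b):]))) t" for t
    by (simp only: det_eval_mat)
  then show thesis by (rule that)
qed

text \<open>In orthonormal coordinates, minor over determinant is the entry of the inverse of z - A
  at the marked vector e_0. Since \<open>T\<close> fixes e_0, this is the H-product of e_0 with the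
  inverse of z - C applied to e_0, that is, entry 0 of H X over \<open>f\<close>. Cleared of
  denominators, it also covers eigenvalues z.\<close>

lemma minor_of_base_change:
  assumes n: "0 < n"
    and c: "H \<in> carrier_mat n n" "C \<in> carrier_mat n n" "A \<in> carrier_mat n n" "T \<in> carrier_mat n n" "X \<in> carrier_mat n 1"
    and T0: "\<And>a. a < n \<Longrightarrow> T $$ (a, 0) = (if a = 0 then 1 else 0)"
    and HT: "ctr T * H * T = 1\<^sub>m n" and TA: "T * A = C * T"
    and X: "(z \<cdot>\<^sub>m 1\<^sub>m n - C) * X = f \<cdot>\<^sub>m mat n 1 (\<lambda>(b, _). if b = 0 then 1 else 0)"
  shows "det (z \<cdot>\<^sub>m 1\<^sub>m n - A) = det (z \<cdot>\<^sub>m 1\<^sub>m n - C)"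
    "f * det (mat_delete (z \<cdot>\<^sub>m 1\<^sub>m n - A) 0 0) =
       det (z \<cdot>\<^sub>m 1\<^sub>m n - A) * (H * X) $$ (0, 0)"
proof -
  define M where "M = z \<cdot>\<^sub>m 1\<^sub>m n - A"
  define L where "L = z \<cdot>\<^sub>m 1\<^sub>m n - C"
  define E where "E = mat n 1 (\<lambda>(b :: nat, _ :: nat). if b = 0 then 1 else 0 :: complex)"
  have E: "E \<in> carrier_mat n 1" by (simp add: E_def)
  have z1: "z \<cdot>\<^sub>m 1\<^sub>m n \<in> carrier_mat n n" by simp
  have M: "M \<in> carrier_mat n n" unfolding M_def using c by (intro minus_carrier_mat)
  have L: "L \<in> carrier_mat n n" unfolding L_def using c by (intro minus_carrier_mat)
  \<comment> \<open>The inverse of \<open>T\<close>, read off from \<open>HT\<close> without any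
    division.\<close>
  define S where "S = ctr T * H"
  have S: "S \<in> carrier_mat n n" unfolding S_def using c by (auto intro!: mult_carrier_mat)
  have ST: "S * T = 1\<^sub>m n" using HT by (simp add: S_def)
  have TS: "T * S = 1\<^sub>m n" using mat_mult_left_right_inverse[OF S c(4) ST] .
  have TM: "T * M = L * T"
    unfolding M_def L_def
    using c by (simp add: mult_minus_distrib_mat[OF c(4) z1 c(3)] minus_mult_distrib_mat[OF z1 c(2) c(4)] TA
        mult_smult_distrib[of _ n n _ n] mult_smult_assoc_mat[of _ n n _ n])
  have "det S * det T = 1" using ST S c(4) det_mult[of S n T] by simp
  then have "det T \<noteq> 0" by auto
  moreover have "det T * det M = det L * det T"
    using TM M L c(4) by (metis det_mult)
  ultimately show detML: "det (z \<cdot>\<^sub>m 1\<^sub>m n - A) = det (z \<cdot>\<^sub>m 1\<^sub>m n - C)"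
    unfolding M_def L_def by simp
  have TE: "T * E = E"
  proof (rule eq_matI)
    fix a j assume "a < dim_row E" "j < dim_col E"
    then have a: "a < n" "j < 1" by (auto simp: E_def)
    have "(T * E) $$ (a, j) = (\<Sum>b<n. T $$ (a, b) * E $$ (b, j))"
      using a c E by (simp add: mult_mat_index_sum[of _ n n _ 1] del: index_mult_mat(1))
    also have "\<dots> = (\<Sum>b\<in>{0}. T $$ (a, b) * E $$ (b, j))"
      using n a by (intro sum.mono_neutral_right) (auto simp: E_def)
    also have "\<dots> = E $$ (a, j)" using T0[OF a(1)] n a by (simp add: E_def)
    finally show "(T * E) $$ (a, j) = E $$ (a, j)" .
  qed (use c in \<open>auto simp: E_def\<close>)
  note as = assoc_mult_mat[of _ n n _ n _ 1] mult_carrier_mat[of _ n n _ 1] mult_carrier_mat[of _ n n _ n]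
  have SE: "S * E = E"
  proof -
    have "S * E = S * (T * E)" by (simp add: TE)
    also have "\<dots> = (S * T) * E" using S c E by (simp add: as)
    finally show ?thesis using ST E by simp
  qed
  define Y where "Y = S * X"
  have Y: "Y \<in> carrier_mat n 1" unfolding Y_def using S c by (auto intro!: mult_carrier_mat)
  have TY: "T * Y = X"
  proof -
    have "T * Y = (T * S) * X" unfolding Y_def using S c by (simp add: as)
    then show ?thesis using TS c by simp
  qed
  have "M * Y = (S * T) * (M * Y)" using M Y ST by (simp add: as)
  also have "\<dots> = S * ((T * M) * Y)" using M Y S c by (simp add: as)
  also have "\<dots> = S * (L * (T * Y))" unfolding TM using L Y S c by (simp add: as)
  also have "\<dots> = S * (f \<cdot>\<^sub>m E)" using X by (simp add: TY L_def E_def)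
  also have "\<dots> = f \<cdot>\<^sub>m E" using mult_smult_distrib[OF S E] SE by simp
  finally have MY: "M * Y = f \<cdot>\<^sub>m E" .
  have adj: "adj_mat M \<in> carrier_mat n n" using adj_mat(1)[OF M] .
  \<comment> \<open>The adjugate replaces the inverse of \<open>M\<close>, which need not exist; its
    corner entry is the principal minor.\<close>
  have "det M \<cdot>\<^sub>m Y = (adj_mat M * M) * Y"
    using adj_mat(3)[OF M] Y by (simp add: mult_smult_assoc_mat[of _ n n _ 1])
  also have "\<dots> = adj_mat M * (f \<cdot>\<^sub>m E)" using adj M Y MY by (simp add: as)
  also have "\<dots> = f \<cdot>\<^sub>m (adj_mat M * E)" by (rule mult_smult_distrib[OF adj E])
  finally have "(det M \<cdot>\<^sub>m Y) $$ (0, 0) = (f \<cdot>\<^sub>m (adj_mat M * E)) $$ (0, 0)" by simp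
  then have "det M * Y $$ (0, 0) = f * (adj_mat M * E) $$ (0, 0)"
    using Y adj E n by (simp del: index_mult_mat(1))
  also have "(adj_mat M * E) $$ (0, 0) = adj_mat M $$ (0, 0)"
  proof -
    have "(adj_mat M * E) $$ (0, 0) = (\<Sum>b<n. adj_mat M $$ (0, b) * E $$ (b, 0))"
      using adj E n by (simp add: mult_mat_index_sum[of _ n n _ 1] del: index_mult_mat(1))
    also have "\<dots> = (\<Sum>b\<in>{0}. adj_mat M $$ (0, b) * E $$ (b, 0))"
      using n by (intro sum.mono_neutral_right) (auto simp: E_def)
    finally show ?thesis using n by (simp add: E_def)
  qed
  also have "\<dots> = det (mat_delete M 0 0)"
    using M n by (simp add: adj_mat_def cofactor_def)
  \<comment> \<open>The first column of \<open>T\<close> is e_0, so \<open>ctr T\<close> acts on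
    entry 0 as the identity.\<close>
  also have "Y $$ (0, 0) = (H * X) $$ (0, 0)"
  proof -
    have HX: "H * X \<in> carrier_mat n 1" using c by (auto intro!: mult_carrier_mat)
    have "Y = ctr T * (H * X)" unfolding Y_def S_def using c by (simp add: as)
    also have "\<dots> $$ (0, 0) = (\<Sum>b<n. ctr T $$ (0, b) * (H * X) $$ (b, 0))"
      using n c HX by (subst mult_mat_index_sum[of _ n n _ 1]) auto
    also have "\<dots> = (\<Sum>b\<in>{0}. ctr T $$ (0, b) * (H * X) $$ (b, 0))"
      using n c T0 by (intro sum.mono_neutral_right) (auto simp del: index_mult_mat(1))
    finally show ?thesis using n c T0[of 0] by (simp del: index_mult_mat(1))
  qed
  finally show "f * det (mat_delete (z \<cdot>\<^sub>m 1\<^sub>m n - A) 0 0) =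
       det (z \<cdot>\<^sub>m 1\<^sub>m n - A) * (H * X) $$ (0, 0)" unfolding M_def by simp
qed

section \<open>Hermitian pencils\<close>

abbreviation pencil :: "nat \<Rightarrow> complex mat \<Rightarrow> complex mat \<Rightarrow> complex \<Rightarrow> complex \<Rightarrow> complex mat" where
  "pencil n A B u z \<equiv> z \<cdot>\<^sub>m 1\<^sub>m n - (A + u \<cdot>\<^sub>m B)"

text \<open>\<open>ev\<close> provides the positive pairs on which the descent works, and
  \<open>top\<close> the initial lower bound for the degree of the determinant. All identities are
  first obtained at almost every real u and extend to complex u because both sides are polynomial in
  it.\<close>

theorem determinantal_pencil:
  fixes F G :: "nat \<Rightarrow> complex poly"
  assumes m: "0 < m" and Fm: "F m = 1" and Gm: "G (m - 1) = 1"
    and dF: "\<And>j. j < m \<Longrightarrow> deg_le (F j) (int m - int j)"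
    and dG: "\<And>j. j < m \<Longrightarrow> deg_le (G j) (int m - 1 - int j)"
    and ev: "\<forall>\<^sub>\<infinity>u :: real.
      interlaced m (\<lambda>j. poly (F j) (of_real u)) (\<lambda>j. poly (G j) (of_real u))"
    and top: "interlaced m (\<lambda>j. coeff (F j) (m - j)) (\<lambda>j. coeff (G j) (m - 1 - j))"
  shows "\<exists>A1 A2. hermitian_mat m A1 \<and> hermitian_mat m A2 \<and>
    (\<forall>u z. det (pencil m A1 A2 u z) = (\<Sum>j\<le>m. poly (F j) u * z ^ j)) \<and>
    (\<forall>u z. det (mat_delete (pencil m A1 A2 u z) 0 0) = (\<Sum>j<m. poly (G j) u * z ^ j))"
proof -
  define f where "f = (\<lambda>u j. poly (F j) u)"
  define g where "g = (\<lambda>u j. poly (G j) u)"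
  have fm: "f u m = 1" for u using Fm by (simp add: f_def)
  note ih = interlaced_hankel[where m = m and f = "f w" and q = "g w" for w, OF fm]
  define H where "H = (\<lambda>a b. markov_seq m F G (a + b))"
  have H: "eval_mat m H u = hankel m (markov_seq m (f u) (g u))" for u
    by (rule eq_matI) (auto simp: H_def hankel_def markov_seq_poly f_def g_def)
  define B where "B = (\<lambda>a b. if Suc b = m then - F a else if a = Suc b then 1 else 0)"
  have B: "eval_mat m B u = companion m (f u)" for u
    by (rule eq_matI) (auto simp: B_def companion_def f_def)
  have dH: "deg_le (H a b) (int a + int b)" for a b
    using markov_seq_deg_le[of m F G "a + b"] dF dG by (simp add: H_def)
  have dB: "deg_le (B a b) (1 + int b - int a)" if "a < m" "b < m" for a b
    using deg_le_minus[OF dF[OF that(1)]] that by (auto simp: B_def deg_le_degree)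
  have inter: "\<forall>\<^sub>\<infinity>u :: real. interlaced m (f (of_real u)) (g (of_real u))"
    using ev by (simp add: f_def g_def)
  have deg: "2 * (\<Sum>a<m. a) \<le> degree (det (poly_mat m H))"
  proof (rule le_degree)
    have "coeff (det (poly_mat m H)) (2 * (\<Sum>a<m. a)) =
        det (mat m m (\<lambda>(a, b). coeff (H a b) (a + b)))"
      by (rule coeff_det_top) (rule dH)
    also have "mat m m (\<lambda>(a, b). coeff (H a b) (a + b)) =
        hankel m (markov_seq m (\<lambda>j. coeff (F j) (m - j)) (\<lambda>j. coeff (G j) (m - 1 - j)))"
      using markov_seq_top[of m F G] dF dG by (simp add: hankel_def H_def)
    also have "det \<dots> \<noteq> 0"
      using interlaced_hankel(1)[OF _ top] Fm
      by (intro posdef_det_nonzero[OF hankel_carrier]) (simp add: positive_pair_def)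
    finally show "coeff (det (poly_mat m H)) (2 * (\<Sum>a<m. a)) \<noteq> 0" .
  qed
  have "\<exists>K B1 B2. K \<in> carrier_mat m m \<and> B1 \<in> carrier_mat m m \<and> B2 \<in> carrier_mat m m \<and>
    (\<forall>\<^sub>\<infinity>u :: real. base_change m (eval_mat m H (of_real u)) (eval_mat m B (of_real u))
       K (B1 + of_real u \<cdot>\<^sub>m B2))"
  proof (rule reduction_to_constant[of m H "\<lambda>a. a" B])
    show "\<forall>\<^sub>\<infinity>u :: real. positive_pair m (eval_mat m H (of_real u)) (eval_mat m B (of_real u))"
      using inter by (rule eventually_mono) (simp only: H B ih(1))
  qed (use m dH dB deg in auto)
  then obtain K B1 B2 where c: "K \<in> carrier_mat m m" "B1 \<in> carrier_mat m m" "B2 \<in> carrier_mat m m"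
    and bc: "\<forall>\<^sub>\<infinity>u :: real. base_change m (eval_mat m H (of_real u)) (eval_mat m B (of_real u))
       K (B1 + of_real u \<cdot>\<^sub>m B2)" by blast
  obtain u0 :: real where u0: "base_change m (eval_mat m H (of_real u0)) (eval_mat m B (of_real u0)) K (B1 + of_real u0 \<cdot>\<^sub>m B2)"
    "interlaced m (f (of_real u0)) (g (of_real u0))"
    using cofinite_real_ex[OF eventually_conj[OF bc inter]] by blast
  have K: "ctr K = K" "posdef m K"
    using base_change_positive_pair[OF u0(1)] ih(1)[OF u0(2)] by (simp_all add: positive_pair_def H B)
  \<comment> \<open>The marked vector is never changed, so its norm is still the first Markov
    coefficient, the leading coefficient of \<open>G\<close>.\<close>
  have "K $$ (0, 0) = 1"
  proof -
    obtain T where T: "T \<in> carrier_mat m m" "\<forall>a<m. T $$ (a, 0) = (if a = 0 then 1 else 0)"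
      "K = ctr T * eval_mat m H (of_real u0) * T" using u0(1) unfolding base_change_def by blast
    have "K $$ (0, 0) = (\<Sum>a<m. \<Sum>b<m. cnj (T $$ (a, 0)) * eval_mat m H (of_real u0) $$ (a, b) * T $$ (b, 0))"
      unfolding T(3) by (rule ctr_mult_mult_index) (use T m in auto)
    also have "\<dots> = (\<Sum>a<m. \<Sum>b<m. if a = 0 then if b = 0 then eval_mat m H (of_real u0) $$ (0, 0) else 0 else 0)"
      using T by (intro sum.cong) auto
    also have "\<dots> = (\<Sum>a<m. if a = 0 then eval_mat m H (of_real u0) $$ (0, 0) else 0)"
      using m by (intro sum.cong) auto
    also have "\<dots> = eval_mat m H (of_real u0) $$ (0, 0)" using m by simp
    also have "\<dots> = poly (markov_seq m F G 0) (of_real u0)" using m by (simp add: H_def)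
    also have "markov_seq m F G 0 = 1" by (subst markov_seq.simps) (use m Gm in simp)
    finally show ?thesis by simp
  qed
  from orthonormal_basis[OF c(1) K this m] obtain W where W: "W \<in> carrier_mat m m"
    "ctr W * K * W = 1\<^sub>m m" "\<And>a. a < m \<Longrightarrow> W $$ (a, 0) = (if a = 0 then 1 else 0)" by metis
  have cW: "ctr W \<in> carrier_mat m m" "ctr W * K \<in> carrier_mat m m"
    using W(1) c(1) by (auto intro!: mult_carrier_mat)
  have WW: "W * (ctr W * K) = 1\<^sub>m m" using mat_mult_left_right_inverse[OF cW(2) W(1) W(2)] .
  have "det (ctr W * K) * det W = 1"
    using W(2) det_mult[OF cW(2) W(1)] by simp
  then have detW: "det W \<noteq> 0" by auto
  define A1 where "A1 = ctr W * K * B1 * W"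
  define A2 where "A2 = ctr W * K * B2 * W"
  have A: "A1 \<in> carrier_mat m m" "A2 \<in> carrier_mat m m"
    unfolding A1_def A2_def using c cW W by (auto intro!: mult_carrier_mat)
  note as = assoc_mult_mat[of _ m m _ m _ m] mult_carrier_mat[of _ m m _ m]
  have Au: "A1 + u \<cdot>\<^sub>m A2 = ctr W * K * (B1 + u \<cdot>\<^sub>m B2) * W" for u
  proof -
    have 1: "ctr W * K * (B1 + u \<cdot>\<^sub>m B2) = ctr W * K * B1 + u \<cdot>\<^sub>m (ctr W * K * B2)"
      using c cW by (simp add: mult_add_distrib_mat[of _ m m _ m] mult_smult_distrib[of _ m m _ m])
    have 2: "ctr W * K * B1 \<in> carrier_mat m m" "ctr W * K * B2 \<in> carrier_mat m m"
      using c cW by (auto intro!: mult_carrier_mat)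
    show ?thesis unfolding 1 A1_def A2_def
      using 2 W(1) by (simp add: add_mult_distrib_mat[of _ m m _ _ m] mult_smult_assoc_mat[of _ m m _ m])
  qed
  have bc1: "\<forall>\<^sub>\<infinity>u :: real.
     base_change m (hankel m (markov_seq m (f (of_real u)) (g (of_real u)))) (companion m (f (of_real u)))
       (1\<^sub>m m) (A1 + of_real u \<cdot>\<^sub>m A2) \<and> interlaced m (f (of_real u)) (g (of_real u))"
    using bc inter
  proof eventually_elim
    case (elim u)
    have Bu: "B1 + of_real u \<cdot>\<^sub>m B2 \<in> carrier_mat m m" using c by auto
    have "base_change m K (B1 + of_real u \<cdot>\<^sub>m B2) (1\<^sub>m m) (A1 + of_real u \<cdot>\<^sub>m A2)"
      unfolding base_change_def
    proof (intro bexI[of _ W] conjI)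
      have "W * (A1 + of_real u \<cdot>\<^sub>m A2) = (W * (ctr W * K)) * (B1 + of_real u \<cdot>\<^sub>m B2) * W"
        unfolding Au using W(1) cW Bu by (simp add: as)
      then show "W * (A1 + of_real u \<cdot>\<^sub>m A2) = (B1 + of_real u \<cdot>\<^sub>m B2) * W"
        unfolding WW left_mult_one_mat[OF Bu] .
    qed (use W detW A in auto)
    then show ?case
      using base_change_trans[OF elim(1) _ m eval_mat_carrier eval_mat_carrier] elim(2) by (simp add: H B)
  qed
  have herm: "\<forall>\<^sub>\<infinity>u :: real. ctr (A1 + of_real u \<cdot>\<^sub>m A2) = A1 + of_real u \<cdot>\<^sub>m A2"
    using bc1
  proof (rule eventually_mono, elim conjE)
    fix u assume bu: "base_change m (hankel m (markov_seq m (f (of_real u)) (g (of_real u)))) (companion m (f (of_real u)))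
       (1\<^sub>m m) (A1 + of_real u \<cdot>\<^sub>m A2)" and i: "interlaced m (f (of_real u)) (g (of_real u))"
    have Ac: "A1 + of_real u \<cdot>\<^sub>m A2 \<in> carrier_mat m m" using A by auto
    have "1\<^sub>m m * (A1 + of_real u \<cdot>\<^sub>m A2) = ctr (A1 + of_real u \<cdot>\<^sub>m A2) * 1\<^sub>m m"
      using base_change_positive_pair[OF bu ih(1)[OF i]] unfolding positive_pair_def by blast
    then show "ctr (A1 + of_real u \<cdot>\<^sub>m A2) = A1 + of_real u \<cdot>\<^sub>m A2"
      using left_mult_one_mat[OF Ac] right_mult_one_mat[OF ctr_carrier[OF Ac]] by simp
  qed
  \<comment> \<open>Hermitian at almost all real u means that the two coefficients of u are
    hermitian separately.\<close>
  have hab: "cnj (A1 $$ (b, a)) = A1 $$ (a, b) \<and> cnj (A2 $$ (b, a)) = A2 $$ (a, b)"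
    if ab: "a < m" "b < m" for a b
  proof -
    have "[:cnj (A1 $$ (b, a)), cnj (A2 $$ (b, a)):] = [:A1 $$ (a, b), A2 $$ (a, b):]"
    proof (rule poly_eqI_cofinite, rule eventually_mono[OF herm])
      fix u assume "ctr (A1 + complex_of_real u \<cdot>\<^sub>m A2) = A1 + of_real u \<cdot>\<^sub>m A2"
      then have "ctr (A1 + complex_of_real u \<cdot>\<^sub>m A2) $$ (a, b) = (A1 + of_real u \<cdot>\<^sub>m A2) $$ (a, b)" by simp
      then show "poly [:cnj (A1 $$ (b, a)), cnj (A2 $$ (b, a)):] (of_real u) =
          poly [:A1 $$ (a, b), A2 $$ (a, b):] (of_real u)" using A ab by simp
    qed
    then show ?thesis by simp
  qed
  have hA: "hermitian_mat m A1" "hermitian_mat m A2"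
    unfolding hermitian_mat_ctr using A hab by (auto intro!: eq_matI)
  \<comment> \<open>The second equation keeps the factor f(z) on both sides since it may vanish at a
    particular z.\<close>
  have ev2: "\<forall>\<^sub>\<infinity>u :: real. \<forall>z.
      det (pencil m A1 A2 (of_real u) z) = (\<Sum>j\<le>m. f (of_real u) j * z ^ j) \<and>
      (\<Sum>j\<le>m. f (of_real u) j * z ^ j) * det (mat_delete (pencil m A1 A2 (of_real u) z) 0 0) =
      (\<Sum>j\<le>m. f (of_real u) j * z ^ j) * (\<Sum>j<m. g (of_real u) j * z ^ j)" (is "\<forall>\<^sub>\<infinity>u. ?ev u")
    using bc1
  proof (rule eventually_mono, elim conjE, intro allI)
    fix u and z :: complex
    let ?u = "complex_of_real u"
    let ?H = "hankel m (markov_seq m (f ?u) (g ?u))"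
    let ?C = "companion m (f ?u)"
    let ?A = "A1 + ?u \<cdot>\<^sub>m A2"
    assume bu: "base_change m ?H ?C (1\<^sub>m m) ?A" and i: "interlaced m (f ?u) (g ?u)"
    obtain T where T: "T \<in> carrier_mat m m" "\<And>a. a < m \<Longrightarrow> T $$ (a, 0) = (if a = 0 then 1 else 0)"
      "?A \<in> carrier_mat m m" "ctr T * ?H * T = 1\<^sub>m m" "T * ?A = ?C * T"
      using bu unfolding base_change_def by metis
    define X where "X = mat m 1 (\<lambda>(b :: nat, _ :: nat). \<Sum>l\<in>{b<..m}. f ?u l * z ^ (l - 1 - b))"
    have X: "X \<in> carrier_mat m 1" by (simp add: X_def)
    note mb = minor_of_base_change[OF m hankel_carrier companion_carrier T(3,1) X T(2,4,5)
        companion_resolvent[of m "f ?u" z, OF m fm, folded X_def]]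
    have detC: "det (z \<cdot>\<^sub>m 1\<^sub>m m - ?C) = (\<Sum>j\<le>m. f ?u j * z ^ j)"
      unfolding det_companion[OF m] using fm[of ?u]
      by (simp add: lessThan_Suc_atMost[symmetric] add.commute)
    have "(?H * X) $$ (0, 0) = (\<Sum>b<m. markov_seq m (f ?u) (g ?u) b * X $$ (b, 0))"
      using X m by (subst mult_mat_index_sum[of _ m m _ 1]) (auto simp: hankel_def)
    also have "\<dots> = (\<Sum>j<m. g ?u j * z ^ j)"
      using ih(2)[OF i, of z] by (simp add: X_def)
    finally have HX: "(?H * X) $$ (0, 0) = (\<Sum>j<m. g ?u j * z ^ j)" .
    show "det (z \<cdot>\<^sub>m 1\<^sub>m m - ?A) = (\<Sum>j\<le>m. f ?u j * z ^ j) \<and>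
      (\<Sum>j\<le>m. f ?u j * z ^ j) * det (mat_delete (z \<cdot>\<^sub>m 1\<^sub>m m - ?A) 0 0) =
      (\<Sum>j\<le>m. f ?u j * z ^ j) * (\<Sum>j<m. g ?u j * z ^ j)"
      using mb detC unfolding HX by simp
  qed
  have polyF: "(\<Sum>j\<le>m. f u j * z ^ j) = poly (\<Sum>j\<le>m. smult (z ^ j) (F j)) u"
    "(\<Sum>j\<le>m. f u j * z ^ j) = poly (\<Sum>j\<le>m. monom (f u j) j) z" for u z
    by (simp_all add: f_def poly_sum poly_monom mult.commute)
  have polyG: "(\<Sum>j<m. g u j * z ^ j) = poly (\<Sum>j<m. smult (z ^ j) (G j)) u"
    "(\<Sum>j<m. g u j * z ^ j) = poly (\<Sum>j<m. monom (g u j) j) z" for u z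
    by (simp_all add: g_def poly_sum poly_monom mult.commute)
  have "det (pencil m A1 A2 u z) = (\<Sum>j\<le>m. poly (F j) u * z ^ j)" for u z
  proof -
    have c1: "z \<cdot>\<^sub>m 1\<^sub>m m - A1 \<in> carrier_mat m m" "- A2 \<in> carrier_mat m m"
      using A by (auto intro!: minus_carrier_mat)
    have eq: "pencil m A1 A2 u z = (z \<cdot>\<^sub>m 1\<^sub>m m - A1) + u \<cdot>\<^sub>m (- A2)" for u
      using A by (intro eq_matI) auto
    from det_linear_poly[OF c1] obtain d where d: "\<And>u. det (pencil m A1 A2 u z) = poly d u"
      unfolding eq by metis
    have "d = (\<Sum>j\<le>m. smult (z ^ j) (F j))"
    proof (rule poly_eqI_cofinite, rule eventually_mono[OF ev2])
      fix u assume "?ev u"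
      then have "poly d (of_real u) = (\<Sum>j\<le>m. f (of_real u) j * z ^ j)" unfolding d[symmetric] by blast
      then show "poly d (of_real u) = poly (\<Sum>j\<le>m. smult (z ^ j) (F j)) (of_real u)"
        unfolding polyF(1) .
    qed
    then show ?thesis using d polyF(1)[of u z] by (simp add: f_def)
  qed
  moreover have "det (mat_delete (pencil m A1 A2 u z) 0 0) = (\<Sum>j<m. poly (G j) u * z ^ j)" for u z
  proof -
    have c1: "mat_delete (z \<cdot>\<^sub>m 1\<^sub>m m - A1) 0 0 \<in> carrier_mat (m - 1) (m - 1)"
      "mat_delete (- A2) 0 0 \<in> carrier_mat (m - 1) (m - 1)" for z
      using A by (auto intro!: mat_delete_carrier minus_carrier_mat)
    have eq: "mat_delete (pencil m A1 A2 u z) 0 0 =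
        mat_delete (z \<cdot>\<^sub>m 1\<^sub>m m - A1) 0 0 + u \<cdot>\<^sub>m mat_delete (- A2) 0 0" for u z
      using A by (intro eq_matI) (auto simp: mat_delete_def)
    have c2: "mat_delete (- (A1 + u \<cdot>\<^sub>m A2)) 0 0 \<in> carrier_mat (m - 1) (m - 1)" for u
      using A by (auto intro!: mat_delete_carrier)
    have eq2: "mat_delete (pencil m A1 A2 u z) 0 0 =
        mat_delete (- (A1 + u \<cdot>\<^sub>m A2)) 0 0 + z \<cdot>\<^sub>m 1\<^sub>m (m - 1)" for u z
      using A by (intro eq_matI) (auto simp: mat_delete_def)
    have real: "\<forall>\<^sub>\<infinity>u :: real. \<forall>z.
      det (mat_delete (pencil m A1 A2 (of_real u) z) 0 0) = (\<Sum>j<m. g (of_real u) j * z ^ j)"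
    proof (rule eventually_mono[OF ev2], intro allI)
      fix u :: real and z :: complex
      let ?u = "complex_of_real u"
      assume h: "?ev u"
      from det_linear_poly[OF c2[of ?u] one_carrier_mat] obtain d where
        d: "\<And>z. det (mat_delete (pencil m A1 A2 ?u z) 0 0) = poly d z"
        unfolding eq2 by metis
      let ?f = "\<Sum>j\<le>m. monom (f ?u j) j"
      have "coeff ?f m = 1" using fm by (simp add: coeff_sum sum.delta)
      then have "?f \<noteq> 0" by auto
      \<comment> \<open>As polynomials in z the two sides share the nonzero factor
        \<open>?f\<close>, which can be cancelled.\<close>
      moreover have "?f * d = ?f * (\<Sum>j<m. monom (g ?u j) j)"
      proof (rule poly_eqI_cofinite, rule always_eventually, rule allI)
        fix t :: real
        show "poly (?f * d) (of_real t) = poly (?f * (\<Sum>j<m. monom (g ?u j) j)) (of_real t)"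
          using h[rule_format, of "of_real t"] unfolding d polyF(2) polyG(2) poly_mult by blast
      qed
      ultimately have "d = (\<Sum>j<m. monom (g ?u j) j)" by simp
      then show "det (mat_delete (pencil m A1 A2 ?u z) 0 0) = (\<Sum>j<m. g ?u j * z ^ j)"
        unfolding polyG(2) d by simp
    qed
    from det_linear_poly[OF c1] obtain d where d: "\<And>u. det (mat_delete (pencil m A1 A2 u z) 0 0) = poly d u"
      unfolding eq by metis
    have "d = (\<Sum>j<m. smult (z ^ j) (G j))"
    proof (rule poly_eqI_cofinite, rule eventually_mono[OF real])
      fix u assume "\<forall>z. det (mat_delete (pencil m A1 A2 (complex_of_real u) z) 0 0) = (\<Sum>j<m. g (of_real u) j * z ^ j)"
      then have "poly d (of_real u) = (\<Sum>j<m. g (of_real u) j * z ^ j)" unfolding d[symmetric] by blast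
      then show "poly d (of_real u) = poly (\<Sum>j<m. smult (z ^ j) (G j)) (of_real u)"
        unfolding polyG(1) .
    qed
    then show ?thesis using d polyG(1)[of u z] by (simp add: g_def)
  qed
  ultimately show ?thesis using hA by blast
qed

section \<open>From interlacing zeros to positive weights\<close>

lemma strict_enumeration:
  fixes S :: "real set"
  assumes "finite S"
  obtains s where "bij_betw s {..<card S} S" "\<And>i j. i < j \<Longrightarrow> j < card S \<Longrightarrow> s i < s j"
proof -
  let ?l = "sorted_list_of_set S"
  have l: "length ?l = card S" "set ?l = S" "distinct ?l" "sorted_wrt (<) ?l"
    using assms by auto
  have "bij_betw ((!) ?l) {..<card S} S" using bij_betw_nth[OF l(3), of "{..<card S}" S] l by simp
  moreover have "?l ! i < ?l ! j" if "i < j" "j < card S" for i j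
    using sorted_wrt_nth_less[OF l(4), of i j] l(1) that by simp
  ultimately show thesis by (rule that)
qed

text \<open>The difference has degree below n and n zeros. The common top coefficient may be 1, as
  for \<open>q\<close> against the product over its zeros, or 0, as in the partial fraction
  identity.\<close>

lemma monic_eqI:
  fixes p q :: "complex poly"
  assumes "degree p \<le> n" "degree q \<le> n" "coeff p n = coeff q n"
    and "inj_on s {..<n}" "\<And>i. i < n \<Longrightarrow> poly p (s i) = poly q (s i)"
  shows "p = q"
proof -
  have le: "poly r z = (\<Sum>a\<le>n. coeff r a * z ^ a)" if "degree r \<le> n" for r :: "complex poly" and z
    unfolding poly_altdef using that by (intro sum.mono_neutral_left) (auto simp: coeff_eq_0)
  have "(\<Sum>a<n. coeff (p - q) a * s i ^ a) = 0" if "i < n" for i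
  proof -
    have "0 = poly (p - q) (s i)" using assms(5)[OF that] by simp
    also have "\<dots> = (\<Sum>a\<le>n. coeff (p - q) a * s i ^ a)"
      using assms(1,2) by (intro le degree_diff_le)
    also have "\<dots> = (\<Sum>a<n. coeff (p - q) a * s i ^ a)"
      using assms(3) by (simp add: lessThan_Suc_atMost[symmetric])
    finally show ?thesis by simp
  qed
  then have low: "coeff (p - q) a = 0" if "a < n" for a
    using polynomial_vanishing[OF assms(4)] that by blast
  show ?thesis
  proof (rule poly_eqI)
    fix a
    consider "a < n" | "a = n" | "a > n" by linarith
    then show "coeff p a = coeff q a"
      using low[of a] assms(1-3) by cases (auto simp: coeff_eq_0)
  qed
qed

text \<open>\<open>f\<close> has m distinct real zeros, so \<open>q\<close> has a zero in each of
  the m - 1 gaps and, by its degree, no others. The weights are the residues of q / f, and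
  interlacing determines their signs.\<close>

lemma interlacedI:
  fixes f q :: "complex poly"
  assumes m: "0 < m" and df: "degree f \<le> m" and fm: "coeff f m = 1"
    and dq: "degree q \<le> m - 1" and qm: "coeff q (m - 1) = 1"
    and real: "\<And>z. poly f z = 0 \<Longrightarrow> z \<in> \<real>"
    and simple: "\<And>z. poly f z = 0 \<Longrightarrow> poly (pderiv f) z \<noteq> 0"
    and between: "\<And>s1 s2 :: real. s1 < s2 \<Longrightarrow> poly f (of_real s1) = 0 \<Longrightarrow> poly f (of_real s2) = 0 \<Longrightarrow>
      \<exists>s. s1 < s \<and> s < s2 \<and> poly q (of_real s) = 0"
  shows "interlaced m (coeff f) (coeff q)"
proof -
  have degf: "degree f = m" using df fm by (metis le_antisym le_degree zero_neq_one)
  have lf: "lead_coeff f = 1" using degf fm by simp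
  define Z where "Z = {z. poly f z = 0}"
  have "f \<noteq> 0" using fm by auto
  then have finZ: "finite Z" unfolding Z_def by (rule poly_roots_finite)
  have "rsquarefree f" using simple by (auto simp: rsquarefree_roots)
  then have fZ: "f = (\<Prod>z\<in>Z. [:- z, 1:])"
    using complex_poly_decompose_rsquarefree[of f] lf by (simp add: Z_def)
  have cardZ: "card Z = m"
  proof -
    have "degree (\<Prod>z\<in>Z. [:- z, 1:]) = (\<Sum>z\<in>Z. degree [:- z, 1:])"
      by (rule degree_prod_eq_sum_degree) auto
    then show ?thesis using fZ degf by simp
  qed
  have ZR: "of_real (Re z) = z" if "z \<in> Z" for z
    using real that by (auto simp: Z_def)
  define S where "S = Re ` Z"
  have bijZ: "bij_betw of_real S Z"
    unfolding S_def by (rule bij_betw_byWitness[where f' = Re]) (use ZR in auto)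
  have cS: "card S = m" using bij_betw_same_card[OF bijZ] cardZ by simp
  have finS: "finite S" using finZ by (simp add: S_def)
  obtain s where s: "bij_betw s {..<m} S" "\<And>i j. i < j \<Longrightarrow> j < m \<Longrightarrow> s i < s j"
    using strict_enumeration[OF finS] cS by metis
  have sle: "s i \<le> s j" if "i \<le> j" "j < m" for i j
    using s(2)[of i j] that by (cases "i = j") auto
  have inj: "inj_on s {..<m}" using s(1) by (rule bij_betw_imp_inj_on)
  have injc: "inj_on (\<lambda>i. complex_of_real (s i)) {..<m}" using inj by (auto simp: inj_on_def)
  have bz: "bij_betw (\<lambda>i. complex_of_real (s i)) {..<m} Z"
    using bij_betw_trans[OF s(1) bijZ] by (simp add: o_def)
  have fs: "f = (\<Prod>i<m. [:- of_real (s i), 1:])"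
    using prod.reindex_bij_betw[OF bz, of "\<lambda>z. [:- z, 1:]"] fZ by simp
  have root: "poly f (of_real (s i)) = 0" if "i < m" for i
    using bij_betwE[OF bz] that by (auto simp: Z_def)
  have "\<exists>t. s i < t \<and> t < s (Suc i) \<and> poly q (of_real t) = 0" if "i < m - 1" for i
    using that root[of i] root[of "Suc i"] s(2)[of i "Suc i"] by (intro between) auto
  then obtain t where t: "\<And>i. i < m - 1 \<Longrightarrow> s i < t i \<and> t i < s (Suc i) \<and> poly q (of_real (t i)) = 0"
    by metis
  have tmono: "t i < t j" if "i < j" "j < m - 1" for i j
    using t[of i] t[of j] sle[of "Suc i" j] that by force
  have "inj_on t {..<m - 1}"
    by (rule linorder_inj_onI) (use tmono in \<open>force\<close>)+
  then have injt: "inj_on (\<lambda>i. complex_of_real (t i)) {..<m - 1}" by (auto simp: inj_on_def)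
  have degprod: "degree (\<Prod>i\<in>I. [:- c i, 1:]) = card I \<and> coeff (\<Prod>i\<in>I. [:- c i, 1:]) (card I) = 1"
    for I :: "nat set" and c :: "nat \<Rightarrow> complex"
  proof -
    have "degree (\<Prod>i\<in>I. [:- c i, 1:]) = (\<Sum>i\<in>I. degree [:- c i, 1:])"
      by (rule degree_prod_eq_sum_degree) auto
    then have d: "degree (\<Prod>i\<in>I. [:- c i, 1:]) = card I" by simp
    have "lead_coeff (\<Prod>i\<in>I. [:- c i, 1:]) = 1" by (simp add: lead_coeff_prod)
    then show ?thesis using d by simp
  qed
  have qt: "q = (\<Prod>i<m - 1. [:- of_real (t i), 1:])"
  proof (rule monic_eqI[OF dq _ _ injt])
    show "degree (\<Prod>i<m - 1. [:- complex_of_real (t i), 1:]) \<le> m - 1"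
      "coeff q (m - 1) = coeff (\<Prod>i<m - 1. [:- complex_of_real (t i), 1:]) (m - 1)"
      using degprod[of "\<lambda>i. complex_of_real (t i)" "{..<m - 1}"] qm by simp_all
    show "poly q (complex_of_real (t i)) = poly (\<Prod>i<m - 1. [:- complex_of_real (t i), 1:]) (of_real (t i))"
      if "i < m - 1" for i
      using t[OF that] that by (auto simp: poly_prod)
  qed
  \<comment> \<open>The residue q(s i) / f'(s i), both factored over their zeros.\<close>
  define \<omega> where "\<omega> = (\<lambda>i. (\<Prod>j<m - 1. s i - t j) / (\<Prod>j\<in>{..<m} - {i}. s i - s j))"
  have wpos: "0 < \<omega> i" if i: "i < m" for i
  proof -
    have 1: "(\<Prod>j<m - 1. s i - t j) = (\<Prod>j<i. s i - t j) * (\<Prod>j\<in>{i..<m - 1}. s i - t j)"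
    proof -
      have eq: "{..<m - 1} = {..<i} \<union> {i..<m - 1}" using i by auto
      show ?thesis unfolding eq by (rule prod.union_disjoint) auto
    qed
    have 2: "(\<Prod>j\<in>{..<m} - {i}. s i - s j) = (\<Prod>j<i. s i - s j) * (\<Prod>j\<in>{i..<m - 1}. s i - s (Suc j))"
    proof -
      have eq: "{..<m} - {i} = {..<i} \<union> {Suc i..<m}" using i by auto
      have "(\<Prod>j\<in>{..<m} - {i}. s i - s j) = (\<Prod>j<i. s i - s j) * (\<Prod>j\<in>{Suc i..<m}. s i - s j)"
        unfolding eq by (rule prod.union_disjoint) auto
      also have "(\<Prod>j\<in>{Suc i..<m}. s i - s j) = (\<Prod>j\<in>{i..<m - 1}. s i - s (Suc j))"
        by (rule prod.reindex_bij_witness[of _ Suc "\<lambda>j. j - 1"]) auto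
      finally show ?thesis .
    qed
    \<comment> \<open>For j < i the zero \<open>t j\<close> is paired with \<open>s j\<close>, both
      to the left of \<open>s i\<close>; for j \<ge> i it is paired with \<open>s (Suc j)\<close>,
      both to the right. Every quotient is thus positive.\<close>
    have "\<omega> i = (\<Prod>j<i. (s i - t j) / (s i - s j)) * (\<Prod>j\<in>{i..<m - 1}. (s i - t j) / (s i - s (Suc j)))"
      unfolding \<omega>_def 1 2 by (simp add: prod_dividef)
    also have "\<dots> > 0"
    proof (intro mult_pos_pos prod_pos ballI)
      fix j assume "j \<in> {..<i}"
      then show "0 < (s i - t j) / (s i - s j)"
        using t[of j] sle[of "Suc j" i] i s(2)[of j i] by (intro divide_pos_pos) force+
    next
      fix j assume "j \<in> {i..<m - 1}"
      then show "0 < (s i - t j) / (s i - s (Suc j))"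
        using t[of j] sle[of i j] i s(2)[of i "Suc j"] by (intro divide_neg_neg) force+
    qed
    finally show ?thesis .
  qed
  \<comment> \<open>The quotient of \<open>f\<close> by x - s i, with its coefficients in the form
    in which they enter \<open>interlaced\<close>.\<close>
  define g where "g = (\<lambda>i. \<Sum>b<m. monom (\<Sum>l\<in>{b<..m}. coeff f l * complex_of_real (s i) ^ (l - 1 - b)) b)"
  have cg: "coeff (g i) b = (if b < m then \<Sum>l\<in>{b<..m}. coeff f l * complex_of_real (s i) ^ (l - 1 - b) else 0)" for i b
    by (simp add: g_def coeff_sum sum.delta)
  have froot: "(\<Sum>l\<le>m. coeff f l * complex_of_real (s i) ^ l) = 0" if "i < m" for i
    using root[OF that] degf by (simp add: poly_altdef)
  have gf: "[:- of_real (s i), 1:] * g i = f" if i: "i < m" for i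
  proof (rule poly_eqI)
    fix b
    let ?z = "complex_of_real (s i)"
    have c: "coeff ([:- ?z, 1:] * g i) b = (if b = 0 then 0 else coeff (g i) (b - 1)) - ?z * coeff (g i) b"
      by (cases b) (auto simp: coeff_pCons)
    consider "b < m" | "b = m" | "b > m" by linarith
    then show "coeff ([:- ?z, 1:] * g i) b = coeff f b"
    proof cases
      case 1
      then show ?thesis using horner_step[OF 1, of ?z "coeff f"] froot[OF i] m
        unfolding c cg by (auto simp: algebra_simps split: if_splits)
    next
      case 2
      then have "{b - 1<..m} = {m}" using m by auto
      then show ?thesis using 2 m unfolding c cg by simp
    next
      case 3
      then show ?thesis using degf unfolding c cg by (simp add: coeff_eq_0)
    qed
  qed
  have gprod: "g i = (\<Prod>j\<in>{..<m} - {i}. [:- of_real (s j), 1:])" if i: "i < m" for i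
  proof -
    have "f = [:- of_real (s i), 1:] * (\<Prod>j\<in>{..<m} - {i}. [:- of_real (s j), 1:])"
      unfolding fs using i by (intro prod.remove) auto
    then have "[:- of_real (s i), 1:] * g i = [:- of_real (s i), 1:] * (\<Prod>j\<in>{..<m} - {i}. [:- complex_of_real (s j), 1:])"
      using gf[OF i] by simp
    then show ?thesis by (simp del: mult_pCons_left)
  qed
  \<comment> \<open>Lagrange interpolation: both sides have degree below m and agree at all
    \<open>s k\<close>, where only the summand i = k survives.\<close>
  have "q = (\<Sum>i<m. smult (of_real (\<omega> i)) (g i))" (is "q = ?r")
  proof (rule monic_eqI[OF _ _ _ injc])
    show "degree q \<le> m" using dq by simp
    have cr: "coeff ?r b = 0" if "b \<ge> m" for b using that by (simp add: coeff_sum cg)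
    then show "degree ?r \<le> m" by (intro degree_le) auto
    show "coeff q m = coeff ?r m" using cr[of m] dq m by (simp add: coeff_eq_0)
    fix k assume k: "k < m"
    let ?z = "complex_of_real (s k)"
    have "poly (g i) ?z = (if i = k then of_real (\<Prod>j\<in>{..<m} - {k}. s k - s j) else 0)" if "i < m" for i
      using gprod[OF that] k by (auto simp: poly_prod)
    then have "poly ?r ?z = (\<Sum>i<m. if i = k then of_real (\<omega> k * (\<Prod>j\<in>{..<m} - {k}. s k - s j)) else 0)"
      unfolding poly_sum by (intro sum.cong) auto
    also have "\<dots> = of_real (\<omega> k * (\<Prod>j\<in>{..<m} - {k}. s k - s j))" using k by simp
    also have "\<omega> k * (\<Prod>j\<in>{..<m} - {k}. s k - s j) = (\<Prod>j<m - 1. s k - t j)"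
      unfolding \<omega>_def using inj k by (auto simp: inj_on_def)
    also have "of_real \<dots> = poly q ?z" unfolding qt by (simp add: poly_prod)
    finally show "poly q ?z = poly ?r ?z" by simp
  qed
  then have "coeff q b = (\<Sum>i<m. of_real (\<omega> i) * coeff (g i) b)" for b by (simp add: coeff_sum)
  then show ?thesis unfolding interlaced_def using inj wpos froot cg
    by (intro exI[of _ s] exI[of _ \<omega>]) auto
qed

section \<open>Evaluation of polynomials in several variables\<close>

lemma map_poly_pCons_0:
  "h 0 = 0 \<Longrightarrow> map_poly h (pCons c p) = pCons (h c) (map_poly h p)"
  by (rule poly_eqI) (auto simp: coeff_map_poly coeff_pCons split: nat.splits)

lemma poly_map_poly_sum:
  fixes h :: "'a::zero \<Rightarrow> 'b::comm_ring_1"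
  assumes "h 0 = 0"
  shows "poly (map_poly h p) x = (\<Sum>i\<le>degree p. h (coeff p i) * x ^ i)"
proof -
  have "poly (map_poly h p) x = (\<Sum>i\<le>degree (map_poly h p). coeff (map_poly h p) i * x ^ i)"
    by (rule poly_altdef)
  also have "\<dots> = (\<Sum>i\<le>degree p. coeff (map_poly h p) i * x ^ i)"
    using degree_map_poly_le[of h p] by (intro sum.mono_neutral_left) (auto simp: coeff_eq_0)
  finally show ?thesis using assms by (simp add: coeff_map_poly)
qed

lemma eval2_pCons:
  "eval2 (pCons c p) x1 x2 = poly (map_poly of_real c) x2 + x1 * eval2 p x1 x2"
  by (simp add: eval2_def map_poly_pCons_0)

lemma eval3_pCons:
  "eval3 (pCons c R) x0 x1 x2 = eval2 c x1 x2 + x0 * eval3 R x0 x1 x2"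
  by (simp add: eval3_def eval2_def map_poly_pCons_0)

lemma eval2_0 [simp]: "eval2 0 x1 x2 = 0" by (simp add: eval2_def)
lemma eval3_0 [simp]: "eval3 0 x0 x1 x2 = 0" by (simp add: eval3_def)

lemma eval2_sum_form: "eval2 p x1 x2 = (\<Sum>i\<le>degree p. poly (map_poly of_real (coeff p i)) x2 * x1 ^ i)"
  unfolding eval2_def by (subst poly_map_poly_sum) (auto simp: poly_sum)

lemma eval3_sum_form: "eval3 R x0 x1 x2 = (\<Sum>i\<le>degree R. eval2 (coeff R i) x1 x2 * x0 ^ i)"
  unfolding eval3_def eval2_def by (subst poly_map_poly_sum) (auto simp: poly_sum)

lemma eval3_triple_sum:
  "eval3 R x0 x1 x2 = (\<Sum>i\<le>degree R. \<Sum>j\<le>degree (coeff R i). \<Sum>k\<le>degree (coeff (coeff R i) j).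
     of_real (coeff (coeff (coeff R i) j) k) * x0 ^ i * x1 ^ j * x2 ^ k)"
  by (simp add: eval3_sum_form eval2_sum_form poly_map_poly_sum sum_distrib_left sum_distrib_right mult_ac)

lemma poly_of_real_of_real:
  "poly (map_poly of_real c) (of_real x) = (of_real (poly c x) :: 'b::real_field)"
  unfolding poly_altdef[of c] poly_map_poly_sum[where h = of_real, OF of_real_0] by simp

lemma map_poly_of_real_real: "map_poly (of_real :: real \<Rightarrow> real) c = c"
  by (rule poly_eqI) (simp add: coeff_map_poly)

lemma eval2_of_real: "eval2 p (of_real x1) (of_real x2) = of_real (eval2 p x1 x2)"
  by (simp add: eval2_sum_form poly_of_real_of_real map_poly_of_real_real)

lemma eval3_of_real: "eval3 R (of_real x0) (of_real x1) (of_real x2) = of_real (eval3 R x0 x1 x2)"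
  by (simp add: eval3_sum_form eval2_of_real)

lemma of_real_comm_ring_hom: "comm_ring_hom (of_real :: real \<Rightarrow> 'b::real_field)"
  by standard auto

lemma eval2_hom:
  "eval2 (p + q) x1 x2 = eval2 p x1 x2 + eval2 q x1 x2"
  "eval2 (p * q) x1 x2 = eval2 p x1 x2 * eval2 q x1 x2"
proof -
  interpret h0: comm_ring_hom "of_real :: real \<Rightarrow> 'a" by (rule of_real_comm_ring_hom)
  interpret h1: map_poly_comm_ring_hom "of_real :: real \<Rightarrow> 'a" ..
  interpret h2: map_poly_comm_ring_hom "map_poly (of_real :: real \<Rightarrow> 'a)" ..
  show "eval2 (p + q) x1 x2 = eval2 p x1 x2 + eval2 q x1 x2"
    "eval2 (p * q) x1 x2 = eval2 p x1 x2 * eval2 q x1 x2"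
    by (simp_all add: eval2_def h2.hom_add h2.hom_mult)
qed

lemma eval2_1 [simp]: "eval2 1 x1 x2 = 1"
  by (simp add: eval2_def)

lemma eval3_sum: "eval3 (sum f I) x0 x1 x2 = (\<Sum>i\<in>I. eval3 (f i) x0 x1 x2)"
proof -
  interpret h0: comm_ring_hom "of_real :: real \<Rightarrow> 'a" by (rule of_real_comm_ring_hom)
  interpret h1: map_poly_comm_ring_hom "of_real :: real \<Rightarrow> 'a" ..
  interpret h2: map_poly_comm_ring_hom "map_poly (of_real :: real \<Rightarrow> 'a)" ..
  interpret h3: map_poly_comm_ring_hom "map_poly (map_poly (of_real :: real \<Rightarrow> 'a))" ..
  have add: "eval3 (p + q) x0 x1 x2 = eval3 p x0 x1 x2 + eval3 q x0 x1 x2" for p q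
    by (simp add: eval3_def h3.hom_add)
  show ?thesis by (induction I rule: infinite_finite_induct) (auto simp: add)
qed

lemma eval3_monom:
  "eval3 (monom (monom (monom c k) j) i) x0 x1 x2 = of_real c * x0 ^ i * x1 ^ j * x2 ^ k"
  by (simp add: eval3_def map_poly_monom poly_monom)

lemma poly_eq_0_if_roots:
  fixes q :: "'b::{idom, ring_char_0} poly"
  assumes "\<And>t. poly q t = 0"
  shows "q = 0"
  using assms by (metis poly_all_0_iff_0)

lemma eval2_eq_0:
  assumes "\<And>x1 x2 :: real. eval2 p x1 x2 = 0"
  shows "p = 0"
proof (rule poly_eqI)
  fix i
  have "coeff p i = 0"
  proof (rule poly_eq_0_if_roots)
    fix x2 :: real
    have "(\<Sum>i\<le>degree p. monom (poly (coeff p i) x2) i) = 0"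
      using assms[of _ x2]
      by (intro poly_eq_0_if_roots) (simp add: poly_sum poly_monom eval2_sum_form map_poly_of_real_real)
    then have "coeff (\<Sum>i\<le>degree p. monom (poly (coeff p i) x2) i) i = 0" by simp
    then show "poly (coeff p i) x2 = 0"
      by (cases "i \<le> degree p") (auto simp: coeff_sum sum.delta coeff_eq_0)
  qed
  then show "coeff p i = coeff 0 i" by simp
qed

lemma eval3_eq_0:
  assumes "\<And>x0 x1 x2 :: real. eval3 R x0 x1 x2 = 0"
  shows "R = 0"
proof (rule poly_eqI)
  fix i
  have "coeff R i = 0"
  proof (rule eval2_eq_0)
    fix x1 x2 :: real
    have "(\<Sum>i\<le>degree R. monom (eval2 (coeff R i) x1 x2) i) = 0"
      using assms[of _ x1 x2] by (intro poly_eq_0_if_roots) (simp add: poly_sum poly_monom eval3_sum_form)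
    then have "coeff (\<Sum>i\<le>degree R. monom (eval2 (coeff R i) x1 x2) i) i = 0" by simp
    then show "eval2 (coeff R i) x1 x2 = 0"
      by (cases "i \<le> degree R") (auto simp: coeff_sum sum.delta coeff_eq_0)
  qed
  then show "coeff R i = coeff 0 i" by simp
qed

lemma eval2_line:
  fixes c1 d1 c2 d2 :: "'b::real_field"
  shows "\<exists>q. \<forall>t. eval2 p (c1 + t * d1) (c2 + t * d2) = poly q t"
proof (induction p)
  case 0
  show ?case by (rule exI[of _ 0]) simp
next
  case (pCons c p)
  then obtain q where q: "\<And>t. eval2 p (c1 + t * d1) (c2 + t * d2) = poly q t" by blast
  show ?case
    by (rule exI[of _ "pcompose (map_poly of_real c) [:c2, d2:] + [:c1, d1:] * q"])
      (simp add: eval2_pCons q poly_pcompose algebra_simps)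
qed

lemma eval3_line:
  fixes c0 d0 c1 d1 c2 d2 :: "'b::real_field"
  shows "\<exists>q. \<forall>t. eval3 R (c0 + t * d0) (c1 + t * d1) (c2 + t * d2) = poly q t"
proof (induction R)
  case 0
  show ?case by (rule exI[of _ 0]) simp
next
  case (pCons c R)
  then obtain q where q: "\<And>t. eval3 R (c0 + t * d0) (c1 + t * d1) (c2 + t * d2) = poly q t" by blast
  obtain q' where q': "\<And>t. eval2 c (c1 + t * d1) (c2 + t * d2) = poly q' t"
    using eval2_line[of c c1 d1 c2 d2] by blast
  show ?case
    by (rule exI[of _ "q' + [:c0, d0:] * q"]) (simp add: eval3_pCons q q' algebra_simps)
qed

lemma eval2_line_derivative:
  fixes c1 d1 c2 d2 :: complex
  shows "((\<lambda>t. eval2 p (c1 + t * d1) (c2 + t * d2)) has_field_derivative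
    (d1 * eval2 (pderiv p) (c1 + t * d1) (c2 + t * d2) +
     d2 * eval2 (map_poly pderiv p) (c1 + t * d1) (c2 + t * d2))) (at t)"
proof (induction p)
  case 0
  then show ?case by simp
next
  case (pCons c p)
  have "idom_hom (of_real :: real \<Rightarrow> complex)" by standard auto
  note mpd = idom_hom.map_poly_pderiv[OF this]
  have 1: "((\<lambda>t. poly (map_poly of_real c) (c2 + t * d2)) has_field_derivative
      poly (map_poly of_real (pderiv c)) (c2 + t * d2) * d2) (at t)"
    by (auto intro!: derivative_eq_intros DERIV_chain2[OF poly_DERIV] simp: mpd)
  have 2: "((\<lambda>t. c1 + t * d1) has_field_derivative d1) (at t)"
    by (auto intro!: derivative_eq_intros)
  show ?case
    unfolding eval2_pCons
    by (rule DERIV_cong[OF DERIV_add[OF 1 DERIV_mult[OF 2 pCons(2)]]])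
      (simp add: eval2_pCons eval2_hom map_poly_pCons_0 pderiv_pCons algebra_simps)
qed

lemma homogeneous_eval3_scale:
  fixes c x0 x1 x2 :: "'b::real_field"
  assumes "homogeneous d R"
  shows "eval3 R (c * x0) (c * x1) (c * x2) = c ^ d * eval3 R x0 x1 x2"
  unfolding eval3_triple_sum sum_distrib_left
proof (intro sum.cong refl)
  fix i j k
  show "of_real (coeff (coeff (coeff R i) j) k) * (c * x0) ^ i * (c * x1) ^ j * (c * x2) ^ k =
    c ^ d * (of_real (coeff (coeff (coeff R i) j) k) * x0 ^ i * x1 ^ j * x2 ^ k)"
  proof (cases "coeff (coeff (coeff R i) j) k = 0")
    case False
    then have "i + j + k = d" using assms by (auto simp: homogeneous_def)
    then show ?thesis by (auto simp: power_add power_mult_distrib mult_ac)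
  qed simp
qed

lemma total_degree_ge:
  assumes "coeff (coeff p i) j \<noteq> 0"
  shows "i + j \<le> total_degree p"
proof -
  have "finite {i + j | i j. coeff (coeff p i) j \<noteq> 0}"
  proof (rule finite_subset)
    show "{i + j | i j. coeff (coeff p i) j \<noteq> 0} \<subseteq>
      (\<Union>i\<le>degree p. (\<lambda>j. i + j) ` {..degree (coeff p i)})"
    proof
      fix x assume "x \<in> {i + j | i j. coeff (coeff p i) j \<noteq> 0}"
      then obtain i j where x: "x = i + j" "coeff (coeff p i) j \<noteq> 0" by blast
      then have "coeff p i \<noteq> 0" by auto
      then show "x \<in> (\<Union>i\<le>degree p. (\<lambda>j. i + j) ` {..degree (coeff p i)})"
        using x le_degree[of p i] le_degree[of "coeff p i" j] by auto
    qed
  qed auto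
  then show ?thesis unfolding total_degree_def using assms by (intro Max_ge) auto
qed

lemma total_degree_attained:
  assumes "p \<noteq> 0"
  obtains i j where "i + j = total_degree p" "coeff (coeff p i) j \<noteq> 0"
proof -
  let ?S = "{i + j | i j. coeff (coeff p i) j \<noteq> 0}"
  have "finite ?S" using total_degree_ge[of p] by (auto intro: finite_subset[of _ "{..total_degree p}"])
  moreover have "?S \<noteq> {}"
  proof -
    have "coeff (coeff p (degree p)) (degree (coeff p (degree p))) \<noteq> 0" using assms by simp
    then show ?thesis by blast
  qed
  ultimately have "Max ?S \<in> ?S" by (rule Max_in)
  then show thesis using that unfolding total_degree_def by auto
qed

lemma eval3_homogenization:
  "eval3 (homogenization p) x0 x1 x2 = (\<Sum>i\<le>degree p. \<Sum>j\<le>degree (coeff p i).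
     of_real (coeff (coeff p i) j) * x0 ^ (total_degree p - i - j) * x1 ^ i * x2 ^ j)"
  by (simp add: homogenization_def eval3_sum eval3_monom)

lemma eval3_homogenization_nonzero:
  fixes x0 x1 x2 :: "'b::real_field"
  assumes "x0 \<noteq> 0"
  shows "eval3 (homogenization p) x0 x1 x2 = x0 ^ total_degree p * eval2 p (x1 / x0) (x2 / x0)"
  unfolding eval3_homogenization eval2_sum_form sum_distrib_left
proof (intro sum.cong refl)
  fix i
  have "of_real (coeff (coeff p i) j) * x0 ^ (total_degree p - i - j) * x1 ^ i * x2 ^ j =
    x0 ^ total_degree p * (of_real (coeff (coeff p i) j) * (x2 / x0) ^ j * (x1 / x0) ^ i)" for j
  proof (cases "coeff (coeff p i) j = 0")
    case False
    then have "total_degree p = (total_degree p - i - j) + i + j" using total_degree_ge[of p i j] by simp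
    then have "x0 ^ total_degree p = x0 ^ (total_degree p - i - j) * x0 ^ i * x0 ^ j" by (metis power_add)
    then show ?thesis using assms by (simp add: power_divide)
  qed simp
  then show "(\<Sum>j\<le>degree (coeff p i). of_real (coeff (coeff p i) j) * x0 ^ (total_degree p - i - j) * x1 ^ i * x2 ^ j) =
    x0 ^ total_degree p * (poly (map_poly of_real (coeff p i)) (x2 / x0) * (x1 / x0) ^ i)"
    by (simp only: poly_map_poly_sum[where h = of_real, OF of_real_0] sum_distrib_left sum_distrib_right)
qed

lemma homogeneous_homogenization: "homogeneous (total_degree p) (homogenization p)"
  unfolding homogeneous_def
proof (intro allI impI)
  fix i j k assume "coeff (coeff (coeff (homogenization p) i) j) k \<noteq> 0"
  then have "(\<Sum>i'\<le>degree p. \<Sum>j'\<le>degree (coeff p i').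
     coeff (coeff (coeff (monom (monom (monom (coeff (coeff p i') j') j') i') (total_degree p - i' - j')) i) j) k) \<noteq> 0"
    by (simp add: homogenization_def coeff_sum)
  then obtain i' j' where
    *: "coeff (coeff (coeff (monom (monom (monom (coeff (coeff p i') j') j') i') (total_degree p - i' - j')) i) j) k \<noteq> 0"
    by (metis (no_types, lifting) sum.neutral)
  then have "i = total_degree p - i' - j'" "j = i'" "k = j'" "coeff (coeff p i') j' \<noteq> 0"
    by (auto split: if_splits simp: coeff_monom)
  then show "i + j + k = total_degree p" using total_degree_ge[of p i' j'] by simp
qed

section \<open>Restriction to lines\<close>

text \<open>The outer variable is s, the inner one u; this bounds their joint degree.\<close>

definition total_weight :: "nat \<Rightarrow> complex poly poly \<Rightarrow> bool" where
  "total_weight d P \<longleftrightarrow> (\<forall>j. deg_le (coeff P j) (int d - int j))"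

lemma total_weight_mult: "total_weight a P \<Longrightarrow> total_weight b Q \<Longrightarrow> total_weight (a + b) (P * Q)"
  unfolding total_weight_def coeff_mult
proof (intro allI deg_le_sum)
  fix j i :: nat assume P: "\<forall>j. deg_le (coeff P j) (int a - int j)" and Q: "\<forall>j. deg_le (coeff Q j) (int b - int j)"
    and "i \<in> {..j}"
  then have "deg_le (coeff P i * coeff Q (j - i)) ((int a - int i) + (int b - int (j - i)))"
    using deg_le_mult[OF P[rule_format, of i] Q[rule_format, of "j - i"]] by blast
  then show "deg_le (coeff P i * coeff Q (j - i)) (int (a + b) - int j)"
    using \<open>i \<in> {..j}\<close> by (simp add: of_nat_diff algebra_simps)
qed

lemma total_weight_power: "total_weight 1 P \<Longrightarrow> total_weight n (P ^ n)"
proof (induction n)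
  case 0
  then show ?case by (auto simp: total_weight_def deg_le_degree coeff_1)
next
  case (Suc n)
  then show ?case using total_weight_mult[of 1 P n "P ^ n"] by simp
qed

lemma total_weight_sum: "(\<And>i. i \<in> I \<Longrightarrow> total_weight d (f i)) \<Longrightarrow> total_weight d (sum f I)"
  by (auto simp: total_weight_def coeff_sum intro!: deg_le_sum)

text \<open>\<open>F j\<close> is the coefficient of s^j in \<open>R\<close> along the lines. All
  three coordinates substituted have joint degree at most one in s and u, hence the degree bounds.
  The last two claims are limits made exact by homogeneity: u to \<infinity> gives the top
  coefficients, s to \<infinity> the leading one.\<close>

lemma line_restriction:
  fixes a1 a2 \<beta> :: complex
  assumes "homogeneous d R"
  obtains F :: "nat \<Rightarrow> complex poly" where
    "\<And>j. j \<le> d \<Longrightarrow> deg_le (F j) (int d - int j)"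
    "\<And>s u. (\<Sum>j\<le>d. poly (F j) u * s ^ j) = eval3 R s (u + s * a1) (1 + u * \<beta> + s * a2)"
    "\<And>s. (\<Sum>j\<le>d. coeff (F j) (d - j) * s ^ j) = eval3 R s (1 + s * a1) (\<beta> + s * a2)"
    "F d = [:eval3 R 1 a1 a2:]"
proof -
  let ?t = "\<lambda>i j k. [:[:complex_of_real (coeff (coeff (coeff R i) j) k):]:] * [:0, 1:] ^ i *
      [:[:0, 1:], [:a1:]:] ^ j * [:[:1, \<beta>:], [:a2:]:] ^ k"
  define P where "P = (\<Sum>i\<le>degree R. \<Sum>j\<le>degree (coeff R i). \<Sum>k\<le>degree (coeff (coeff R i) j). ?t i j k)"
  have w: "total_weight 1 [:0, 1:]" "total_weight 1 [:[:0, 1:], [:a1:]:]" "total_weight 1 [:[:1, \<beta>:], [:a2:]:]"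
    by (auto simp: total_weight_def deg_le_degree coeff_pCons split: nat.splits)
  have "total_weight d (?t i j k)" for i j k
  proof (cases "coeff (coeff (coeff R i) j) k = 0")
    case True
    then show ?thesis by (simp add: total_weight_def)
  next
    case False
    then have d: "d = 0 + i + j + k" using assms by (auto simp: homogeneous_def)
    have "total_weight 0 [:[:complex_of_real (coeff (coeff (coeff R i) j) k):]:]"
      by (auto simp: total_weight_def deg_le_degree coeff_pCons split: nat.splits)
    then show ?thesis unfolding d by (intro total_weight_mult total_weight_power w)
  qed
  then have wP: "total_weight d P" unfolding P_def by (intro total_weight_sum)
  define F where "F = coeff P"
  have dF: "deg_le (F j) (int d - int j)" for j using wP by (simp add: total_weight_def F_def)
  have "F j = 0" if "j > d" for j
    using dF[of j] that by (auto simp: deg_le_degree)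
  then have degP: "degree P \<le> d" by (auto simp: F_def intro: degree_le)
  have ev: "(\<Sum>j\<le>d. poly (F j) u * s ^ j) = eval3 R s (u + s * a1) (1 + u * \<beta> + s * a2)" for s u
  proof -
    have "poly P [:s:] = (\<Sum>j\<le>degree P. coeff P j * [:s:] ^ j)" by (rule poly_altdef)
    also have "\<dots> = (\<Sum>j\<le>d. F j * [:s:] ^ j)"
      using degP by (intro sum.mono_neutral_cong_left) (auto simp: coeff_eq_0 F_def)
    finally have "poly (poly P [:s:]) u = (\<Sum>j\<le>d. poly (F j) u * s ^ j)"
      by (simp add: poly_sum)
    moreover have "poly (poly P [:s:]) u = eval3 R s (u + s * a1) (1 + u * \<beta> + s * a2)"
      unfolding P_def eval3_triple_sum by (simp add: poly_sum mult_ac add_ac)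
    ultimately show ?thesis by simp
  qed
  have top: "(\<Sum>j\<le>d. coeff (F j) (d - j) * s ^ j) = eval3 R s (1 + s * a1) (\<beta> + s * a2)" for s
  proof -
    \<comment> \<open>The restriction at parameters s / w and 1 / w, multiplied by w^d. It is a
      polynomial in w, also after homogeneity has moved w^d into the arguments of \<open>R\<close>;
      comparing the two at w = 0 gives the claim.\<close>
    define B where "B = (\<Sum>j\<le>d. smult (s ^ j) (\<Sum>n\<le>d - j. monom (coeff (F j) n) (d - j - n)))"
    obtain q where q: "\<And>w. eval3 R (s + w * 0) (1 + s * a1 + w * 0) (\<beta> + s * a2 + w * 1) = poly q w"
      using eval3_line[of R s 0 "1 + s * a1" 0 "\<beta> + s * a2" 1] by blast
    have "B = q"
    proof (rule poly_eqI_cofinite, rule eventually_mono[OF cofinite_neq[of 0]])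
      fix u assume "complex_of_real u \<noteq> 0"
      define w where "w = complex_of_real u"
      have w0: "w \<noteq> 0" using \<open>complex_of_real u \<noteq> 0\<close> by (simp add: w_def)
      have wd: "w ^ d = w ^ j * w ^ (d - j)" if "j \<le> d" for j using that by (simp flip: power_add)
      have pF: "poly (F j) (1 / w) * w ^ (d - j) = (\<Sum>n\<le>d - j. coeff (F j) n * w ^ (d - j - n))" if "j \<le> d" for j
      proof -
        have "poly (F j) (1 / w) = (\<Sum>n\<le>d - j. coeff (F j) n * (1 / w) ^ n)"
          unfolding poly_altdef using dF[of j] that
          by (intro sum.mono_neutral_left) (auto simp: coeff_eq_0 deg_le_degree)
        moreover have "(1 / w) ^ n * w ^ (d - j) = w ^ (d - j - n)" if "n \<le> d - j" for n
        proof -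
          have "w ^ (d - j) = w ^ n * w ^ (d - j - n)"
            by (simp only: power_add[symmetric] le_add_diff_inverse that)
          then show ?thesis using w0 by (simp add: power_one_over)
        qed
        ultimately show ?thesis by (simp add: sum_distrib_right mult.assoc)
      qed
      have "poly B w = (\<Sum>j\<le>d. s ^ j * (poly (F j) (1 / w) * w ^ (d - j)))"
        unfolding B_def using pF by (simp add: poly_sum poly_monom)
      also have "\<dots> = (\<Sum>j\<le>d. w ^ d * (poly (F j) (1 / w) * (s / w) ^ j))"
        using w0 wd by (intro sum.cong) (auto simp: power_divide)
      also have "\<dots> = w ^ d * eval3 R (s / w) (1 / w + (s / w) * a1) (1 + (1 / w) * \<beta> + (s / w) * a2)"
        unfolding sum_distrib_left[symmetric] ev ..
      also have "\<dots> = eval3 R (w * (s / w)) (w * (1 / w + (s / w) * a1)) (w * (1 + (1 / w) * \<beta> + (s / w) * a2))"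
        by (rule homogeneous_eval3_scale[OF assms, symmetric])
      also have "w * (s / w) = s" using w0 by simp
      also have "w * (1 / w + (s / w) * a1) = 1 + s * a1" using w0 by (simp add: field_simps)
      also have "w * (1 + (1 / w) * \<beta> + (s / w) * a2) = \<beta> + s * a2 + w * 1" using w0 by (simp add: field_simps)
      also have "eval3 R s (1 + s * a1) (\<beta> + s * a2 + w * 1) = poly q w" using q[of w] by simp
      finally show "poly B (of_real u) = poly q (of_real u)" unfolding w_def .
    qed
    then have "poly B 0 = eval3 R s (1 + s * a1) (\<beta> + s * a2)" using q[of 0] by simp
    moreover have "poly (\<Sum>n\<le>d - j. monom (coeff (F j) n) (d - j - n)) 0 = coeff (F j) (d - j)" for j
    proof -
      have "poly (\<Sum>n\<le>d - j. monom (coeff (F j) n) (d - j - n)) 0 = (\<Sum>n\<le>d - j. if n = d - j then coeff (F j) n else 0)"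
        unfolding poly_sum by (intro sum.cong) (auto simp: poly_monom)
      then show ?thesis by simp
    qed
    then have "poly B 0 = (\<Sum>j\<le>d. coeff (F j) (d - j) * s ^ j)"
      unfolding B_def by (simp add: poly_sum[of _ "{..d}"] mult.commute)
    ultimately show ?thesis by simp
  qed
  have lead: "F d = [:eval3 R 1 a1 a2:]"
  proof -
    have "poly (F d) u = eval3 R 1 a1 a2" for u
    proof -
      \<comment> \<open>The same device with u fixed and s = 1 / w: at w = 0 only the coefficient of
        s^d remains.\<close>
      define B where "B = (\<Sum>j\<le>d. monom (poly (F j) u) (d - j))"
      obtain q where q: "\<And>w. eval3 R (1 + w * 0) (a1 + w * u) (a2 + w * (1 + u * \<beta>)) = poly q w"
        using eval3_line[of R 1 0 a1 u a2 "1 + u * \<beta>"] by blast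
      have "B = q"
      proof (rule poly_eqI_cofinite, rule eventually_mono[OF cofinite_neq[of 0]])
        fix x assume "complex_of_real x \<noteq> 0"
        define w where "w = complex_of_real x"
        have w0: "w \<noteq> 0" using \<open>complex_of_real x \<noteq> 0\<close> by (simp add: w_def)
        have wd: "w ^ d = w ^ j * w ^ (d - j)" if "j \<le> d" for j using that by (simp flip: power_add)
        have "poly B w = (\<Sum>j\<le>d. w ^ d * (poly (F j) u * (1 / w) ^ j))"
          unfolding B_def poly_sum using w0 wd by (intro sum.cong) (auto simp: poly_monom power_one_over)
        also have "\<dots> = w ^ d * eval3 R (1 / w) (u + (1 / w) * a1) (1 + u * \<beta> + (1 / w) * a2)"
          unfolding sum_distrib_left[symmetric] ev ..
        also have "\<dots> = eval3 R (w * (1 / w)) (w * (u + (1 / w) * a1)) (w * (1 + u * \<beta> + (1 / w) * a2))"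
          by (rule homogeneous_eval3_scale[OF assms, symmetric])
        also have "\<dots> = eval3 R (1 + w * 0) (a1 + w * u) (a2 + w * (1 + u * \<beta>))"
          using w0 by (simp add: distrib_left add_ac)
        also have "\<dots> = poly q w" by (rule q)
        finally show "poly B (of_real x) = poly q (of_real x)" unfolding w_def .
      qed
      then have "poly B 0 = eval3 R 1 a1 a2" using q[of 0] by simp
      moreover have "poly B 0 = (\<Sum>j\<le>d. if j = d then poly (F j) u else 0)"
        unfolding B_def poly_sum by (intro sum.cong) (auto simp: poly_monom)
      ultimately show ?thesis by simp
    qed
    then have "poly (F d - [:eval3 R 1 a1 a2:]) u = 0" for u by simp
    then have "F d - [:eval3 R 1 a1 a2:] = 0" by (rule poly_eq_0_if_roots)
    then show ?thesis by simp
  qed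
  show thesis by (rule that[OF dF ev top lead])
qed

text \<open>Elimination of x1: \<open>c\<close> is a polynomial in x2 alone, so common zeros of
  \<open>p\<close> and \<open>r\<close> have only finitely many values of x2. A combination
  \<open>d\<close> of least degree in x1 divides \<open>p\<close> and \<open>r\<close> up to factors
  in x2; if it had positive degree, primality of \<open>p\<close> would be violated.\<close>

lemma irreducible_bezout:
  fixes p r :: "real poly poly"
  assumes p: "irreducible p" and r: "\<not> p dvd r"
  obtains u w c where "c \<noteq> 0" "u * p + w * r = [:c:]"
proof (cases "degree p = 0")
  case True
  then obtain c where c: "p = [:c:]" by (rule degree_eq_zeroE)
  then have "c \<noteq> 0" using p by (metis irreducible_def pCons_0_0)
  then show thesis using that[of c 1 0] c by simp
next
  case dp: False
  have p0: "p \<noteq> 0" using p by (simp add: irreducible_def)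
  have pr: "prime_elem p" using p by (rule irreducible_imp_prime_elem_gcd)
  define J where "J = {d. d \<noteq> 0 \<and> (\<exists>u w. d = u * p + w * r)}"
  have "p = 1 * p + 0 * r" by simp
  then have "p \<in> J" unfolding J_def using p0 by blast
  then obtain d where d: "d \<in> J" "\<And>e. e \<in> J \<Longrightarrow> degree d \<le> degree e"
    using ex_has_least_nat[of "\<lambda>d. d \<in> J" p degree] by blast
  then have d0: "d \<noteq> 0" by (simp add: J_def)
  obtain u w where uw: "d = u * p + w * r" using d(1) by (auto simp: J_def)
  \<comment> \<open>The coefficients lie in a ring, so division by \<open>d\<close> needs a power of
    its leading coefficient, \<open>l\<close>; minimality of the degree kills the
    pseudo-remainder.\<close>
  have div: "\<exists>l q. l \<noteq> 0 \<and> [:l:] * x = d * q" if x: "x = a * p + b * r" for x a b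
  proof -
    obtain q e where qe: "pseudo_divmod x d = (q, e)" by fastforce
    define l where "l = coeff d (degree d) ^ (Suc (degree x) - degree d)"
    have 1: "smult l x = d * q + e" "e = 0 \<or> degree e < degree d"
      using pseudo_divmod[OF d0 qe] by (auto simp: l_def)
    have "e = smult l x - d * q" using 1 by simp
    also have "\<dots> = ([:l:] * a - u * q) * p + ([:l:] * b - w * q) * r"
      unfolding x uw by (simp add: algebra_simps smult_add_right)
    finally have "e = 0" using 1(2) d(2)[of e] unfolding J_def by fastforce
    moreover have "l \<noteq> 0" using d0 by (simp add: l_def)
    ultimately show ?thesis using 1 by (intro exI[of _ l] exI[of _ q]) simp
  qed
  show thesis
  proof (cases "degree d = 0")
    case True
    then obtain c where "d = [:c:]" by (rule degree_eq_zeroE)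
    then show thesis using that[of c u w] uw d0 by auto
  next
    case False
    obtain l q where lq: "l \<noteq> 0" "[:l:] * p = d * q" using div[of p 1 0] by auto
    obtain l' q' where lq': "l' \<noteq> 0" "[:l':] * r = d * q'" using div[of r 0 1] by auto
    have "p dvd [:l:] * p" by (rule dvd_triv_right)
    then have "p dvd d * q" by (simp only: lq(2))
    then consider "p dvd d" | "p dvd q" using pr prime_elem_dvd_mult_iff by blast
    then have False
    proof cases
      case 1
      then have "p dvd d * q'" by (rule dvd_mult2)
      then have "p dvd [:l':] * r" by (simp only: lq'(2))
      then have "p dvd [:l':]" using pr r prime_elem_dvd_mult_iff by blast
      then obtain k where k: "[:l':] = p * k" by (rule dvdE)
      then have "k \<noteq> 0" using lq'(1) by auto
      then have "degree (p * k) = degree p + degree k" using p0 by (simp add: degree_mult_eq)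
      then show False using k dp by (metis add_is_0 degree_pCons_0)
    next
      case 2
      then obtain k where k: "q = p * k" by (rule dvdE)
      have "p * [:l:] = p * (d * k)" using lq(2) k by (simp only: mult_ac)
      then have "[:l:] = d * k" using p0 by (metis mult_left_cancel)
      moreover from this have "k \<noteq> 0" using lq(1) by auto
      then have "degree (d * k) = degree d + degree k" using d0 by (simp add: degree_mult_eq)
      ultimately show False using False by (metis add_is_0 degree_pCons_0)
    qed
    then show thesis ..
  qed
qed

section \<open>Generic directions\<close>

text \<open>For z \<noteq> 0, scaling by 1 / z turns the point into (1, a1 + t y1, a2 + t y2) with t
  = 1 / z, where the real zero property applies; z = 0 is real anyway.\<close>

lemma real_zeros_on_lines:
  fixes y1 y2 :: real and z :: complex
  assumes "real_zero_poly a1 a2 p"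
    and "eval3 (homogenization p) z (of_real y1 + z * of_real a1) (of_real y2 + z * of_real a2) = 0"
  shows "z \<in> \<real>"
proof (cases "z = 0")
  case False
  have "(of_real y1 + z * of_real a1) / z = of_real a1 + (1 / z) * complex_of_real y1"
    "(of_real y2 + z * of_real a2) / z = of_real a2 + (1 / z) * complex_of_real y2"
    using False by (simp_all add: add_divide_distrib)
  then have "eval2 p (of_real a1 + (1 / z) * complex_of_real y1) (of_real a2 + (1 / z) * complex_of_real y2) = 0"
    using assms(2) False by (simp add: eval3_homogenization_nonzero)
  then have "1 / z \<in> \<real>" using assms(1) unfolding real_zero_poly_def by blast
  from Reals_divide[OF Reals_1 this] show ?thesis by simp
qed simp

text \<open>Where \<open>t \<mapsto> p (a + t y)\<close> has a multiple zero \<open>t \<noteq> 0\<close>, both \<open>p\<close> and its radial derivative vanish.\<close>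

definition radial_deriv :: "real \<Rightarrow> real \<Rightarrow> real poly poly \<Rightarrow> real poly poly" where
  "radial_deriv a1 a2 p = [:[:-a1:], 1:] * pderiv p + [:[:-a2, 1:]:] * map_poly pderiv p"

lemma eval2_linear:
  "eval2 [:[:c:], 1:] x1 x2 = x1 + of_real c" "eval2 [:[:c, 1:]:] x1 x2 = x2 + of_real c"
  by (simp_all add: eval2_pCons map_poly_pCons_0 one_pCons)

lemma eval2_radial_deriv:
  "eval2 (radial_deriv a1 a2 p) x1 x2 =
    (x1 - of_real a1) * eval2 (pderiv p) x1 x2 + (x2 - of_real a2) * eval2 (map_poly pderiv p) x1 x2"
  by (simp only: radial_deriv_def eval2_hom eval2_linear) simp

lemma eval2_radial_deriv_line:
  fixes y1 y2 t :: complex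
  assumes "\<And>t. eval2 p (of_real a1 + t * y1) (of_real a2 + t * y2) = poly q t"
  shows "eval2 (radial_deriv a1 a2 p) (of_real a1 + t * y1) (of_real a2 + t * y2) = t * poly (pderiv q) t"
proof -
  have "(poly q has_field_derivative
    y1 * eval2 (pderiv p) (of_real a1 + t * y1) (of_real a2 + t * y2) +
    y2 * eval2 (map_poly pderiv p) (of_real a1 + t * y1) (of_real a2 + t * y2)) (at t)"
    using eval2_line_derivative[of p "of_real a1" y1 "of_real a2" y2 t] unfolding assms .
  note D = DERIV_unique[OF this poly_DERIV]
  have "eval2 (radial_deriv a1 a2 p) (of_real a1 + t * y1) (of_real a2 + t * y2) =
    t * (y1 * eval2 (pderiv p) (of_real a1 + t * y1) (of_real a2 + t * y2) +
    y2 * eval2 (map_poly pderiv p) (of_real a1 + t * y1) (of_real a2 + t * y2))"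
    unfolding eval2_radial_deriv by (simp add: algebra_simps)
  then show ?thesis by (simp only: D)
qed

text \<open>Otherwise, on each line through a, the restriction q of \<open>p\<close> satisfies t q'
  = q h. If q' were nonzero, comparing degrees would make h constant, and t = 0 with q(0) = 1 would
  make it zero. So q is constant on all lines, and \<open>p\<close> would be the unit 1.\<close>

lemma radial_deriv_not_dvd:
  assumes p: "irreducible p" and pa: "eval2 p a1 a2 = (1 :: real)"
  shows "\<not> p dvd radial_deriv a1 a2 p"
proof
  assume "p dvd radial_deriv a1 a2 p"
  then obtain g where g: "radial_deriv a1 a2 p = p * g" by (rule dvdE)
  have one: "eval2 p (of_real a1 + y1) (of_real a2 + y2) = 1" for y1 y2 :: complex
  proof -
    obtain q where q: "\<And>t. eval2 p (of_real a1 + t * y1) (of_real a2 + t * y2) = poly q t"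
      using eval2_line[of p "of_real a1" y1 "of_real a2" y2] by blast
    obtain h where h: "\<And>t. eval2 g (of_real a1 + t * y1) (of_real a2 + t * y2) = poly h t"
      using eval2_line[of g "of_real a1" y1 "of_real a2" y2] by blast
    have "poly ([:0, 1:] * pderiv q - q * h) t = 0" for t
      using eval2_radial_deriv_line[OF q, of t] by (simp add: g eval2_hom q h)
    then have qh: "[:0, 1:] * pderiv q = q * h" using poly_eq_0_if_roots[of "[:0, 1:] * pderiv q - q * h"] by simp
    have q0: "poly q 0 = 1" using q[of 0] pa by (simp add: eval2_of_real)
    have "pderiv q = 0"
    proof (rule ccontr)
      assume nz: "pderiv q \<noteq> 0"
      then have dq: "degree q \<noteq> 0" by (simp add: pderiv_eq_0_iff)
      have e1: "degree ([:0, 1:] * pderiv q) = degree q"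
        using nz dq by (subst degree_mult_eq) (auto simp: degree_pderiv)
      have h0: "h \<noteq> 0" using qh nz by (metis mult_eq_0_iff mult_zero_right one_neq_zero pCons_eq_0_iff)
      have "q \<noteq> 0" using q0 by auto
      then have "degree (q * h) = degree q + degree h" using h0 by (rule degree_mult_eq)
      then have "degree h = 0" using e1 unfolding qh by simp
      then obtain c where c: "h = [:c:]" by (rule degree_eq_zeroE)
      have "poly ([:0, 1:] * pderiv q) 0 = poly (q * h) 0" by (simp only: qh)
      then have "c = 0" using q0 c by simp
      then show False using h0 c by simp
    qed
    then have "degree q = 0" by (simp add: pderiv_eq_0_iff)
    then obtain c where "q = [:c:]" by (rule degree_eq_zeroE)
    then have "poly q 1 = 1" using q0 by simp
    then show ?thesis using q[of 1] by simp
  qed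
  have "eval2 (p - 1) x1 x2 = 0" for x1 x2 :: real
  proof -
    have "complex_of_real (eval2 p x1 x2) = eval2 p (of_real x1) (of_real x2)" by (simp add: eval2_of_real)
    also have "\<dots> = 1" using one[of "of_real (x1 - a1)" "of_real (x2 - a2)"] by simp
    finally have "eval2 p x1 x2 = 1" by simp
    moreover have "eval2 ((p - 1) + 1) x1 x2 = eval2 (p - 1) x1 x2 + 1" by (simp only: eval2_hom eval2_1)
    ultimately show ?thesis by simp
  qed
  then have "p - 1 = 0" by (rule eval2_eq_0)
  then show False using p by simp
qed

text \<open>The zeros of \<open>N\<close> are the directions of the points at infinity, where the
  restriction to the line would vanish at s = 0. There is no cancellation in \<open>N\<close>, since
  in top degree i is determined by j.\<close>

lemma leading_form_nonzero:
  assumes "p \<noteq> 0"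
  obtains N :: "real poly" where "N \<noteq> 0" "\<And>\<gamma>. eval3 (homogenization p) 0 1 \<gamma> = poly N \<gamma>"
proof -
  let ?m = "total_degree p"
  define N where "N = (\<Sum>i\<le>degree p. \<Sum>j\<le>degree (coeff p i). if i + j = ?m then monom (coeff (coeff p i) j) j else 0)"
  have "eval3 (homogenization p) 0 1 \<gamma> = poly N \<gamma>" for \<gamma>
  proof -
    have "coeff (coeff p i) j * 0 ^ (?m - i - j) * 1 ^ i * \<gamma> ^ j =
      poly (if i + j = ?m then monom (coeff (coeff p i) j) j else 0) \<gamma>" for i j
      using total_degree_ge[of p i j] by (cases "coeff (coeff p i) j = 0") (auto simp: poly_monom)
    then show ?thesis unfolding eval3_homogenization N_def poly_sum by simp
  qed
  moreover have "N \<noteq> 0"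
  proof -
    obtain i0 j0 where ij: "i0 + j0 = ?m" "coeff (coeff p i0) j0 \<noteq> 0" by (rule total_degree_attained[OF assms])
    have "coeff N j0 = (\<Sum>i\<le>degree p. \<Sum>j\<le>degree (coeff p i). if j = j0 then if i = i0 then coeff (coeff p i) j0 else 0 else 0)"
      unfolding N_def coeff_sum using ij(1) by (intro sum.cong) auto
    also have "\<dots> = (\<Sum>i\<le>degree p. if i = i0 then coeff (coeff p i0) j0 else 0)"
      by (intro sum.cong) (auto simp: le_degree coeff_eq_0)
    also have "\<dots> = coeff (coeff p i0) j0" using ij(2) by (auto simp: le_degree coeff_eq_0)
    finally show ?thesis using ij(2) by auto
  qed
  ultimately show thesis using that by blast
qed

abbreviation line_eval ::
    "real poly poly poly \<Rightarrow> real \<Rightarrow> real \<Rightarrow> real \<Rightarrow> real \<Rightarrow> complex \<Rightarrow> complex" where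
  "line_eval R a1 a2 y1 y2 s \<equiv> eval3 R s (of_real y1 + s * of_real a1) (of_real y2 + s * of_real a2)"

text \<open>A multiple zero at s \<noteq> 0 yields an affine point (\<rho>, \<zeta>) where
  \<open>p\<close> and its radial derivative vanish, and each such point spoils a single slope.
  Elimination leaves finitely many \<zeta>, each with finitely many \<rho>, unless \<open>p\<close>
  vanishes on the whole line x2 = \<zeta>. A zero at s = 0 is excluded by the leading form.\<close>

lemma simple_zeros_generic:
  assumes p: "irreducible p" and rz: "real_zero_poly a1 a2 p" and pa: "eval2 p a1 a2 = (1 :: real)"
  obtains Bad :: "real set" where "finite Bad"
    "\<And>(y1 :: real) (y2 :: real) f z. y1 \<noteq> 0 \<Longrightarrow> y2 / y1 \<notin> Bad \<Longrightarrow>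
      (\<And>s. poly f s = line_eval (homogenization p) a1 a2 y1 y2 s) \<Longrightarrow>
      poly f z = 0 \<Longrightarrow> poly (pderiv f) z \<noteq> 0"
proof -
  let ?P = "homogenization p" and ?m = "total_degree p"
  have p0: "p \<noteq> 0" using p by (simp add: irreducible_def)
  obtain N :: "real poly" where N: "N \<noteq> 0" "\<And>\<gamma>. eval3 ?P 0 1 \<gamma> = poly N \<gamma>"
    by (rule leading_form_nonzero[OF p0]) blast
  obtain u w c where c: "c \<noteq> 0" "u * p + w * radial_deriv a1 a2 p = [:c:]"
    by (rule irreducible_bezout[OF p radial_deriv_not_dvd[OF p pa]])
  have "\<exists>q. \<forall>x :: real. eval2 p x \<zeta> = poly q x" for \<zeta>
    using eval2_line[of p 0 1 \<zeta> 0] by simp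
  then obtain pz where pz: "\<And>\<zeta> x :: real. eval2 p x \<zeta> = poly (pz \<zeta>) x" by metis
  define Bad where "Bad = {\<gamma>. poly N \<gamma> = 0} \<union>
    (\<Union>\<zeta>\<in>{\<zeta>. poly c \<zeta> = 0 \<and> pz \<zeta> \<noteq> 0}. (\<lambda>\<rho>. (\<zeta> - a2) / (\<rho> - a1)) ` {\<rho>. poly (pz \<zeta>) \<rho> = 0})"
  have "finite {\<zeta>. poly c \<zeta> = 0 \<and> pz \<zeta> \<noteq> 0}"
    using poly_roots_finite[OF c(1)] by (rule rev_finite_subset) auto
  then have "finite Bad" unfolding Bad_def using poly_roots_finite N(1) by auto
  moreover have "poly (pderiv f) z \<noteq> 0"
    if y1: "y1 \<noteq> 0" and nb: "y2 / y1 \<notin> Bad"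
      and f: "\<And>s. poly f s = line_eval ?P a1 a2 y1 y2 s"
      and fz: "poly f z = 0" for y1 y2 :: real and f z
  proof
    assume dfz: "poly (pderiv f) z = 0"
    have "z \<in> \<real>" using real_zeros_on_lines[OF rz] f fz by metis
    then obtain \<sigma> where z: "z = of_real \<sigma>" by (auto elim: Reals_cases)
    show False
    proof (cases "\<sigma> = 0")
      case True
      then have "eval3 ?P (of_real 0) (complex_of_real y1) (of_real y2) = 0" using f[of z] fz z by simp
      then have "eval3 ?P 0 y1 y2 = 0" by (simp only: eval3_of_real of_real_eq_0_iff)
      moreover have "eval3 ?P (y1 * 0) (y1 * 1) (y1 * (y2 / y1)) = y1 ^ ?m * eval3 ?P 0 1 (y2 / y1)"
        by (rule homogeneous_eval3_scale[OF homogeneous_homogenization])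
      ultimately have "poly N (y2 / y1) = 0" using y1 N(2) by simp
      then show False using nb by (simp add: Bad_def)
    next
      case False
      define t where "t = 1 / \<sigma>"
      have t0: "t \<noteq> 0" using False by (simp add: t_def)
      define \<rho> where "\<rho> = a1 + t * y1"
      define \<zeta> where "\<zeta> = a2 + t * y2"
      obtain q where q: "\<And>t. eval2 p (of_real a1 + t * of_real y1) (of_real a2 + t * complex_of_real y2) = poly q t"
        using eval2_line[of p "of_real a1" "of_real y1" "of_real a2" "complex_of_real y2"] by blast
      \<comment> \<open>\<open>q\<close> is the reversed polynomial of \<open>f\<close>, so a
        multiple zero of \<open>f\<close> at z becomes one of \<open>q\<close> at 1 / z, where the
        radial derivative can be used.\<close>
      have qf: "x ^ ?m * poly f (1 / x) = poly q x" if "x \<noteq> 0" for x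
      proof -
        have "x ^ ?m * poly f (1 / x) = x ^ ?m * ((1 / x) ^ ?m *
            eval2 p ((of_real y1 + (1 / x) * of_real a1) / (1 / x)) ((of_real y2 + (1 / x) * of_real a2) / (1 / x)))"
          unfolding f using that by (simp add: eval3_homogenization_nonzero)
        also have "\<dots> = eval2 p (of_real a1 + x * of_real y1) (of_real a2 + x * of_real y2)"
          using that by (simp add: power_one_over distrib_left distrib_right add.commute mult.commute)
        finally show ?thesis unfolding q .
      qed
      have zt: "z = 1 / of_real t" using z by (simp add: t_def)
      have "((\<lambda>x. x ^ ?m * poly f (1 / x)) has_field_derivative 0) (at (complex_of_real t))"
        using t0 fz dfz unfolding zt
        by (auto intro!: derivative_eq_intros DERIV_chain2[OF poly_DERIV])
      then have "(poly q has_field_derivative 0) (at (complex_of_real t))"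
        by (rule has_field_derivative_transform_within_open[where S = "- {0}"]) (use t0 qf in auto)
      then have dq: "poly (pderiv q) (of_real t) = 0" using DERIV_unique poly_DERIV by blast
      have q0: "poly q (of_real t) = 0" using qf[of "of_real t"] t0 fz zt by simp
      have x: "of_real a1 + complex_of_real t * of_real y1 = of_real \<rho>"
        "of_real a2 + complex_of_real t * of_real y2 = of_real \<zeta>" by (simp_all add: \<rho>_def \<zeta>_def)
      have pr: "eval2 p (of_real \<rho>) (complex_of_real \<zeta>) = 0" using q[of "of_real t"] q0 x by simp
      have "eval2 (radial_deriv a1 a2 p) (of_real \<rho>) (complex_of_real \<zeta>) = 0"
        using eval2_radial_deriv_line[OF q, of "of_real t"] dq x by simp
      then have "eval2 [:c:] (of_real \<rho>) (complex_of_real \<zeta>) = 0"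
        unfolding c(2)[symmetric] using pr by (simp add: eval2_hom)
      then have "poly c \<zeta> = 0" by (simp add: eval2_pCons poly_of_real_of_real)
      have pr': "poly (pz \<zeta>) \<rho> = 0" using pr by (simp add: eval2_of_real pz)
      show False
      proof (cases "pz \<zeta> = 0")
        case False
        have "(\<zeta> - a2) / (\<rho> - a1) = y2 / y1" using t0 by (simp add: \<zeta>_def \<rho>_def)
        then have "y2 / y1 \<in> Bad" unfolding Bad_def using False pr' \<open>poly c \<zeta> = 0\<close> by force
        then show False using nb by simp
      next
        case True
        \<comment> \<open>Here \<open>p\<close> is x2 - \<zeta> up to a unit, so its restriction can
          have a multiple zero only if y2 = 0; but then \<zeta> = a2, against p(a1, a2) = 1.\<close>
        have "[:-\<zeta>, 1:] dvd coeff p i" for i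
        proof -
          have "(\<Sum>i\<le>degree p. monom (poly (coeff p i) \<zeta>) i) = 0"
            using pz[of _ \<zeta>] True
            by (intro poly_eq_0_if_roots) (simp add: poly_sum poly_monom eval2_sum_form map_poly_of_real_real)
          then have "coeff (\<Sum>i\<le>degree p. monom (poly (coeff p i) \<zeta>) i) i = 0" by simp
          then have "poly (coeff p i) \<zeta> = 0"
            by (cases "i \<le> degree p") (auto simp: coeff_sum sum.delta coeff_eq_0)
          then show ?thesis by (simp only: poly_eq_0_iff_dvd)
        qed
        then have "[:[:-\<zeta>, 1:]:] dvd p" by (simp add: const_poly_dvd_iff)
        then obtain g where g: "p = [:[:-\<zeta>, 1:]:] * g" by (rule dvdE)
        have "\<not> [:[:-\<zeta>, 1:]:] dvd 1"
          by (simp add: is_unit_const_poly_iff is_unit_iff_degree)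
        then have "g dvd 1" using p g by (metis irreducible_def)
        then obtain h where h: "1 = g * h" by (rule dvdE)
        obtain qg where qg: "\<And>t. eval2 g (of_real a1 + t * of_real y1) (of_real a2 + t * complex_of_real y2) = poly qg t"
          using eval2_line[of g "of_real a1" "of_real y1" "of_real a2" "complex_of_real y2"] by blast
        have ev: "eval2 p x1 x2 = (x2 - of_real \<zeta>) * eval2 g x1 x2" for x1 x2 :: complex
          by (simp only: g eval2_hom eval2_linear) simp
        have "poly (q - [:of_real (a2 - \<zeta>), of_real y2:] * qg) t = 0" for t
          unfolding poly_diff q[symmetric] ev qg by (simp add: algebra_simps)
        then have qq: "q = [:of_real (a2 - \<zeta>), of_real y2:] * qg"
          using poly_eq_0_if_roots[of "q - [:of_real (a2 - \<zeta>), of_real y2:] * qg"] by simp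
        have "poly (pderiv q) (of_real t) = of_real y2 * poly qg (of_real t) +
            (of_real (a2 - \<zeta>) + of_real t * of_real y2) * poly (pderiv qg) (of_real t)"
          unfolding qq pderiv_mult by (simp add: pderiv_pCons algebra_simps)
        moreover have "of_real (a2 - \<zeta>) + of_real t * complex_of_real y2 = 0" by (simp add: \<zeta>_def)
        ultimately have "of_real y2 * poly qg (complex_of_real t) = 0" using dq by simp
        moreover have "poly qg (of_real t) \<noteq> 0"
        proof
          assume "poly qg (of_real t) = 0"
          then have "eval2 (g * h) (of_real \<rho>) (complex_of_real \<zeta>) = 0"
            using qg[of "of_real t"] x by (simp add: eval2_hom)
          then show False unfolding h[symmetric] by simp
        qed
        ultimately have "\<zeta> = a2" by (simp add: \<zeta>_def)
        then have "eval2 p (of_real a1) (complex_of_real a2) = 0" using ev by simp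
        then show False using pa by (simp add: eval2_of_real)
      qed
    qed
  qed
  ultimately show thesis using that by blast
qed

text \<open>
  The exceptional polynomial need not be homogeneous, but interlacing is invariant under scaling
  and under translation along \<open>(1, a1, a2)\<close>, so some representative of almost every direction avoids
  its zeros.
\<close>

lemma interlacing_generic:
  assumes P: "homogeneous d P" and Q: "homogeneous e Q" and "interlaces a1 a2 Q P"
  obtains Bad :: "real set" where "finite Bad"
    "\<And>y1 y2 s1 s2. y1 \<noteq> 0 \<Longrightarrow> y2 / y1 \<notin> Bad \<Longrightarrow> s1 < s2 \<Longrightarrow>
      eval3 P s1 (y1 + s1 * a1) (y2 + s1 * a2) = 0 \<Longrightarrow> eval3 P s2 (y1 + s2 * a1) (y2 + s2 * a2) = 0 \<Longrightarrow>
      \<exists>s. s1 < s \<and> s < s2 \<and> eval3 Q s (y1 + s * a1) (y2 + s * a2) = 0"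
proof -
  obtain G where G: "G \<noteq> 0" and il: "\<And>X0 X1 X2 s1 s2 :: real. eval3 G X0 X1 X2 \<noteq> 0 \<Longrightarrow> s1 < s2 \<Longrightarrow>
     eval3 P (X0 + s1) (X1 + s1 * a1) (X2 + s1 * a2) = 0 \<Longrightarrow>
     eval3 P (X0 + s2) (X1 + s2 * a1) (X2 + s2 * a2) = 0 \<Longrightarrow>
     \<exists>s. s1 < s \<and> s < s2 \<and> eval3 Q (X0 + s) (X1 + s * a1) (X2 + s * a2) = 0"
    using assms(3) unfolding interlaces_def by blast
  obtain X0 X1 X2 :: real where X: "eval3 G X0 X1 X2 \<noteq> 0" using eval3_eq_0[of G] G by blast
  obtain q1 where q1: "\<And>t. eval3 G (X0 + t * 0) (0 + t * 1) (X2 + t * 0) = poly q1 t"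
    using eval3_line[of G X0 0 0 1 X2 0] by blast
  have "poly q1 X1 \<noteq> 0" using q1[of X1] X by simp
  then have "finite {t. poly q1 t = 0}" by (intro poly_roots_finite) auto
  then obtain x1 where x1: "x1 \<notin> insert (X0 * a1) {t. poly q1 t = 0}"
    using ex_new_if_finite[OF infinite_UNIV_char_0] by (metis finite_insert)
  \<comment> \<open>What remains of x1 after a translation along (1, a1, a2) to X0 = 0. It has to be
    nonzero so that varying the last coordinate reaches every slope y2 / y1.\<close>
  define c where "c = x1 - X0 * a1"
  have c0: "c \<noteq> 0" using x1 by (simp add: c_def)
  have G1: "eval3 G X0 x1 X2 \<noteq> 0" using x1 q1[of x1] by simp
  obtain q2 where q2: "\<And>t. eval3 G (X0 + t * 0) (x1 + t * 0) (X0 * a2 + t * c) = poly q2 t"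
    using eval3_line[of G X0 0 x1 0 "X0 * a2" c] by blast
  have "poly q2 ((X2 - X0 * a2) / c) \<noteq> 0" using q2[of "(X2 - X0 * a2) / c"] G1 c0 by simp
  then have fin: "finite {t. poly q2 t = 0}" by (intro poly_roots_finite) auto
  have "\<exists>s. s1 < s \<and> s < s2 \<and> eval3 Q s (y1 + s * a1) (y2 + s * a2) = 0"
    if y1: "y1 \<noteq> 0" and nb: "y2 / y1 \<notin> {t. poly q2 t = 0}" and s: "s1 < s2"
      "eval3 P s1 (y1 + s1 * a1) (y2 + s1 * a2) = 0" "eval3 P s2 (y1 + s2 * a1) (y2 + s2 * a2) = 0"
    for y1 y2 s1 s2
  proof -
    \<comment> \<open>Scaling by \<open>k\<close> carries the given line to one through a point
      where \<open>G\<close> does not vanish. A negative \<open>k\<close> reverses the order of the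
      zeros, whence the two cases below.\<close>
    define k where "k = c / y1"
    have k0: "k \<noteq> 0" using c0 y1 by (simp add: k_def)
    define x2 where "x2 = X0 * a2 + c * (y2 / y1)"
    have Gx: "eval3 G X0 x1 x2 \<noteq> 0" using q2[of "y2 / y1"] nb by (simp add: x2_def mult.commute)
    have scale: "eval3 R (X0 + (k * s - X0)) (x1 + (k * s - X0) * a1) (x2 + (k * s - X0) * a2) =
        k ^ n * eval3 R s (y1 + s * a1) (y2 + s * a2)" if "homogeneous n R" for R n s
    proof -
      have "X0 + (k * s - X0) = k * s" "x1 + (k * s - X0) * a1 = k * (y1 + s * a1)"
        "x2 + (k * s - X0) * a2 = k * (y2 + s * a2)"
        using y1 by (simp_all add: x2_def k_def c_def field_simps)
      then show ?thesis by (simp only: homogeneous_eval3_scale[OF that])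
    qed
    have "eval3 P (X0 + (k * s - X0)) (x1 + (k * s - X0) * a1) (x2 + (k * s - X0) * a2) = 0"
      if "s = s1 \<or> s = s2" for s
      unfolding scale[OF P] using that s by auto
    note r = this[of s1, simplified] this[of s2, simplified]
    have "\<exists>v. (k * s1 - X0 < v \<and> v < k * s2 - X0 \<or> k * s2 - X0 < v \<and> v < k * s1 - X0) \<and>
        eval3 Q (X0 + v) (x1 + v * a1) (x2 + v * a2) = 0"
    proof (cases "k > 0")
      case True
      then have "k * s1 - X0 < k * s2 - X0" using s(1) by simp
      from il[OF Gx this] r show ?thesis by auto
    next
      case False
      then have "k * s2 - X0 < k * s1 - X0" using s(1) k0 by (simp add: mult_less_cancel_left)
      from il[OF Gx this] r show ?thesis by auto
    qed
    then obtain v where v: "k * s1 - X0 < v \<and> v < k * s2 - X0 \<or> k * s2 - X0 < v \<and> v < k * s1 - X0"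
      "eval3 Q (X0 + v) (x1 + v * a1) (x2 + v * a2) = 0" by blast
    define s' where "s' = (v + X0) / k"
    have vs: "v = k * s' - X0" using k0 by (simp add: s'_def)
    have "eval3 Q s' (y1 + s' * a1) (y2 + s' * a2) = 0"
      using v(2) k0 unfolding vs scale[OF Q] by simp
    moreover have "s1 < s' \<and> s' < s2"
    proof -
      have "k * s1 < k * s' \<and> k * s' < k * s2 \<or> k * s2 < k * s' \<and> k * s' < k * s1"
        using v(1) unfolding vs by auto
      then show ?thesis using s(1) by (auto simp: mult_less_cancel_left)
    qed
    ultimately show ?thesis by blast
  qed
  then show thesis using that fin by blast
qed

lemma interlaced_cong:
  assumes "\<And>j. j \<le> m \<Longrightarrow> f j = f' j" "\<And>j. j < m \<Longrightarrow> q j = q' j"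
  shows "interlaced m f q \<longleftrightarrow> interlaced m f' q'"
proof -
  have A: "(\<Sum>l\<le>m. f l * x ^ l) = (\<Sum>l\<le>m. f' l * x ^ l)" for x
    using assms(1) by (intro sum.cong) auto
  have B: "(\<Sum>l\<in>{b<..m}. f l * x ^ (l - 1 - b)) = (\<Sum>l\<in>{b<..m}. f' l * x ^ (l - 1 - b))" for b x
    using assms(1) by (intro sum.cong) auto
  show ?thesis unfolding interlaced_def A B using assms(2) by simp
qed

lemma interlaced_generic:
  assumes p: "irreducible p" and rz: "real_zero_poly a1 a2 p" and pa: "eval2 p a1 a2 = (1 :: real)"
    and m: "0 < m" "total_degree p = m" and Q: "homogeneous (m - 1) Q"
    and il: "interlaces a1 a2 Q (homogenization p)"
  obtains Bad :: "real set" where "finite Bad"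
    "\<And>(y1 :: real) (y2 :: real) F G. y1 \<noteq> 0 \<Longrightarrow> y2 / y1 \<notin> Bad \<Longrightarrow> F m = 1 \<Longrightarrow> G (m - 1) = 1 \<Longrightarrow>
      (\<And>s. (\<Sum>j\<le>m. F j * s ^ j) =
        line_eval (homogenization p) a1 a2 y1 y2 s) \<Longrightarrow>
      (\<And>s. (\<Sum>j\<le>m - 1. G j * s ^ j) =
        line_eval Q a1 a2 y1 y2 s) \<Longrightarrow> interlaced m F G"
proof -
  let ?P = "homogenization p"
  obtain B1 where B1: "finite B1" "\<And>(y1 :: real) (y2 :: real) f z. y1 \<noteq> 0 \<Longrightarrow> y2 / y1 \<notin> B1 \<Longrightarrow>
      (\<And>s. poly f s = line_eval ?P a1 a2 y1 y2 s) \<Longrightarrow>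
      poly f z = 0 \<Longrightarrow> poly (pderiv f) z \<noteq> 0"
    using simple_zeros_generic[OF p rz pa] by metis
  have P: "homogeneous m ?P" using homogeneous_homogenization[of p] m by simp
  obtain B2 where B2: "finite B2"
    "\<And>y1 y2 s1 s2. y1 \<noteq> 0 \<Longrightarrow> y2 / y1 \<notin> B2 \<Longrightarrow> s1 < s2 \<Longrightarrow>
      eval3 ?P s1 (y1 + s1 * a1) (y2 + s1 * a2) = 0 \<Longrightarrow> eval3 ?P s2 (y1 + s2 * a1) (y2 + s2 * a2) = 0 \<Longrightarrow>
      \<exists>s. s1 < s \<and> s < s2 \<and> eval3 Q s (y1 + s * a1) (y2 + s * a2) = 0"
    using interlacing_generic[OF P Q il] by metis
  have "interlaced m F G"
    if y1: "y1 \<noteq> 0" and nb: "y2 / y1 \<notin> B1 \<union> B2" and lead: "F m = 1" "G (m - 1) = 1"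
      and F: "\<And>s. (\<Sum>j\<le>m. F j * s ^ j) = line_eval ?P a1 a2 y1 y2 s"
      and G: "\<And>s. (\<Sum>j\<le>m - 1. G j * s ^ j) = line_eval Q a1 a2 y1 y2 s"
    for y1 y2 :: real and F G
  proof -
    define f where "f = (\<Sum>j\<le>m. monom (F j) j)"
    define q where "q = (\<Sum>j\<le>m - 1. monom (G j) j)"
    have cf: "coeff f j = (if j \<le> m then F j else 0)" for j by (simp add: f_def coeff_sum sum.delta)
    have cq: "coeff q j = (if j \<le> m - 1 then G j else 0)" for j by (simp add: q_def coeff_sum sum.delta)
    have pf: "poly f s = line_eval ?P a1 a2 y1 y2 s" for s
      unfolding F[symmetric] f_def by (simp add: poly_sum poly_monom)
    have pq: "poly q s = line_eval Q a1 a2 y1 y2 s" for s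
      unfolding G[symmetric] q_def by (simp add: poly_sum poly_monom)
    have ofr: "eval3 R (of_real s) (of_real y1 + of_real s * of_real a1) (of_real y2 + of_real s * complex_of_real a2) =
      of_real (eval3 R s (y1 + s * a1) (y2 + s * a2))" for R s
      by (simp flip: eval3_of_real)
    have "interlaced m (coeff f) (coeff q)"
    proof (rule interlacedI)
      show "0 < m" by fact
      show "degree f \<le> m" by (intro degree_le) (simp add: cf)
      show "coeff f m = 1" using lead by (simp add: cf)
      show "degree q \<le> m - 1" by (intro degree_le) (simp add: cq)
      show "coeff q (m - 1) = 1" using lead by (simp add: cq)
      show "z \<in> \<real>" if "poly f z = 0" for z
        using real_zeros_on_lines[OF rz, of z y1 y2] that pf by simp
      show "poly (pderiv f) z \<noteq> 0" if "poly f z = 0" for z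
        using B1(2)[OF y1 _ pf that] nb by simp
      fix s1 s2 :: real assume "s1 < s2" "poly f (of_real s1) = 0" "poly f (of_real s2) = 0"
      then show "\<exists>s. s1 < s \<and> s < s2 \<and> poly q (of_real s) = 0"
        using B2(2)[OF y1, of y2 s1 s2] nb unfolding pf pq ofr by simp
    qed
    then show ?thesis
      using interlaced_cong[of m "coeff f" F "coeff q" G] by (simp add: cf cq)
  qed
  then show thesis using that[of "B1 \<union> B2"] B1(1) B2(1) by blast
qed

section \<open>The determinantal representation\<close>

lemma eval3_homogenization_one: "eval3 (homogenization p) 1 x1 x2 = eval2 p x1 x2"
  using eval3_homogenization_nonzero[of 1 p x1 x2] by simp

text \<open>Put c1 = x2 - a2 - \<beta> (x1 - a1) and c2 = x1 - a1. If c1 \<noteq> 0, then (1, x1,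
  x2) is c1 times the point on the line with z = 1 / c1, u = c2 / c1, and homogeneity turns the
  pencil into 1 - c1 A1 - c2 A2; expanding in x1 and x2 gives the three matrices.\<close>

lemma pencil_substitution:
  fixes A1 A2 :: "complex mat" and a1 a2 \<beta> :: real
  assumes A: "A1 \<in> carrier_mat m m" "A2 \<in> carrier_mat m m"
    and P: "homogeneous m P" and Q: "homogeneous (m - 1) Q"
    and detP: "\<And>u z. det (pencil m A1 A2 u z) =
      eval3 P z (u + z * of_real a1) (1 + u * of_real \<beta> + z * of_real a2)"
    and detQ: "\<And>u z. det (mat_delete (pencil m A1 A2 u z) 0 0) =
      eval3 Q z (u + z * of_real a1) (1 + u * of_real \<beta> + z * of_real a2)"
  defines "C0 \<equiv> 1\<^sub>m m + of_real (a2 - \<beta> * a1) \<cdot>\<^sub>m A1 + of_real a1 \<cdot>\<^sub>m A2"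
    and "C1 \<equiv> of_real \<beta> \<cdot>\<^sub>m A1 - A2" and "C2 \<equiv> - A1"
  shows "det (C0 + x1 \<cdot>\<^sub>m C1 + x2 \<cdot>\<^sub>m C2) = eval3 P 1 x1 x2"
    and "det (mat_delete (C0 + x1 \<cdot>\<^sub>m C1 + x2 \<cdot>\<^sub>m C2) 0 0) = eval3 Q 1 x1 x2"
proof -
  have C: "C0 \<in> carrier_mat m m" "C1 \<in> carrier_mat m m" "C2 \<in> carrier_mat m m"
    unfolding C0_def C1_def C2_def using A by auto
  have generic: "det (C0 + x1 \<cdot>\<^sub>m C1 + x2 \<cdot>\<^sub>m C2) = eval3 P 1 x1 x2 \<and>
    det (mat_delete (C0 + x1 \<cdot>\<^sub>m C1 + x2 \<cdot>\<^sub>m C2) 0 0) = eval3 Q 1 x1 x2"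
    if ne: "x2 \<noteq> of_real a2 + of_real \<beta> * (x1 - of_real a1)" for x1 x2 :: complex
  proof -
    define c2 where "c2 = x1 - of_real a1"
    define c1 where "c1 = x2 - of_real a2 - of_real \<beta> * c2"
    have c1: "c1 \<noteq> 0" using ne by (auto simp: c1_def c2_def algebra_simps)
    define z where "z = 1 / c1"
    define u where "u = c2 / c1"
    define M where "M = pencil m A1 A2 u z"
    have M: "M \<in> carrier_mat m m" unfolding M_def using A by (intro minus_carrier_mat) auto
    have cz: "c1 * z = 1" "c1 * u = c2" using c1 by (simp_all add: z_def u_def)
    have eq: "C0 + x1 \<cdot>\<^sub>m C1 + x2 \<cdot>\<^sub>m C2 = c1 \<cdot>\<^sub>m M"
    proof (rule eq_matI)
      fix i j assume "i < dim_row (c1 \<cdot>\<^sub>m M)" "j < dim_col (c1 \<cdot>\<^sub>m M)"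
      then have ij: "i < m" "j < m" using M by auto
      have "(c1 \<cdot>\<^sub>m M) $$ (i, j) = (c1 * z) * (1\<^sub>m m $$ (i, j)) - (c1 * A1 $$ (i, j) + (c1 * u) * A2 $$ (i, j))"
        using ij A by (simp add: M_def algebra_simps)
      also have "\<dots> = 1\<^sub>m m $$ (i, j) - (c1 * A1 $$ (i, j) + c2 * A2 $$ (i, j))" by (simp add: cz)
      also have "\<dots> = (C0 + x1 \<cdot>\<^sub>m C1 + x2 \<cdot>\<^sub>m C2) $$ (i, j)"
        using ij A by (simp add: C0_def C1_def C2_def c1_def c2_def algebra_simps)
      finally show "(C0 + x1 \<cdot>\<^sub>m C1 + x2 \<cdot>\<^sub>m C2) $$ (i, j) = (c1 \<cdot>\<^sub>m M) $$ (i, j)" by simp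
    qed (use C M in auto)
    have hom: "c1 ^ n * eval3 R z (u + z * of_real a1) (1 + u * of_real \<beta> + z * of_real a2) = eval3 R 1 x1 x2"
      if "homogeneous n R" for n R
    proof -
      have "c1 * z = 1" "c1 * (u + z * of_real a1) = x1" "c1 * (1 + u * of_real \<beta> + z * of_real a2) = x2"
        using c1 by (simp_all add: z_def u_def field_simps) (simp_all add: c1_def c2_def algebra_simps)
      then show ?thesis using homogeneous_eval3_scale[OF that, of c1 z "u + z * of_real a1" "1 + u * of_real \<beta> + z * of_real a2"]
        by simp
    qed
    have "mat_delete (c1 \<cdot>\<^sub>m M) 0 0 = c1 \<cdot>\<^sub>m mat_delete M 0 0"
      by (rule eq_matI) (auto simp: mat_delete_def)
    moreover have "mat_delete M 0 0 \<in> carrier_mat (m - 1) (m - 1)" using M by (rule mat_delete_carrier)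
    ultimately have "det (mat_delete (c1 \<cdot>\<^sub>m M) 0 0) = c1 ^ (m - 1) * det (mat_delete M 0 0)"
      using carrier_matD[OF M] by (simp add: det_smult)
    moreover have "det (c1 \<cdot>\<^sub>m M) = c1 ^ m * det M" using M by (simp add: det_smult)
    ultimately show ?thesis unfolding eq unfolding M_def detP detQ hom[OF P] hom[OF Q] by simp
  qed
  \<comment> \<open>With x1 fixed, c1 = 0 excludes a single x2, which is recovered because both
    sides are polynomial in x2.\<close>
  have ev: "\<forall>\<^sub>\<infinity>t :: real. complex_of_real t \<noteq> of_real a2 + of_real \<beta> * (x1 - of_real a1)"
    by (rule cofinite_neq)
  have C01: "C0 + x1 \<cdot>\<^sub>m C1 \<in> carrier_mat m m" using C by auto
  obtain d where d: "\<And>t. det (C0 + x1 \<cdot>\<^sub>m C1 + t \<cdot>\<^sub>m C2) = poly d t"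
    using det_linear_poly[OF C01 C(3)] by blast
  obtain d' where d': "\<And>t. eval3 P (1 + t * 0) (x1 + t * 0) (0 + t * 1) = poly d' t"
    using eval3_line[of P 1 0 x1 0 0 1] by blast
  have d'': "eval3 P 1 x1 t = poly d' t" for t using d'[of t] by simp
  have "d = d'"
    by (rule poly_eqI_cofinite, rule eventually_mono[OF ev])
      (unfold d[symmetric] d''[symmetric], erule generic[THEN conjunct1])
  then show "det (C0 + x1 \<cdot>\<^sub>m C1 + x2 \<cdot>\<^sub>m C2) = eval3 P 1 x1 x2"
    using d[of x2] d'[of x2] by simp
  have split: "mat_delete (C0 + x1 \<cdot>\<^sub>m C1 + t \<cdot>\<^sub>m C2) 0 0 =
      mat_delete (C0 + x1 \<cdot>\<^sub>m C1) 0 0 + t \<cdot>\<^sub>m mat_delete C2 0 0" for t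
    using C by (intro eq_matI) (auto simp: mat_delete_def)
  have D: "mat_delete (C0 + x1 \<cdot>\<^sub>m C1) 0 0 \<in> carrier_mat (m - 1) (m - 1)"
    "mat_delete C2 0 0 \<in> carrier_mat (m - 1) (m - 1)"
    by (rule mat_delete_carrier[OF C01], rule mat_delete_carrier[OF C(3)])
  obtain e where e: "\<And>t. det (mat_delete (C0 + x1 \<cdot>\<^sub>m C1 + t \<cdot>\<^sub>m C2) 0 0) = poly e t"
    unfolding split using det_linear_poly[OF D] by blast
  obtain e' where e': "\<And>t. eval3 Q (1 + t * 0) (x1 + t * 0) (0 + t * 1) = poly e' t"
    using eval3_line[of Q 1 0 x1 0 0 1] by blast
  have e'': "eval3 Q 1 x1 t = poly e' t" for t using e'[of t] by simp
  have "e = e'"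
    by (rule poly_eqI_cofinite, rule eventually_mono[OF ev])
      (unfold e[symmetric] e''[symmetric], erule generic[THEN conjunct2])
  then show "det (mat_delete (C0 + x1 \<cdot>\<^sub>m C1 + x2 \<cdot>\<^sub>m C2) 0 0) = eval3 Q 1 x1 x2"
    using e[of x2] e'[of x2] by simp
qed

lemma total_degree_pos:
  assumes "irreducible p"
  shows "0 < total_degree p"
proof (rule ccontr)
  assume "\<not> 0 < total_degree p"
  then have c: "coeff (coeff p i) j = 0" if "i + j > 0" for i j
    using total_degree_ge[of p i j] that by auto
  define c0 where "c0 = coeff (coeff p 0) 0"
  have pc: "p = [:[:c0:]:]"
    by (intro poly_eqI) (use c in \<open>auto simp: c0_def coeff_pCons split: nat.splits\<close>)
  have "c0 \<noteq> 0" using assms pc by auto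
  then have "p dvd 1" unfolding pc by (simp add: is_unit_const_poly_iff dvd_field_iff)
  then show False using assms by (simp add: irreducible_def)
qed

lemma hermitian_mat_add_smult:
  "hermitian_mat n A \<Longrightarrow> hermitian_mat n B \<Longrightarrow> hermitian_mat n (A + complex_of_real r \<cdot>\<^sub>m B)"
  by (auto simp: hermitian_mat_ctr ctr_add[of _ n n] ctr_smult)

theorem theorem5p4:
  fixes p :: "real poly poly" and P Q :: "real poly poly poly"
    and a1 a2 :: real and m :: nat
    and S :: "'a topology" and \<A> :: "'a chart set" and \<nu> :: "'a \<Rightarrow> ppoint"
  assumes "irreducible p"
    and "real_zero_poly a1 a2 p"
    and "total_degree p = m"
    and "eval2 p a1 a2 = 1"
    and "P = homogenization p"
    and "desingularization P S \<A> \<nu>"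
    and "homogeneous (m - 1) Q"
    and "interlaces a1 a2 Q P"
    and "eval3 Q 1 a1 a2 = 1"
    and "adjoint_divisor S \<A> \<nu> P \<le> pullback_divisor S \<A> \<nu> Q"
  shows "\<exists>A0 A1 A2 :: complex mat.
      hermitian_mat m A0 \<and> hermitian_mat m A1 \<and> hermitian_mat m A2 \<and>
      A0 + of_real a1 \<cdot>\<^sub>m A1 + of_real a2 \<cdot>\<^sub>m A2 = 1\<^sub>m m \<and>
      (\<forall>x1 x2 :: complex.
         Determinant.det (A0 + x1 \<cdot>\<^sub>m A1 + x2 \<cdot>\<^sub>m A2) = eval2 p x1 x2 \<and>
         Determinant.det (mat_delete (A0 + x1 \<cdot>\<^sub>m A1 + x2 \<cdot>\<^sub>m A2) 0 0) = eval3 Q 1 x1 x2)"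
proof -
  note p = assms(1) and rz = assms(2) and m = assms(3) and pa = assms(4) and P = assms(5)
    and Q = assms(7) and il = assms(8) and Qa = assms(9)
  have m0: "0 < m" using total_degree_pos[OF p] m by simp
  have hP: "homogeneous m P" using homogeneous_homogenization[of p] m P by simp
  obtain Bad :: "real set" where Bad: "finite Bad"
    "\<And>(y1 :: real) (y2 :: real) F G. y1 \<noteq> 0 \<Longrightarrow> y2 / y1 \<notin> Bad \<Longrightarrow> F m = 1 \<Longrightarrow> G (m - 1) = 1 \<Longrightarrow>
      (\<And>s. (\<Sum>j\<le>m. F j * s ^ j) =
        line_eval P a1 a2 y1 y2 s) \<Longrightarrow>
      (\<And>s. (\<Sum>j\<le>m - 1. G j * s ^ j) =
        line_eval Q a1 a2 y1 y2 s) \<Longrightarrow> interlaced m F G"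
    unfolding P by (rule interlaced_generic[OF p rz pa m0 m Q il[unfolded P]]) blast
  obtain \<beta> :: real where \<beta>: "\<beta> \<notin> Bad" using ex_new_if_finite[OF infinite_UNIV_char_0 Bad(1)] by blast
  obtain F where F: "\<And>j. j \<le> m \<Longrightarrow> deg_le (F j) (int m - int j)"
    "\<And>s u. (\<Sum>j\<le>m. poly (F j) u * s ^ j) = eval3 P s (u + s * of_real a1) (1 + u * of_real \<beta> + s * of_real a2)"
    "\<And>s. (\<Sum>j\<le>m. coeff (F j) (m - j) * s ^ j) = eval3 P s (1 + s * of_real a1) (of_real \<beta> + s * of_real a2)"
    "F m = [:eval3 P 1 (of_real a1) (of_real a2):]"
    by (rule line_restriction[OF hP, of "of_real a1" "of_real \<beta>" "of_real a2"]) blast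
  obtain G where G: "\<And>j. j \<le> m - 1 \<Longrightarrow> deg_le (G j) (int (m - 1) - int j)"
    "\<And>s u. (\<Sum>j\<le>m - 1. poly (G j) u * s ^ j) = eval3 Q s (u + s * of_real a1) (1 + u * of_real \<beta> + s * of_real a2)"
    "\<And>s. (\<Sum>j\<le>m - 1. coeff (G j) (m - 1 - j) * s ^ j) = eval3 Q s (1 + s * of_real a1) (of_real \<beta> + s * of_real a2)"
    "G (m - 1) = [:eval3 Q 1 (of_real a1) (of_real a2):]"
    by (rule line_restriction[OF Q, of "of_real a1" "of_real \<beta>" "of_real a2"]) blast
  have "eval3 P 1 (of_real a1) (complex_of_real a2) = 1"
    unfolding P eval3_homogenization_one eval2_of_real pa by simp
  then have Fm: "F m = 1" using F(4) by (simp add: one_pCons)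
  have "eval3 Q (of_real 1) (of_real a1) (complex_of_real a2) = 1"
    unfolding eval3_of_real Qa by simp
  then have Gm: "G (m - 1) = 1" using G(4) by (simp add: one_pCons)
  have gen: "\<forall>\<^sub>\<infinity>u :: real. interlaced m (\<lambda>j. poly (F j) (of_real u)) (\<lambda>j. poly (G j) (of_real u))"
  proof -
    \<comment> \<open>The slope of (u, 1 + u \<beta>) is \<beta> + 1 / u, which takes each bad value
      for at most one u.\<close>
    have "{u. \<not> (u \<noteq> 0 \<and> (1 + u * \<beta>) / u \<notin> Bad)} \<subseteq> insert 0 ((\<lambda>\<gamma>. 1 / (\<gamma> - \<beta>)) ` Bad)"
    proof
      fix u assume u: "u \<in> {u. \<not> (u \<noteq> 0 \<and> (1 + u * \<beta>) / u \<notin> Bad)}"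
      show "u \<in> insert 0 ((\<lambda>\<gamma>. 1 / (\<gamma> - \<beta>)) ` Bad)"
      proof (cases "u = 0")
        case False
        then have "(1 + u * \<beta>) / u - \<beta> = 1 / u" by (simp add: add_divide_distrib)
        then have "u = 1 / ((1 + u * \<beta>) / u - \<beta>)" by simp
        moreover have "(1 + u * \<beta>) / u \<in> Bad" using u False by blast
        ultimately show ?thesis by (intro insertI2 image_eqI)
      qed simp
    qed
    then have "finite {u. \<not> (u \<noteq> 0 \<and> (1 + u * \<beta>) / u \<notin> Bad)}"
      by (rule finite_subset) (use Bad(1) in simp)
    then have "\<forall>\<^sub>\<infinity>u :: real. u \<noteq> 0 \<and> (1 + u * \<beta>) / u \<notin> Bad"
      by (simp add: eventually_cofinite)
    then show ?thesis
    proof (rule eventually_mono)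
      fix u assume u: "u \<noteq> 0 \<and> (1 + u * \<beta>) / u \<notin> Bad"
      show "interlaced m (\<lambda>j. poly (F j) (of_real u)) (\<lambda>j. poly (G j) (of_real u))"
        by (rule Bad(2)[of u "1 + u * \<beta>"]) (use u Fm Gm F(2) G(2) in auto)
    qed
  qed
  \<comment> \<open>The limiting line u = \<infinity> has slope \<beta>, itself chosen outside
    \<open>Bad\<close>.\<close>
  have top: "interlaced m (\<lambda>j. coeff (F j) (m - j)) (\<lambda>j. coeff (G j) (m - 1 - j))"
    by (rule Bad(2)[of 1 \<beta>]) (use \<beta> Fm Gm F(3) G(3) in auto)
  have deg: "deg_le (F j) (int m - int j)" "deg_le (G j) (int m - 1 - int j)" if "j < m" for j
    using F(1)[of j] G(1)[of j] that m0 by (auto simp: of_nat_diff)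
  obtain A1 A2 where A: "hermitian_mat m A1" "hermitian_mat m A2"
    "\<And>u z. det (pencil m A1 A2 u z) = (\<Sum>j\<le>m. poly (F j) u * z ^ j)"
    "\<And>u z. det (mat_delete (pencil m A1 A2 u z) 0 0) = (\<Sum>j<m. poly (G j) u * z ^ j)"
    using determinantal_pencil[OF m0 Fm Gm deg gen top] by blast
  have c: "A1 \<in> carrier_mat m m" "A2 \<in> carrier_mat m m" using A by (auto simp: hermitian_mat_ctr)
  have dP: "det (pencil m A1 A2 u z) =
      eval3 P z (u + z * of_real a1) (1 + u * of_real \<beta> + z * of_real a2)" for u z
    unfolding A(3) F(2) ..
  have lm: "{..<m} = {..m - 1}" using m0 by auto
  have dQ: "det (mat_delete (pencil m A1 A2 u z) 0 0) =
      eval3 Q z (u + z * of_real a1) (1 + u * of_real \<beta> + z * of_real a2)" for u z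
    unfolding A(4) lm G(2) ..
  define C0 where "C0 = 1\<^sub>m m + of_real (a2 - \<beta> * a1) \<cdot>\<^sub>m A1 + complex_of_real a1 \<cdot>\<^sub>m A2"
  define C1 where "C1 = complex_of_real \<beta> \<cdot>\<^sub>m A1 - A2"
  define C2 where "C2 = - A1"
  note main = pencil_substitution[OF c hP Q dP dQ, folded C0_def C1_def C2_def]
  have "hermitian_mat m (1\<^sub>m m)" by (simp add: hermitian_mat_ctr)
  then have h0: "hermitian_mat m C0" unfolding C0_def using A by (intro hermitian_mat_add_smult)
  have z: "hermitian_mat m (0\<^sub>m m m)" by (auto simp: hermitian_mat_ctr intro!: eq_matI)
  have "C1 = 0\<^sub>m m m + complex_of_real \<beta> \<cdot>\<^sub>m A1 + complex_of_real (- 1) \<cdot>\<^sub>m A2"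
    unfolding C1_def using c by (intro eq_matI) auto
  then have h1: "hermitian_mat m C1" using z A by (simp only:) (intro hermitian_mat_add_smult)
  have "C2 = 0\<^sub>m m m + complex_of_real (- 1) \<cdot>\<^sub>m A1"
    unfolding C2_def using c by (intro eq_matI) auto
  then have h2: "hermitian_mat m C2" using z A by (simp only:) (intro hermitian_mat_add_smult)
  have "C0 + of_real a1 \<cdot>\<^sub>m C1 + of_real a2 \<cdot>\<^sub>m C2 = 1\<^sub>m m"
    unfolding C0_def C1_def C2_def using c by (intro eq_matI) (auto simp: algebra_simps)
  moreover have "eval3 P 1 x1 x2 = eval2 p x1 x2" for x1 x2 :: complex
    unfolding P by (rule eval3_homogenization_one)
  ultimately show ?thesis using h0 h1 h2 main by (intro exI[of _ C0] exI[of _ C1] exI[of _ C2]) simp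
qed

end
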